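(* Let $\lambda$ be a partition with at most $n$ parts and $\lambda_1>0$, and let $\lambda'$ denote its conjugate partition and $\ell(\lambda)$ its number of nonzero parts. For every subset $S\subseteq\{1,\dots,n\}$ with $\#S=\ell(\lambda)$, $$\sum_{\substack{\mu\in S_n(\lambda)\\ \mathrm{Supp}(\mu)=S}}f^*_\mu(x_1,\dots,x_n;1,t)=\prod_{i\in S}\left(x_i-\frac{t^{\#(S^c\cap\{1,\dots,i-1\})}}{t^{n-1}}\right)\prod_{2\le i\le\lambda_1}e^*_{\lambda'_i}(x_1,\dots,x_n;t).$$ Consequently, for every partition $\lambda$ with at most $n$ parts, $$P^*_\lambda(x_1,\dots,x_n;1,t)=\prod_{1\le i\le\lambda_1}P^*_{(1^{\lambda'_i},0^{n-\lambda'_i})}(x_1,\dots,x_n;1,t)=\prod_{1\le i\le\lambda_1}e^*_{\lambda'_i}(x_1,\dots,x_n;t).$$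
   Context: Polynomials are in $x_1,\dots,x_n$ over $\mathbb{Q}(q,t)$; $f(x;1,t)$ denotes specialization at $q=1$. For $\mu\in\mathbb{N}^n$ let $k_i(\mu)=\#\{j<i:\mu_j>\mu_i\}+\#\{j>i:\mu_j\ge\mu_i\}$ and $\widetilde\mu=(q^{\mu_1}t^{-k_1(\mu)},\dots,q^{\mu_n}t^{-k_n(\mu)})$. For $\mu\in\mathbb{N}^n$, $|\mu|=d$, $E^*_\mu$ is the unique polynomial of degree at most $d$ with coefficient of $x^\mu$ equal to $1$ and $E^*_\mu(\widetilde\nu)=0$ for all $\nu\in\mathbb{N}^n$, $|\nu|\le d$, $\nu\ne\mu$. $S_n$ acts on compositions by $\sigma\cdot\mu=(\mu_{\sigma^{-1}(1)},\dots,\mu_{\sigma^{-1}(n)})$ and on polynomials by permuting variables; $s_i=(i,i+1)$; $T_i=t-\frac{tx_i-x_{i+1}}{x_i-x_{i+1}}(1-s_i)$; $T_\sigma=T_{i_1}\cdots T_{i_\ell}$ for a reduced word. $S_n(\lambda)$ is the set of rearrangements of $\lambda$; for $\mu\in S_n(\lambda)$, $\sigma_\mu$ is the shortest permutation with $\sigma_\mu(\lambda)=\mu$ and $f^*_\mu=T_{\sigma_\mu}E^*_\lambda$. $P^*_\lambda$ is the unique symmetric polynomial of degree at most $|\lambda|$ with coefficient $1$ on the monomial symmetric polynomial $m_\lambda$ and vanishing at $\widetilde\nu$ for every partition $\nu\ne\lambda$ with $|\nu|\le|\lambda|$. $\mathrm{Supp}(\mu)=\{i:\mu_i>0\}$,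 $S^c$ is the complement of $S$ in $\{1,\dots,n\}$, and for $k\ge0$, $$e^*_k(x_1,\dots,x_n;t)=\sum_{S\subseteq\{1,\dots,n\},\ \#S=k}\ \prod_{i\in S}\left(x_i-\frac{t^{\#(S^c\cap\{1,\dots,i-1\})}}{t^{n-1}}\right).$$ *)

theory Defs
  imports "HOL-Library.Poly_Mapping" "HOL-Computational_Algebra.Polynomial"
    "HOL-Computational_Algebra.Fraction_Field" "HOL-Combinatorics.Permutations"
    "HOL-Combinatorics.Transposition"
begin

(* Multivariate polynomials: maps from exponent vectors (nat \<Rightarrow>\<^sub>0 nat) to coefficients.
   Variables are indexed 0..n-1 (x_{i+1} of the paper is variable i here). *)
type_synonym 'a mpoly = "(nat \<Rightarrow>\<^sub>0 nat) \<Rightarrow>\<^sub>0 'a"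

definition mvar :: "nat \<Rightarrow> 'a::comm_ring_1 mpoly" where
  "mvar i = Poly_Mapping.single (Poly_Mapping.single i 1) 1"

definition mconst :: "'a::comm_ring_1 \<Rightarrow> 'a mpoly" where
  "mconst c = Poly_Mapping.single 0 c"

definition mmon :: "nat list \<Rightarrow> (nat \<Rightarrow>\<^sub>0 nat)" where
  "mmon \<alpha> = Poly_Mapping.nth \<alpha>"

definition mdeg :: "(nat \<Rightarrow>\<^sub>0 nat) \<Rightarrow> nat" where
  "mdeg m = sum (Poly_Mapping.lookup m) (Poly_Mapping.keys m)"

definition in_vars :: "nat \<Rightarrow> 'a::zero mpoly \<Rightarrow> bool" where
  "in_vars n p \<longleftrightarrow> (\<forall>m\<in>Poly_Mapping.keys p. Poly_Mapping.keys m \<subseteq> {..<n})"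

definition total_deg_le :: "'a::zero mpoly \<Rightarrow> nat \<Rightarrow> bool" where
  "total_deg_le p d \<longleftrightarrow> (\<forall>m\<in>Poly_Mapping.keys p. mdeg m \<le> d)"

definition meval :: "'a::comm_ring_1 mpoly \<Rightarrow> (nat \<Rightarrow> 'a) \<Rightarrow> 'a" where
  "meval p z = (\<Sum>m\<in>Poly_Mapping.keys p. Poly_Mapping.lookup p m * (\<Prod>i\<in>Poly_Mapping.keys m. z i ^ Poly_Mapping.lookup m i))"

definition mon_perm :: "(nat \<Rightarrow> nat) \<Rightarrow> (nat \<Rightarrow>\<^sub>0 nat) \<Rightarrow> (nat \<Rightarrow>\<^sub>0 nat)" where
  "mon_perm \<sigma> m = (\<Sum>i\<in>Poly_Mapping.keys m. Poly_Mapping.single (\<sigma> i) (Poly_Mapping.lookup m i))"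

definition mperm :: "(nat \<Rightarrow> nat) \<Rightarrow> 'a::comm_ring_1 mpoly \<Rightarrow> 'a mpoly" where
  "mperm \<sigma> p = (\<Sum>m\<in>Poly_Mapping.keys p. Poly_Mapping.single (mon_perm \<sigma> m) (Poly_Mapping.lookup p m))"

definition mswap :: "nat \<Rightarrow> 'a::comm_ring_1 mpoly \<Rightarrow> 'a mpoly" where
  "mswap i p = mperm (transpose i (Suc i)) p"

definition divdiff :: "nat \<Rightarrow> 'a::field mpoly \<Rightarrow> 'a mpoly" where
  "divdiff i f = (THE g. (mvar i - mvar (Suc i)) * g = f - mswap i f)"

definition Ti :: "'a::field \<Rightarrow> nat \<Rightarrow> 'a mpoly \<Rightarrow> 'a mpoly" where
  "Ti t i f = mconst t * f - (mconst t * mvar i - mvar (Suc i)) * divdiff i f"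

definition perm_word :: "nat list \<Rightarrow> nat \<Rightarrow> nat" where
  "perm_word w = foldr (\<lambda>i g. transpose i (Suc i) \<circ> g) w id"

definition valid_word :: "nat \<Rightarrow> nat list \<Rightarrow> bool" where
  "valid_word n w \<longleftrightarrow> (\<forall>i\<in>set w. Suc i < n)"

definition perm_len :: "nat \<Rightarrow> (nat \<Rightarrow> nat) \<Rightarrow> nat" where
  "perm_len n \<sigma> = (LEAST k. \<exists>w. valid_word n w \<and> perm_word w = \<sigma> \<and> length w = k)"

definition reduced_word :: "nat \<Rightarrow> (nat \<Rightarrow> nat) \<Rightarrow> nat list \<Rightarrow> bool" where
  "reduced_word n \<sigma> w \<longleftrightarrow> valid_word n w \<and> perm_word w = \<sigma> \<and> length w = perm_len n \<sigma>"

definition Tperm :: "'a::field \<Rightarrow> nat \<Rightarrow> (nat \<Rightarrow> nat) \<Rightarrow> 'a mpoly \<Rightarrow> 'a mpoly" where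
  "Tperm t n \<sigma> f = foldr (Ti t) (SOME w. reduced_word n \<sigma> w) f"

definition comp_act :: "nat \<Rightarrow> (nat \<Rightarrow> nat) \<Rightarrow> nat list \<Rightarrow> nat list" where
  "comp_act n \<sigma> \<mu> = map (\<lambda>i. \<mu> ! (inv \<sigma> i)) [0..<n]"

definition sigma_mu :: "nat \<Rightarrow> nat list \<Rightarrow> nat list \<Rightarrow> nat \<Rightarrow> nat" where
  "sigma_mu n lam \<mu> = (SOME \<sigma>. \<sigma> permutes {..<n} \<and> comp_act n \<sigma> lam = \<mu> \<and>
      (\<forall>\<tau>. \<tau> permutes {..<n} \<and> comp_act n \<tau> lam = \<mu> \<longrightarrow> perm_len n \<sigma> \<le> perm_len n \<tau>))"

definition kk :: "nat list \<Rightarrow> nat \<Rightarrow> nat" where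
  "kk \<mu> i = card {j. j < i \<and> \<mu> ! j > \<mu> ! i} + card {j. i < j \<and> j < length \<mu> \<and> \<mu> ! j \<ge> \<mu> ! i}"

definition tilde :: "'a::field \<Rightarrow> 'a \<Rightarrow> nat list \<Rightarrow> nat \<Rightarrow> 'a" where
  "tilde q t \<mu> i = q ^ (\<mu> ! i) / t ^ (kk \<mu> i)"

definition Estar :: "'a::field \<Rightarrow> 'a \<Rightarrow> nat \<Rightarrow> nat list \<Rightarrow> 'a mpoly" where
  "Estar q t n \<mu> = (THE p. in_vars n p \<and> total_deg_le p (sum_list \<mu>) \<and> Poly_Mapping.lookup p (mmon \<mu>) = 1 \<and>
      (\<forall>\<nu>. length \<nu> = n \<and> sum_list \<nu> \<le> sum_list \<mu> \<and> \<nu> \<noteq> \<mu> \<longrightarrow> meval p (tilde q t \<nu>) = 0))"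

definition fstar :: "'a::field \<Rightarrow> 'a \<Rightarrow> nat \<Rightarrow> nat list \<Rightarrow> nat list \<Rightarrow> 'a mpoly" where
  "fstar q t n lam \<mu> = Tperm t n (sigma_mu n lam \<mu>) (Estar q t n lam)"

(* partition with at most n parts, padded with zeros to length n *)
definition is_partition :: "nat \<Rightarrow> nat list \<Rightarrow> bool" where
  "is_partition n lam \<longleftrightarrow> length lam = n \<and> sorted_wrt (\<ge>) lam"

definition rearr :: "nat \<Rightarrow> nat list \<Rightarrow> nat list set" where
  "rearr n lam = {\<mu>. length \<mu> = n \<and> mset \<mu> = mset lam}"

definition symmetric_mp :: "nat \<Rightarrow> 'a::comm_ring_1 mpoly \<Rightarrow> bool" where
  "symmetric_mp n p \<longleftrightarrow> (\<forall>\<sigma>. \<sigma> permutes {..<n} \<longrightarrow> mperm \<sigma> p = p)"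

(* for symmetric p, coefficient on m_\<lambda> = coefficient of x^\<lambda> *)
definition Pstar :: "'a::field \<Rightarrow> 'a \<Rightarrow> nat \<Rightarrow> nat list \<Rightarrow> 'a mpoly" where
  "Pstar q t n lam = (THE p. in_vars n p \<and> symmetric_mp n p \<and> total_deg_le p (sum_list lam) \<and>
      Poly_Mapping.lookup p (mmon lam) = 1 \<and>
      (\<forall>\<nu>. is_partition n \<nu> \<and> \<nu> \<noteq> lam \<and> sum_list \<nu> \<le> sum_list lam \<longrightarrow> meval p (tilde q t \<nu>) = 0))"

definition supp :: "nat list \<Rightarrow> nat set" where
  "supp \<mu> = {i. i < length \<mu> \<and> 0 < \<mu> ! i}"

definition first_part :: "nat list \<Rightarrow> nat" where
  "first_part lam = Max (insert 0 (set lam))"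

definition conj_part :: "nat list \<Rightarrow> nat \<Rightarrow> nat" where
  "conj_part lam i = card {j. j < length lam \<and> i \<le> lam ! j}"

definition estar :: "'a::field \<Rightarrow> nat \<Rightarrow> nat \<Rightarrow> 'a mpoly" where
  "estar t n k = (\<Sum>S | S \<subseteq> {..<n} \<and> card S = k.
      \<Prod>i\<in>S. mvar i - mconst (t ^ card (({..<n} - S) \<inter> {..<i}) / t ^ (n - 1)))"

(* Coefficient field Q(q,t), realised as Q(t)(q) *)
type_synonym qt = "rat poly fract poly fract"

definition qq :: qt where "qq = Fract [:0, 1:] 1"
definition tq :: qt where "tq = Fract [: Fract [:0, 1:] 1 :] 1"
definition tt :: "rat poly fract" where "tt = Fract [:0, 1:] 1"

(* specialization q = 1 of an element of Q(t)(q) (defined when there is no pole at q = 1) *)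
definition spec_ok :: "qt \<Rightarrow> bool" where
  "spec_ok c \<longleftrightarrow> (\<exists>a b. c = Fract a b \<and> poly b 1 \<noteq> 0)"

definition spec :: "qt \<Rightarrow> rat poly fract" where
  "spec c = (THE v. \<exists>a b. c = Fract a b \<and> poly b 1 \<noteq> 0 \<and> v = poly a 1 / poly b 1)"

definition mspec_ok :: "qt mpoly \<Rightarrow> bool" where
  "mspec_ok p \<longleftrightarrow> (\<forall>m. spec_ok (Poly_Mapping.lookup p m))"

definition mspec :: "qt mpoly \<Rightarrow> rat poly fract mpoly" where
  "mspec p = Poly_Mapping.map spec p"

end

theory Submission
  imports Defs
begin

text \<open>
  Up to powers of \<open>q\<close>, the rotation \<open>p \<mapsto> (x\<^sub>1 - t\<^bsup>1-n\<^esup>) p(x\<^sub>2, \<dots>, x\<^sub>n, x\<^sub>1/q)\<close> and corrected operators \<open>T\<^sub>i\<close>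
  build every \<open>E\<^sup>*\<^sub>\<mu>\<close> from \<open>1\<close> and show how \<open>H(\<mu>)\<close>, the value of \<open>E\<^sup>*\<^sub>\<mu>\<close> at its own point, changes
  when two parts are swapped. The sum of \<open>f\<^sup>*\<^sub>\<mu>\<close> over the rearrangements supported in \<open>{1, \<dots>, k}\<close> is
  symmetric in \<open>x\<^sub>1, \<dots>, x\<^sub>k\<close>, hence takes a single value at their points, and its coefficient at
  \<open>E\<^sup>*\<^sub>\<nu>\<close> is \<open>H(M)/H(\<nu>)\<close>, where \<open>M\<close> increases on \<open>{1, \<dots>, k}\<close>. At \<open>q = 1\<close> only \<open>\<nu> = M\<close> survives.
  Rotating \<open>k = \<ell>(\<lambda>)\<close> times strips the first column of \<open>\<lambda>\<close>, which gives the factorisation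
  for \<open>S = {1, \<dots>, k}\<close>; applying \<open>T\<^sub>i\<close> moves \<open>S\<close>, and summing over \<open>S\<close> produces \<open>e\<^sup>*\<^sub>k\<close>.
\<close>

text \<open>At q = 1 a node keeps only the ranks \<open>kk\<close> of its composition, so different
  compositions share nodes and no vanishing argument survives there. All interpolation therefore
  happens over Q(q,t); only coefficients are specialised, and their regularity at q = 1 is carried
  along. T_i plus a constant meets the vanishing conditions at every descent, but its leading
  coefficient is under control only when the first nonzero part moves right across a zero. The rule
  for H under an arbitrary swap is transported from these cases through rotations, commutations and
  braid relations. The factor in that rule is (t y - x)/(y - x), with x and y the node's coordinates
  at the two positions; at q = 1 it vanishes when their ranks are consecutive. This happens on the
  last swap leading to M, which kills every term but one. Finally, f* is defined through a chosen
  permutation and a chosen reduced word; it is handled through the relation of being reachable from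
  E* by applying T_i at descents, and the Hecke relations show that this relation determines
  it.\<close>

section \<open>Multivariate polynomials\<close>

abbreviation mkeys :: "('k \<Rightarrow>\<^sub>0 'a::zero) \<Rightarrow> 'k set" where
  "mkeys \<equiv> Poly_Mapping.keys"

abbreviation coeff_at :: "'a::zero mpoly \<Rightarrow> (nat \<Rightarrow>\<^sub>0 nat) \<Rightarrow> 'a" where
  "coeff_at \<equiv> Poly_Mapping.lookup"

abbreviation expo :: "(nat \<Rightarrow>\<^sub>0 nat) \<Rightarrow> nat \<Rightarrow> nat" where
  "expo \<equiv> Poly_Mapping.lookup"

abbreviation mvexp :: "nat \<Rightarrow> (nat \<Rightarrow>\<^sub>0 nat)" where
  "mvexp i \<equiv> Poly_Mapping.single i 1"

abbreviation mterm :: "(nat \<Rightarrow>\<^sub>0 nat) \<Rightarrow> 'a::zero \<Rightarrow> 'a mpoly" where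
  "mterm \<equiv> Poly_Mapping.single"

abbreviation adj :: "nat \<Rightarrow> nat \<Rightarrow> nat" where
  "adj i \<equiv> transpose i (Suc i)"

abbreviation vdiff :: "nat \<Rightarrow> 'a::comm_ring_1 mpoly" where
  "vdiff i \<equiv> mvar i - mvar (Suc i)"

lemma mpoly_as_sum: "p = (\<Sum>m\<in>mkeys p. mterm m (coeff_at p m))"
  by (rule poly_mapping_eqI)
     (auto simp: lookup_sum lookup_single when_def in_keys_iff sum.delta')

lemma mpoly_term_induct [case_names zero add monom]:
  assumes "P 0" and "\<And>p q. P p \<Longrightarrow> P q \<Longrightarrow> P (p + q)"
    and "\<And>m. m \<in> mkeys p \<Longrightarrow> P (mterm m (coeff_at p m))"
  shows "P (p :: 'a::comm_ring_1 mpoly)"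
proof -
  have "P (\<Sum>m\<in>A. mterm m (coeff_at p m))" if "finite A" "A \<subseteq> mkeys p" for A
    using that by (induction A rule: finite_induct) (auto intro: assms)
  from this[of "mkeys p"] show ?thesis
    using mpoly_as_sum[of p] by simp
qed

section \<open>Evaluation of polynomials\<close>

definition mon_val :: "(nat \<Rightarrow> 'b::comm_ring_1) \<Rightarrow> (nat \<Rightarrow>\<^sub>0 nat) \<Rightarrow> 'b" where
  "mon_val z m = (\<Prod>i\<in>mkeys m. z i ^ expo m i)"

lemma mon_val_superset:
  assumes "finite A" "mkeys m \<subseteq> A"
  shows "mon_val z m = (\<Prod>i\<in>A. z i ^ expo m i)"
  unfolding mon_val_def by (rule prod.mono_neutral_left) (use assms in \<open>auto simp: in_keys_iff\<close>)

lemma mon_val_0 [simp]: "mon_val z 0 = 1"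
  by (simp add: mon_val_def)

lemma mon_val_single [simp]: "mon_val z (Poly_Mapping.single i k) = z i ^ k"
  by (cases "k = 0") (auto simp: mon_val_def)

lemma mon_val_add: "mon_val z (m + m') = mon_val z m * mon_val z m'"
proof -
  let ?A = "mkeys m \<union> mkeys m'"
  have "mon_val z (m + m') = (\<Prod>i\<in>?A. z i ^ expo (m + m') i)"
    by (rule mon_val_superset) (auto dest: subsetD[OF keys_add])
  also have "\<dots> = (\<Prod>i\<in>?A. z i ^ expo m i) * (\<Prod>i\<in>?A. z i ^ expo m' i)"
    by (simp add: lookup_add power_add prod.distrib)
  also have "\<dots> = mon_val z m * mon_val z m'"
    by (simp add: mon_val_superset[of ?A])
  finally show ?thesis .
qed

text \<open>Both \<open>meval\<close> and \<open>mperm\<close> are instances of this evaluation along a coefficient homomorphism.\<close>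

definition heval :: "('a::comm_ring_1 \<Rightarrow> 'b::comm_ring_1) \<Rightarrow> (nat \<Rightarrow> 'b) \<Rightarrow> 'a mpoly \<Rightarrow> 'b" where
  "heval h z p = (\<Sum>m\<in>mkeys p. h (coeff_at p m) * mon_val z m)"

locale coeff_hom =
  fixes h :: "'a::comm_ring_1 \<Rightarrow> 'b::comm_ring_1"
  assumes hom_0: "h 0 = 0" and hom_1: "h 1 = 1"
    and hom_add: "h (x + y) = h x + h y" and hom_mult: "h (x * y) = h x * h y"
begin

lemma heval_superset:
  assumes "finite A" "mkeys p \<subseteq> A"
  shows "heval h z p = (\<Sum>m\<in>A. h (coeff_at p m) * mon_val z m)"
  unfolding heval_def by (rule sum.mono_neutral_left) (use assms in \<open>auto simp: in_keys_iff hom_0\<close>)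

lemma heval_0 [simp]: "heval h z 0 = 0"
  by (simp add: heval_def)

lemma heval_term [simp]: "heval h z (mterm m c) = h c * mon_val z m"
  by (cases "c = 0") (auto simp: heval_def hom_0)

lemma heval_add [simp]: "heval h z (p + q) = heval h z p + heval h z q"
proof -
  let ?A = "mkeys p \<union> mkeys q"
  have "heval h z (p + q) = (\<Sum>m\<in>?A. h (coeff_at (p + q) m) * mon_val z m)"
    by (rule heval_superset) (auto dest: subsetD[OF keys_add])
  also have "\<dots> = (\<Sum>m\<in>?A. h (coeff_at p m) * mon_val z m) + (\<Sum>m\<in>?A. h (coeff_at q m) * mon_val z m)"
    by (simp add: lookup_add hom_add distrib_right sum.distrib)
  also have "\<dots> = heval h z p + heval h z q"
    by (simp add: heval_superset[of ?A])
  finally show ?thesis .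
qed

lemma heval_mult [simp]: "heval h z (p * q) = heval h z p * heval h z q"
proof (induction p rule: mpoly_term_induct)
  case (monom m)
  show ?case
    by (induction q rule: mpoly_term_induct)
       (auto simp: mult_single mon_val_add hom_mult algebra_simps)
qed (auto simp: algebra_simps)

lemma heval_1 [simp]: "heval h z 1 = 1"
  using heval_term[of z 0 1] by (simp add: hom_1)

lemma heval_uminus [simp]: "heval h z (- p) = - heval h z p"
  using heval_add[of z p "- p"] by (simp add: eq_neg_iff_add_eq_0 add.commute)

lemma heval_diff [simp]: "heval h z (p - q) = heval h z p - heval h z q"
  using heval_add[of z p "- q"] by simp

lemma heval_sum [simp]: "heval h z (sum f A) = (\<Sum>a\<in>A. heval h z (f a))"
  by (induction A rule: infinite_finite_induct) auto

lemma heval_prod [simp]: "heval h z (prod f A) = (\<Prod>a\<in>A. heval h z (f a))"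
  by (induction A rule: infinite_finite_induct) auto

lemma heval_power [simp]: "heval h z (p ^ k) = heval h z p ^ k"
  by (induction k) auto

lemma heval_var [simp]: "heval h z (mvar i) = z i"
  by (simp add: mvar_def hom_1)

lemma heval_const [simp]: "heval h z (mconst c) = h c"
  by (simp add: mconst_def)

end

interpretation id_hom: coeff_hom "\<lambda>x. x"
  by unfold_locales (rule refl)+

lemma mconst_0 [simp]: "mconst 0 = 0"
  by (simp add: mconst_def)

lemma mconst_1 [simp]: "mconst 1 = 1"
  by (simp add: mconst_def)

lemma mconst_add: "mconst (a + b) = mconst a + mconst b"
  by (simp add: mconst_def single_add)

lemma mconst_uminus: "mconst (- a) = - mconst a"
  by (simp add: mconst_def single_uminus)

lemma mconst_diff: "mconst (a - b) = mconst a - mconst b"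
  by (simp add: mconst_def single_diff)

lemma mconst_mult: "mconst (a * b) = mconst a * mconst b"
  by (simp add: mconst_def mult_single)

interpretation const_hom: coeff_hom mconst
  by unfold_locales (auto simp: mconst_add mconst_mult)

lemma meval_heval: "meval p z = heval (\<lambda>x. x) z p"
  by (simp add: meval_def heval_def mon_val_def)

lemma meval_simps [simp]:
  "meval 0 z = 0" "meval 1 z = 1" "meval (p + q) z = meval p z + meval q z"
  "meval (p * q) z = meval p z * meval q z" "meval (- p) z = - meval p z"
  "meval (p - q) z = meval p z - meval q z" "meval (mvar i) z = z i" "meval (mconst c) z = c"
  "meval (p ^ k) z = meval p z ^ k" "meval (sum f A) z = (\<Sum>a\<in>A. meval (f a) z)" "meval (prod f A) z = (\<Prod>a\<in>A. meval (f a) z)"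
  by (simp_all add: meval_heval)

lemma mvar_power: "mvar i ^ k = mterm (Poly_Mapping.single i k) 1"
  by (induction k) (auto simp: mvar_def mult_single simp flip: single_add)

lemma prod_mterm_1: "(\<Prod>a\<in>A. mterm (f a) (1::'a::comm_ring_1)) = mterm (sum f A) 1"
  by (induction A rule: infinite_finite_induct) (auto simp: mult_single)

text \<open>Permuting variables is the substitution of \<open>mvar (\<sigma> i)\<close> for the
  variable i, that is, an evaluation with values in the polynomial ring itself. All compatibilities
  of \<open>mperm\<close> with the ring operations come from this.\<close>

lemma mperm_heval: "mperm \<sigma> p = heval mconst (\<lambda>i. mvar (\<sigma> i)) p"
proof -
  have "mterm (mon_perm \<sigma> m) c = mconst c * mon_val (\<lambda>i. mvar (\<sigma> i)) m" for m and c :: 'a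
    by (simp add: mon_val_def mvar_power prod_mterm_1 mon_perm_def mconst_def mult_single)
  thus ?thesis
    by (simp add: mperm_def heval_def)
qed

lemma mperm_simps [simp]:
  "mperm \<sigma> 0 = 0" "mperm \<sigma> 1 = 1" "mperm \<sigma> (p + q) = mperm \<sigma> p + mperm \<sigma> q"
  "mperm \<sigma> (p * q) = mperm \<sigma> p * mperm \<sigma> q" "mperm \<sigma> (- p) = - mperm \<sigma> p"
  "mperm \<sigma> (p - q) = mperm \<sigma> p - mperm \<sigma> q" "mperm \<sigma> (mvar i) = mvar (\<sigma> i)"
  "mperm \<sigma> (mconst c) = mconst c" "mperm \<sigma> (p ^ k) = mperm \<sigma> p ^ k" "mperm \<sigma> (sum f A) = (\<Sum>a\<in>A. mperm \<sigma> (f a))" "mperm \<sigma> (prod f A) = (\<Prod>a\<in>A. mperm \<sigma> (f a))"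
  by (simp_all add: mperm_heval)

lemma mperm_term: "mperm \<sigma> (mterm m c) = mterm (mon_perm \<sigma> m) c"
  by (cases "c = 0") (auto simp: mperm_def)

lemma meval_mperm: "meval (mperm \<sigma> p) z = meval p (\<lambda>i. z (\<sigma> i))"
  by (subst mperm_heval, subst heval_def) (simp add: meval_def[of p] mon_val_def)

lemma mperm_mperm: "mperm \<sigma> (mperm \<tau> p) = mperm (\<sigma> \<circ> \<tau>) p"
  by (subst mperm_heval[of \<tau>], subst heval_def, subst mperm_heval[of "\<sigma> \<circ> \<tau>"], subst heval_def)
     (simp add: mon_val_def)

lemma mperm_id: "mperm id p = p"
proof (induction p rule: mpoly_term_induct)
  case (monom m)
  have "mon_perm id m = m"
    by (rule poly_mapping_eqI)
       (auto simp: mon_perm_def lookup_sum lookup_single when_def in_keys_iff sum.delta')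
  thus ?case unfolding mperm_term by simp
qed auto

section \<open>Permutations acting on exponents and coefficients\<close>

lemma expo_mon_perm:
  assumes "bij \<sigma>"
  shows "expo (mon_perm \<sigma> m) (\<sigma> i) = expo m i"
  using assms
  by (auto simp: mon_perm_def lookup_sum lookup_single when_def bij_is_inj inj_eq in_keys_iff sum.delta)

lemma keys_mon_perm:
  assumes "bij \<sigma>"
  shows "mkeys (mon_perm \<sigma> m) = \<sigma> ` mkeys m"
proof -
  have "j \<in> mkeys (mon_perm \<sigma> m) \<longleftrightarrow> j \<in> \<sigma> ` mkeys m" for j
  proof -
    obtain i where j: "j = \<sigma> i" using assms by (metis bij_pointE)
    show ?thesis using assms unfolding j
      by (simp add: in_keys_iff expo_mon_perm inj_image_mem_iff bij_is_inj)
  qed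
  thus ?thesis by blast
qed

lemma mon_perm_inj: "bij \<sigma> \<Longrightarrow> mon_perm \<sigma> m = mon_perm \<sigma> m' \<longleftrightarrow> m = m'"
  by (metis expo_mon_perm poly_mapping_eqI)

lemma coeff_mperm:
  assumes "bij \<sigma>"
  shows "coeff_at (mperm \<sigma> p) (mon_perm \<sigma> m) = coeff_at p m"
  using assms by (auto simp: mperm_def lookup_sum lookup_single when_def mon_perm_inj in_keys_iff sum.delta)

lemma mon_perm_mon_perm:
  assumes "bij \<sigma>" "bij \<tau>"
  shows "mon_perm \<sigma> (mon_perm \<tau> m) = mon_perm (\<sigma> \<circ> \<tau>) m"
proof (rule poly_mapping_eqI)
  fix j
  obtain i where j: "j = \<sigma> (\<tau> i)" using assms by (metis bij_pointE)
  have "expo (mon_perm (\<sigma> \<circ> \<tau>) m) ((\<sigma> \<circ> \<tau>) i) = expo m i"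
    using assms by (intro expo_mon_perm bij_comp)
  thus "expo (mon_perm \<sigma> (mon_perm \<tau> m)) j = expo (mon_perm (\<sigma> \<circ> \<tau>) m) j"
    using assms by (simp add: expo_mon_perm j)
qed

lemma coeff_mperm_inv:
  assumes "bij \<sigma>"
  shows "coeff_at (mperm \<sigma> p) m = coeff_at p (mon_perm (inv \<sigma>) m)"
proof -
  have "mon_perm \<sigma> (mon_perm (inv \<sigma>) m) = mon_perm id m"
    using assms by (simp add: mon_perm_mon_perm bij_imp_bij_inv surj_iff[THEN iffD1] bij_is_surj)
  also have "\<dots> = m"
    by (metis bij_id expo_mon_perm id_apply poly_mapping_eqI)
  finally show ?thesis using coeff_mperm[OF assms, of p "mon_perm (inv \<sigma>) m"] by simp
qed

section \<open>Degrees and occurring variables\<close>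

lemma mdeg_superset:
  assumes "finite A" "mkeys m \<subseteq> A"
  shows "mdeg m = (\<Sum>i\<in>A. expo m i)"
  unfolding mdeg_def by (rule sum.mono_neutral_left) (use assms in \<open>auto simp: in_keys_iff\<close>)

lemma mdeg_add: "mdeg (m + m') = mdeg m + mdeg m'"
proof -
  let ?A = "mkeys m \<union> mkeys m'"
  have "mdeg (m + m') = (\<Sum>i\<in>?A. expo (m + m') i)"
    by (rule mdeg_superset) (auto dest: subsetD[OF keys_add])
  also have "\<dots> = (\<Sum>i\<in>?A. expo m i) + (\<Sum>i\<in>?A. expo m' i)"
    by (simp add: lookup_add sum.distrib)
  also have "\<dots> = mdeg m + mdeg m'"
    by (simp add: mdeg_superset[of ?A])
  finally show ?thesis .
qed

lemma mdeg_0 [simp]: "mdeg 0 = 0"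
  by (simp add: mdeg_def)

lemma mdeg_single [simp]: "mdeg (Poly_Mapping.single i k) = k"
  by (cases "k = 0") (auto simp: mdeg_def)

lemma mdeg_mon_perm: "bij \<sigma> \<Longrightarrow> mdeg (mon_perm \<sigma> m) = mdeg m"
  by (simp add: mdeg_def keys_mon_perm)
     (subst sum.reindex, auto simp: expo_mon_perm intro: inj_on_subset[OF bij_is_inj])

lemma in_vars_simps [simp, intro]:
  "in_vars n 0" "in_vars n 1" "in_vars n (mconst c)"
  by (auto simp: in_vars_def mconst_def split: if_splits)

lemma in_vars_var [intro]: "i < n \<Longrightarrow> in_vars n (mvar i)"
  by (auto simp: in_vars_def mvar_def split: if_splits)

lemma in_vars_add [intro]: "in_vars n p \<Longrightarrow> in_vars n q \<Longrightarrow> in_vars n (p + q)"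
  unfolding in_vars_def using keys_add[of p q] by blast

lemma in_vars_diff [intro]: "in_vars n p \<Longrightarrow> in_vars n q \<Longrightarrow> in_vars n (p - q)"
  unfolding in_vars_def using keys_diff[of p q] by blast

lemma in_vars_mult [intro]:
  assumes "in_vars n p" "in_vars n q" shows "in_vars n (p * q)"
  unfolding in_vars_def
proof
  fix m assume "m \<in> mkeys (p * q)"
  then obtain a b where "m = a + b" "a \<in> mkeys p" "b \<in> mkeys q"
    using keys_mult[of p q] by blast
  thus "mkeys m \<subseteq> {..<n}"
    using assms keys_add[of a b] unfolding in_vars_def by blast
qed

lemma in_vars_sum [intro]: "(\<And>a. a \<in> A \<Longrightarrow> in_vars n (f a)) \<Longrightarrow> in_vars n (sum f A)"
  by (induction A rule: infinite_finite_induct) auto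

lemma in_keys_mperm:
  assumes "m \<in> mkeys (mperm \<sigma> p)"
  obtains m' where "m' \<in> mkeys p" "m = mon_perm \<sigma> m'"
proof -
  have "m \<in> (\<Union>k\<in>mkeys p. mkeys (mterm (mon_perm \<sigma> k) (coeff_at p k)))"
    using assms unfolding mperm_def by (rule subsetD[OF keys_sum])
  with that show ?thesis by (auto split: if_splits)
qed

lemma in_vars_mperm:
  assumes "bij \<sigma>" "\<sigma> ` {..<n} \<subseteq> {..<n}" "in_vars n p"
  shows "in_vars n (mperm \<sigma> p)"
  unfolding in_vars_def
proof
  fix m assume "m \<in> mkeys (mperm \<sigma> p)"
  then obtain m' where "m' \<in> mkeys p" "m = mon_perm \<sigma> m'" by (rule in_keys_mperm)
  thus "mkeys m \<subseteq> {..<n}"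
    using assms by (auto simp: keys_mon_perm in_vars_def)
qed

lemma total_deg_le_const [simp, intro]:
  "total_deg_le 0 d" "total_deg_le 1 d" "total_deg_le (mconst c) d"
  by (auto simp: total_deg_le_def mconst_def split: if_splits)

lemma total_deg_le_var [intro]: "1 \<le> d \<Longrightarrow> total_deg_le (mvar i) d"
  by (auto simp: total_deg_le_def mvar_def split: if_splits)

lemma total_deg_le_add [intro]: "total_deg_le p d \<Longrightarrow> total_deg_le q d \<Longrightarrow> total_deg_le (p + q) d"
  unfolding total_deg_le_def using keys_add[of p q] by blast

lemma total_deg_le_diff [intro]: "total_deg_le p d \<Longrightarrow> total_deg_le q d \<Longrightarrow> total_deg_le (p - q) d"
  unfolding total_deg_le_def using keys_diff[of p q] by blast

lemma total_deg_le_mono: "total_deg_le p d \<Longrightarrow> d \<le> d' \<Longrightarrow> total_deg_le p d'"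
  by (auto simp: total_deg_le_def)

lemma total_deg_le_mult:
  assumes "total_deg_le p a" "total_deg_le q b" "a + b \<le> d"
  shows "total_deg_le (p * q) d"
  unfolding total_deg_le_def
proof
  fix m assume "m \<in> mkeys (p * q)"
  then obtain x y where "m = x + y" "x \<in> mkeys p" "y \<in> mkeys q"
    using keys_mult[of p q] by blast
  thus "mdeg m \<le> d"
    using assms by (fastforce simp: mdeg_add total_deg_le_def)
qed

lemma total_deg_le_cmult [intro]: "total_deg_le p d \<Longrightarrow> total_deg_le (mconst c * p) d"
  by (rule total_deg_le_mult[of _ 0]) auto

lemma total_deg_le_sum [intro]: "(\<And>a. a \<in> A \<Longrightarrow> total_deg_le (f a) d) \<Longrightarrow> total_deg_le (sum f A) d"
  by (induction A rule: infinite_finite_induct) auto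

lemma total_deg_le_mperm:
  assumes "bij \<sigma>" "total_deg_le p d" shows "total_deg_le (mperm \<sigma> p) d"
  using assms unfolding total_deg_le_def by (metis in_keys_mperm mdeg_mon_perm)

section \<open>Coefficients after multiplication by a constant or a variable\<close>

lemma coeff_cmult [simp]: "coeff_at (mconst c * p) m = c * coeff_at p m"
proof (induction p rule: mpoly_term_induct)
  case (monom k)
  thus ?case by (simp add: mconst_def mult_single lookup_single when_def)
qed (auto simp: algebra_simps lookup_add)

lemma coeff_var_mult_add: "coeff_at (mvar i * p) (mvexp i + m) = coeff_at p m"
proof (induction p rule: mpoly_term_induct)
  case (monom k)
  thus ?case by (simp add: mvar_def mult_single lookup_single when_def)
qed (auto simp: algebra_simps lookup_add)

lemma coeff_var_mult_0:
  assumes "expo m i = 0" shows "coeff_at (mvar i * p) m = 0"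
proof (induction p rule: mpoly_term_induct)
  case (monom k)
  have "mvexp i + k \<noteq> m"
    using assms by (metis add_is_0 lookup_add lookup_single_eq one_neq_zero)
  thus ?case by (simp add: mvar_def mult_single lookup_single when_def)
qed (auto simp: algebra_simps lookup_add)

lemma split_var_of_mon:
  assumes "expo m i \<noteq> 0" shows "\<exists>m'. m = mvexp i + m'"
proof
  show "m = mvexp i + (m - mvexp i)"
    by (rule poly_mapping_eqI) (use assms in \<open>auto simp: lookup_add lookup_minus lookup_single when_def\<close>)
qed

lemma coeff_var_mult:
  "coeff_at (mvar i * p) m = (if expo m i = 0 then 0 else coeff_at p (m - mvexp i))"
proof (cases "expo m i = 0")
  case False
  then obtain m' where "m = mvexp i + m'" using split_var_of_mon by blast
  thus ?thesis using False coeff_var_mult_add[of i p m'] by simp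
qed (simp add: coeff_var_mult_0)

lemma meval_cong:
  assumes "in_vars n p" "\<And>i. i < n \<Longrightarrow> z i = w i"
  shows "meval p z = meval p w"
  unfolding meval_def using assms
  by (intro sum.cong arg_cong2[of _ _ _ _ "(*)"] prod.cong refl) (auto simp: in_vars_def subset_iff)

section \<open>Divided differences and the operators \<open>T\<^sub>i\<close>\<close>

text \<open>Builds a monomial one variable at a time, the shape required by the product rule for
  divided differences.\<close>

lemma mon_induct [case_names zero mult]:
  assumes "P 0" and "\<And>m j. P m \<Longrightarrow> P (mvexp j + m)"
  shows "P (m :: nat \<Rightarrow>\<^sub>0 nat)"
proof (induction "mdeg m" arbitrary: m)
  case 0
  hence "m = 0" by (auto simp: mdeg_def in_keys_iff intro!: poly_mapping_eqI)
  thus ?case using assms by simp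
next
  case (Suc d)
  then obtain j where "expo m j \<noteq> 0" by (metis mdeg_0 nat.discI lookup_zero poly_mapping_eqI)
  then obtain m' where m: "m = mvexp j + m'" using split_var_of_mon by blast
  with Suc have "P m'" by (auto simp: mdeg_add)
  thus ?case unfolding m by (rule assms)
qed

lemma mswap_simps [simp]:
  "mswap i 0 = 0" "mswap i 1 = 1" "mswap i (p + q) = mswap i p + mswap i q"
  "mswap i (p * q) = mswap i p * mswap i q"
  "mswap i (p - q) = mswap i p - mswap i q" "mswap i (mvar j) = mvar (adj i j)"
  "mswap i (mconst c) = mconst c" "mswap i (sum f A) = (\<Sum>a\<in>A. mswap i (f a))"
  "mswap i (prod f A) = (\<Prod>a\<in>A. mswap i (f a))"
  by (simp_all add: mswap_def)

lemma coeff_mswap: "coeff_at (mswap i p) m = coeff_at p (mon_perm (adj i) m)"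
  by (simp add: mswap_def coeff_mperm_inv)

lemma in_vars_mswap: "Suc i < n \<Longrightarrow> in_vars n p \<Longrightarrow> in_vars n (mswap i p)"
  unfolding mswap_def by (rule in_vars_mperm) (auto simp: transpose_def)

lemma total_deg_le_mswap: "total_deg_le p d \<Longrightarrow> total_deg_le (mswap i p) d"
  unfolding mswap_def by (rule total_deg_le_mperm) auto

lemma meval_mswap: "meval (mswap i p) z = meval p (z \<circ> adj i)"
  by (simp add: mswap_def meval_mperm comp_def)

lemma var_diff_nonzero: "vdiff i \<noteq> (0 :: 'a::field mpoly)"
proof
  assume "vdiff i = (0 :: 'a mpoly)"
  hence "meval (vdiff i) (\<lambda>j. if j = i then 1 else 0) = (0::'a)" by simp
  thus False by simp
qed

text \<open>Used for two subrings: the whole field, which gives plain existence of divided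
  differences, and the elements regular at q = 1, which gives that T_i creates no poles.\<close>

locale coeff_subring =
  fixes R :: "'a::field \<Rightarrow> bool"
  assumes R_0: "R 0" and R_1: "R 1" and R_add: "R a \<Longrightarrow> R b \<Longrightarrow> R (a + b)" and R_uminus: "R a \<Longrightarrow> R (- a)"
    and R_mult: "R a \<Longrightarrow> R b \<Longrightarrow> R (a * b)"
begin

definition coeffs_in :: "'a mpoly \<Rightarrow> bool" where
  "coeffs_in p \<longleftrightarrow> (\<forall>m. R (coeff_at p m))"

lemma R_diff: "R a \<Longrightarrow> R b \<Longrightarrow> R (a - b)"
  using R_add[of a "- b"] R_uminus by simp

lemma coeffs_in_0: "coeffs_in 0"
  by (simp add: coeffs_in_def R_0)

lemma coeffs_in_add: "coeffs_in p \<Longrightarrow> coeffs_in q \<Longrightarrow> coeffs_in (p + q)"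
  by (simp add: coeffs_in_def lookup_add R_add)

lemma coeffs_in_diff: "coeffs_in p \<Longrightarrow> coeffs_in q \<Longrightarrow> coeffs_in (p - q)"
  by (simp add: coeffs_in_def lookup_minus R_diff)

lemma coeffs_in_sum: "(\<And>a. a \<in> A \<Longrightarrow> coeffs_in (f a)) \<Longrightarrow> coeffs_in (sum f A)"
  by (induction A rule: infinite_finite_induct) (auto intro: coeffs_in_0 coeffs_in_add)

lemma coeffs_in_mterm: "R c \<Longrightarrow> coeffs_in (mterm m c)"
  by (simp add: coeffs_in_def lookup_single when_def R_0)

lemma coeffs_in_cmult: "R c \<Longrightarrow> coeffs_in p \<Longrightarrow> coeffs_in (mconst c * p)"
  by (simp add: coeffs_in_def R_mult)

lemma coeffs_in_var_mult: "coeffs_in p \<Longrightarrow> coeffs_in (mvar i * p)"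
  by (simp add: coeffs_in_def coeff_var_mult R_0)

lemma coeffs_in_mswap: "coeffs_in p \<Longrightarrow> coeffs_in (mswap i p)"
  by (simp add: coeffs_in_def coeff_mswap)

text \<open>Product rule: \<open>x_j m - s_i (x_j m) = x_j (m - s_i m) + (x_j - s_i x_j) s_i
  m\<close>. Coefficient ring, degree bound and variables of the quotient are recorded along the
  way, since \<open>divdiff\<close> is a definite description that reveals none of them.\<close>

lemma divdiff_mterm_ex:
  assumes "R c"
  shows "\<exists>g. vdiff i * g = mterm m c - mswap i (mterm m c) \<and> coeffs_in g \<and>
     (\<forall>m'\<in>mkeys g. mdeg m' < mdeg m) \<and>
     (\<forall>n. Suc i < n \<longrightarrow> mkeys m \<subseteq> {..<n} \<longrightarrow> in_vars n g)"
proof (induction m rule: mon_induct)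
  case zero
  show ?case
    by (intro exI[of _ 0]) (simp add: coeffs_in_0, simp flip: mconst_def)
next
  case (mult m j)
  then obtain g where g: "vdiff i * g = mterm m c - mswap i (mterm m c)" "coeffs_in g"
    "\<forall>m'\<in>mkeys g. mdeg m' < mdeg m"
    "\<And>n. Suc i < n \<Longrightarrow> mkeys m \<subseteq> {..<n} \<Longrightarrow> in_vars n g" by blast
  \<comment> \<open>The difference \<open>x_j - s_i x_j\<close> is \<open>e\<close> times
    \<open>x_i - x_{i+1}\<close>; it is nonzero only for the two exchanged variables.\<close>
  define e :: 'a where "e = (if j = i then 1 else if j = Suc i then -1 else 0)"
  define g' where "g' = mvar j * g + mconst e * mswap i (mterm m c)"
  have e: "mvar j - mvar (adj i j) = vdiff i * mconst e"
    by (auto simp: e_def transpose_def mconst_uminus)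
  have t: "mterm (mvexp j + m) c = mvar j * mterm m c"
    by (simp add: mvar_def mult_single)
  have "vdiff i * g' = mvar j * (vdiff i * g)
      + (mvar j - mvar (adj i j)) * mswap i (mterm m c)"
    by (simp add: g'_def e algebra_simps)
  also have "\<dots> = mterm (mvexp j + m) c - mswap i (mterm (mvexp j + m) c)"
    unfolding g(1) t by (simp add: algebra_simps)
  finally have 1: "vdiff i * g' = \<dots>" .
  have 2: "coeffs_in g'"
    unfolding g'_def using assms g(2)
    by (intro coeffs_in_add coeffs_in_var_mult coeffs_in_cmult coeffs_in_mswap coeffs_in_mterm)
       (auto simp: e_def R_0 R_1 R_uminus)
  have m_deg: "total_deg_le (mswap i (mterm m c)) (mdeg m)"
    by (intro total_deg_le_mswap) (auto simp: total_deg_le_def split: if_splits)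
  have "total_deg_le (mvar j * g) (mdeg m)"
  proof (cases "mdeg m")
    case 0
    hence "g = 0" using g(3) by (simp flip: keys_eq_empty)
    thus ?thesis by simp
  next
    case (Suc d)
    thus ?thesis using g(3)
      by (intro total_deg_le_mult[of _ 1 _ d]) (auto simp: total_deg_le_def mvar_def)
  qed
  hence 3: "total_deg_le g' (mdeg m)"
    unfolding g'_def using m_deg by blast
  have 4: "in_vars n g'" if n: "Suc i < n" "mkeys (mvexp j + m) \<subseteq> {..<n}" for n
  proof -
    have "mkeys (mvexp j + m) = insert j (mkeys m)"
      by (auto simp: in_keys_iff lookup_add lookup_single when_def split: if_splits)
    with n have "j < n" "mkeys m \<subseteq> {..<n}" by auto
    moreover from this have "in_vars n (mterm m c)" by (auto simp: in_vars_def split: if_splits)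
    ultimately show ?thesis unfolding g'_def using n(1) g(4)
      by (intro in_vars_add in_vars_mult in_vars_var in_vars_mswap) auto
  qed
  show ?case
    by (rule exI[of _ g']) (use 1 2 3 4 in \<open>auto simp: total_deg_le_def mdeg_add less_Suc_eq_le\<close>)
qed

lemma divdiff_ex:
  assumes "coeffs_in f"
  shows "\<exists>g. vdiff i * g = f - mswap i f \<and> coeffs_in g \<and>
     (\<forall>d. total_deg_le f d \<longrightarrow> (\<forall>m\<in>mkeys g. mdeg m < d)) \<and>
     (\<forall>n. Suc i < n \<longrightarrow> in_vars n f \<longrightarrow> in_vars n g)"
proof -
  let ?P = "\<lambda>m g. vdiff i * g = mterm m (coeff_at f m) - mswap i (mterm m (coeff_at f m)) \<and>
     coeffs_in g \<and> (\<forall>m'\<in>mkeys g. mdeg m' < mdeg m) \<and>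
     (\<forall>n. Suc i < n \<longrightarrow> mkeys m \<subseteq> {..<n} \<longrightarrow> in_vars n g)"
  have "\<exists>g. ?P m g" for m
    using divdiff_mterm_ex[of "coeff_at f m" i m] assms unfolding coeffs_in_def[of f] by blast
  then obtain g where g: "\<And>m. ?P m (g m)" by metis
  let ?g = "\<Sum>m\<in>mkeys f. g m"
  have "vdiff i * ?g =
      (\<Sum>m\<in>mkeys f. mterm m (coeff_at f m) - mswap i (mterm m (coeff_at f m)))"
    using g by (simp add: sum_distrib_left)
  also have "\<dots> = f - mswap i f"
    by (simp add: sum_subtractf flip: mswap_simps mpoly_as_sum)
  finally have "vdiff i * ?g = f - mswap i f" .
  moreover have "coeffs_in ?g" using g by (intro coeffs_in_sum) auto
  moreover have "mdeg m < d" if d: "total_deg_le f d" and m: "m \<in> mkeys ?g" for d m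
  proof -
    obtain k where "k \<in> mkeys f" "m \<in> mkeys (g k)"
      using subsetD[OF keys_sum m] by blast
    thus ?thesis using g d by (meson less_le_trans total_deg_le_def)
  qed
  moreover have "in_vars n ?g" if "Suc i < n" "in_vars n f" for n
    using g that by (intro in_vars_sum) (metis in_vars_def)
  ultimately show ?thesis by blast
qed

end

interpretation all_coeffs: coeff_subring "\<lambda>_. True"
  by unfold_locales auto

section \<open>Calculus of the operators T_i\<close>

lemma divdiff_unique:
  assumes "vdiff i * g = f - mswap i f"
  shows "divdiff i f = g"
  unfolding divdiff_def
proof (rule the_equality)
  fix g' assume "vdiff i * g' = f - mswap i f"
  hence "vdiff i * g' = vdiff i * g" using assms by simp
  thus "g' = g" using var_diff_nonzero mult_left_cancel by blast
qed (fact assms)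

lemma divdiff_mult: "vdiff i * divdiff i f = f - mswap i f"
  using all_coeffs.divdiff_ex[of f i] divdiff_unique[of i _ f] by (auto simp: all_coeffs.coeffs_in_def)

text \<open>The form of T_i without division. As \<open>vdiff i\<close> can be cancelled, it reduces
  claims about \<open>Ti\<close> to polynomial identities.\<close>

lemma Ti_mult:
  "vdiff i * Ti t i f =
    mconst (1 - t) * mvar (Suc i) * f + (mconst t * mvar i - mvar (Suc i)) * mswap i f"
proof -
  have "vdiff i * Ti t i f = vdiff i * mconst t * f
      - (mconst t * mvar i - mvar (Suc i)) * (vdiff i * divdiff i f)"
    by (simp add: Ti_def algebra_simps)
  thus ?thesis unfolding divdiff_mult by (simp add: algebra_simps mconst_diff)
qed

lemma Ti_eqI:
  assumes "vdiff i * g =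
    mconst (1 - t) * mvar (Suc i) * f + (mconst t * mvar i - mvar (Suc i)) * mswap i f"
  shows "Ti t i f = g"
  using assms Ti_mult[of i t f] var_diff_nonzero[of i] by (metis mult_left_cancel)

lemma Ti_0 [simp]: "Ti t i 0 = 0"
  by (rule Ti_eqI) simp

lemma Ti_add: "Ti t i (f + g) = Ti t i f + Ti t i g"
  by (rule Ti_eqI) (simp add: distrib_left[of "_ - _"] Ti_mult, simp add: algebra_simps)

lemma Ti_sum: "Ti t i (sum f A) = (\<Sum>a\<in>A. Ti t i (f a))"
  by (induction A rule: infinite_finite_induct) (auto simp: Ti_add)

lemma Ti_mult_sym:
  assumes "mswap i g = g"
  shows "Ti t i (f * g) = Ti t i f * g"
  by (rule Ti_eqI) (simp add: assms Ti_mult mult.assoc[symmetric], simp add: algebra_simps)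

lemma Ti_cmult: "Ti t i (mconst c * f) = mconst c * Ti t i f"
  using Ti_mult_sym[of i "mconst c" t f] by (simp add: mult.commute)

text \<open>The difference \<open>t f - T_i f\<close> is \<open>t x_i - x_{i+1}\<close> times the
  divided difference of \<open>f\<close>, and the first factor is not zero.\<close>

lemma Ti_eq_iff_sym:
  assumes "t \<noteq> 0" "Ti t i f = mconst t * f"
  shows "mswap i f = f"
proof -
  have "(mconst t * mvar i - mvar (Suc i)) * (f - mswap i f) =
      vdiff i * (mconst t * f - Ti t i f)"
    by (simp add: right_diff_distrib[of "vdiff i"] Ti_mult)
       (simp add: algebra_simps mconst_diff)
  also have "\<dots> = 0" using assms by simp
  finally have "(mconst t * mvar i - mvar (Suc i)) * (f - mswap i f) = 0" .
  moreover have "mconst t * mvar i - mvar (Suc i) \<noteq> 0"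
  proof
    assume "mconst t * mvar i - mvar (Suc i) = 0"
    hence "meval (mconst t * mvar i - mvar (Suc i)) (\<lambda>j. if j = i then 1 else 0) = 0" by simp
    thus False using assms by simp
  qed
  ultimately show ?thesis by simp
qed

lemma meval_Ti:
  assumes "z i \<noteq> z (Suc i)"
  shows "meval (Ti t i f) z = ((1 - t) * z (Suc i) * meval f z
    + (t * z i - z (Suc i)) * meval f (z \<circ> adj i)) / (z i - z (Suc i))"
proof -
  have "(z i - z (Suc i)) * meval (Ti t i f) z = (1 - t) * z (Suc i) * meval f z
    + (t * z i - z (Suc i)) * meval f (z \<circ> adj i)"
    using arg_cong[OF Ti_mult[of i t f], of "\<lambda>p. meval p z"] by (simp add: meval_mswap)
  thus ?thesis using assms by (simp add: field_simps)
qed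

lemma in_vars_Ti:
  assumes "Suc i < n" "in_vars n f" shows "in_vars n (Ti t i f)"
proof -
  have "in_vars n (divdiff i f)"
    using all_coeffs.divdiff_ex[of f i] divdiff_unique[of i _ f] assms
    by (auto simp: all_coeffs.coeffs_in_def)
  thus ?thesis unfolding Ti_def using assms by (intro in_vars_diff in_vars_mult in_vars_var) auto
qed

lemma total_deg_le_Ti:
  assumes "total_deg_le f d" shows "total_deg_le (Ti t i f) d"
proof -
  have *: "\<forall>m\<in>mkeys (divdiff i f). mdeg m < d"
    using all_coeffs.divdiff_ex[of f i] divdiff_unique[of i _ f] assms
    by (auto simp: all_coeffs.coeffs_in_def)
  have "total_deg_le ((mconst t * mvar i - mvar (Suc i)) * divdiff i f) d"
  proof (cases d)
    case 0
    hence "divdiff i f = 0" using * by (simp flip: keys_eq_empty)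
    thus ?thesis by simp
  next
    case (Suc d')
    hence "total_deg_le (divdiff i f) d'" using * by (auto simp: total_deg_le_def)
    thus ?thesis using Suc
      by (intro total_deg_le_mult[of _ 1 _ d'] total_deg_le_diff total_deg_le_cmult total_deg_le_var) auto
  qed
  thus ?thesis unfolding Ti_def using assms by blast
qed

lemma (in coeff_subring) coeffs_in_Ti:
  assumes "R t" "coeffs_in f" shows "coeffs_in (Ti t i f)"
proof -
  have "coeffs_in (divdiff i f)"
    using divdiff_ex[OF assms(2), of i] divdiff_unique[of i _ f] by auto
  thus ?thesis using assms
    by (simp add: Ti_def left_diff_distrib mult.assoc coeffs_in_diff coeffs_in_cmult coeffs_in_var_mult)
qed

text \<open>Comparing coefficients of \<open>x\<^sup>\<nu> x\<^bsub>i+1\<^esub>\<close> in the defining equation of \<open>T\<^sub>i f\<close>.\<close>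

lemma coeff_Ti:
  assumes "expo \<nu> i = 0"
  shows "coeff_at (Ti t i f) \<nu> =
    coeff_at f (mon_perm (adj i) \<nu>) - (1 - t) * coeff_at f \<nu>"
proof -
  let ?m = "mvexp (Suc i) + \<nu>"
  have i0: "expo ?m i = 0" using assms by (simp add: lookup_add lookup_single)
  have *: "coeff_at (vdiff i * Ti t i f) ?m = coeff_at (mconst (1 - t) * (mvar (Suc i) * f)
      + (mconst t * (mvar i * mswap i f) - mvar (Suc i) * mswap i f)) ?m"
    unfolding Ti_mult by (simp add: algebra_simps)
  have "coeff_at (vdiff i * Ti t i f) ?m = - coeff_at (Ti t i f) \<nu>"
    by (simp add: left_diff_distrib lookup_minus coeff_var_mult_0[OF i0] coeff_var_mult_add del: One_nat_def)
  moreover have "coeff_at (mconst (1 - t) * (mvar (Suc i) * f)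
      + (mconst t * (mvar i * mswap i f) - mvar (Suc i) * mswap i f)) ?m
      = (1 - t) * coeff_at f \<nu> - coeff_at f (mon_perm (adj i) \<nu>)"
    by (simp add: lookup_add lookup_minus coeff_var_mult_0[OF i0] coeff_var_mult_add coeff_mswap del: One_nat_def)
  ultimately have "- coeff_at (Ti t i f) \<nu> =
      (1 - t) * coeff_at f \<nu> - coeff_at f (mon_perm (adj i) \<nu>)"
    using * by (simp only:)
  thus ?thesis by algebra
qed

section \<open>Compositions\<close>

definition sw :: "nat \<Rightarrow> nat list \<Rightarrow> nat list" where
  "sw i \<mu> = permute_list (adj i) \<mu>"

definition phi :: "nat list \<Rightarrow> nat list" where
  "phi \<mu> = Suc (last \<mu>) # butlast \<mu>"

text \<open>A strict total order on positions: larger parts come first, ties go to the larger index.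
  The number k_i of the definition of the nodes is the rank of i in this order.\<close>

definition beats :: "nat list \<Rightarrow> nat \<Rightarrow> nat \<Rightarrow> bool" where
  "beats \<mu> l j \<longleftrightarrow> \<mu> ! l > \<mu> ! j \<or> \<mu> ! l = \<mu> ! j \<and> l > j"

text \<open>The number of leading zeros. After the size, it is the second component of the measure
  on which the recursion for E* runs.\<close>

definition lead :: "nat list \<Rightarrow> nat" where
  "lead \<mu> = length (takeWhile (\<lambda>x. x = 0) \<mu>)"

text \<open>For a rearrangement of a partition this is the length of the shortest permutation that
  produces it, since partitions are weakly decreasing and have no such pair.\<close>

definition linv :: "nat list \<Rightarrow> nat" where
  "linv \<mu> = card {(i, j). i < j \<and> j < length \<mu> \<and> \<mu> ! i < \<mu> ! j}"

lemma length_sw [simp]: "length (sw i \<mu>) = length \<mu>"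
  by (simp add: sw_def)

lemma adj_permutes: "Suc i < n \<Longrightarrow> adj i permutes {..<n}"
  by (rule permutes_swap_id) auto

lemma nth_sw: "j < length \<mu> \<Longrightarrow> sw i \<mu> ! j = \<mu> ! adj i j"
  by (simp add: sw_def permute_list_def)

lemma adj_less: "Suc i < n \<Longrightarrow> j < n \<Longrightarrow> adj i j < n"
  by (auto simp: transpose_def)

lemma sw_sw [simp]: "Suc i < length \<mu> \<Longrightarrow> sw i (sw i \<mu>) = \<mu>"
  by (rule nth_equalityI) (auto simp: nth_sw adj_less)

lemma mset_sw [simp]: "Suc i < length \<mu> \<Longrightarrow> mset (sw i \<mu>) = mset \<mu>"
  unfolding sw_def by (rule mset_permute_list) (rule adj_permutes)

lemma sum_list_sw [simp]: "Suc i < length \<mu> \<Longrightarrow> sum_list (sw i \<mu>) = sum_list \<mu>"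
  by (metis mset_sw sum_mset_sum_list)

lemma sw_eq_self: "Suc i < length \<mu> \<Longrightarrow> \<mu> ! i = \<mu> ! Suc i \<Longrightarrow> sw i \<mu> = \<mu>"
  by (rule nth_equalityI) (auto simp: nth_sw transpose_def)

lemma sw_eq_iff: "Suc i < length \<mu> \<Longrightarrow> Suc i < length \<nu> \<Longrightarrow> sw i \<mu> = \<nu> \<longleftrightarrow> \<mu> = sw i \<nu>"
  using sw_sw by metis

lemma sw_commute:
  assumes "Suc i < j" "Suc j < length \<mu>"
  shows "sw i (sw j \<mu>) = sw j (sw i \<mu>)"
  by (rule nth_equalityI) (use assms in \<open>auto simp: nth_sw adj_less transpose_def\<close>)

lemma sw_braid:
  assumes "Suc (Suc i) < length \<mu>"
  shows "sw i (sw (Suc i) (sw i \<mu>)) = sw (Suc i) (sw i (sw (Suc i) \<mu>))"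
  by (rule nth_equalityI) (use assms in \<open>auto simp: nth_sw adj_less transpose_def\<close>)

section \<open>Ranks of the parts\<close>

lemma kk_beats:
  assumes "i < length \<mu>"
  shows "kk \<mu> i = card {l. l < length \<mu> \<and> beats \<mu> l i}"
proof -
  have *: "{l. l < length \<mu> \<and> beats \<mu> l i} =
      {j. j < i \<and> \<mu> ! j > \<mu> ! i} \<union> {j. i < j \<and> j < length \<mu> \<and> \<mu> ! j \<ge> \<mu> ! i}"
    using assms by (auto simp: beats_def not_less order_le_less)
  show ?thesis
    unfolding kk_def * by (subst card_Un_disjoint) auto
qed

lemma card_beats_reindex:
  assumes "bij_betw \<pi> {..<n} {..<n}" and "i < n"
    and "\<And>l. l < n \<Longrightarrow> beats \<nu> l i \<longleftrightarrow> beats \<mu> (\<pi> l) (\<pi> i)"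
  shows "card {l. l < n \<and> beats \<nu> l i} = card {l. l < n \<and> beats \<mu> l (\<pi> i)}"
  using bij_betw_same_card[OF bij_betw_Collect[OF assms(1), of "\<lambda>l. beats \<mu> l (\<pi> i)" "\<lambda>l. beats \<nu> l i"]]
    assms(3) by simp

text \<open>Exchanging neighbours changes the order of positions only for this pair. Its parts
  differ, so no tie is decided anew and ranks travel with the parts.\<close>

lemma kk_sw:
  assumes "Suc i < length \<mu>" "\<mu> ! i \<noteq> \<mu> ! Suc i" "j < length \<mu>"
  shows "kk (sw i \<mu>) j = kk \<mu> (adj i j)"
proof -
  have "beats (sw i \<mu>) l j \<longleftrightarrow> beats \<mu> (adj i l) (adj i j)"
    if "l < length \<mu>" for l
    using assms that by (auto simp: beats_def nth_sw transpose_def split: if_splits)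
  thus ?thesis
    using assms
    by (simp add: kk_beats adj_less)
       (rule card_beats_reindex, auto intro: permutes_imp_bij adj_permutes)
qed

lemma length_phi [simp]: "\<mu> \<noteq> [] \<Longrightarrow> length (phi \<mu>) = length \<mu>"
  by (simp add: phi_def)

lemma nth_phi_0: "phi \<mu> ! 0 = Suc (last \<mu>)"
  by (simp add: phi_def)

lemma nth_phi_Suc: "Suc j < length \<mu> \<Longrightarrow> phi \<mu> ! Suc j = \<mu> ! j"
  by (simp add: phi_def nth_butlast)

lemma sum_list_phi: "\<mu> \<noteq> [] \<Longrightarrow> sum_list (phi \<mu>) = Suc (sum_list \<mu>)"
  by (induction \<mu> rule: rev_induct) (auto simp: phi_def)

lemma phi_surj:
  assumes "\<nu> \<noteq> []" "\<nu> ! 0 > 0"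
  shows "\<exists>\<mu>. \<mu> \<noteq> [] \<and> length \<mu> = length \<nu> \<and> \<nu> = phi \<mu>"
proof -
  have "\<nu> = phi (tl \<nu> @ [hd \<nu> - 1])"
    using assms by (cases \<nu>) (auto simp: phi_def)
  moreover have "length (tl \<nu> @ [hd \<nu> - 1]) = length \<nu>" using assms by (cases \<nu>) auto
  ultimately show ?thesis by blast
qed

definition rotl :: "nat \<Rightarrow> nat \<Rightarrow> nat" where
  "rotl n j = (if j = 0 then n - 1 else if j < n then j - 1 else j)"

lemma bij_rotl: "bij_betw (rotl n) {..<n} {..<n}"
  by (rule bij_betwI[of _ _ _ "\<lambda>j. if j = n - 1 then 0 else Suc j"]) (auto simp: rotl_def)

text \<open>In last position a part wins all ties and so beats every part at most equal to it.
  Raised by one and put in front it loses all ties, and beats exactly the same parts.\<close>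

lemma kk_phi:
  assumes "\<mu> \<noteq> []" "j < length \<mu>"
  shows "kk (phi \<mu>) j = kk \<mu> (rotl (length \<mu>) j)"
proof -
  have nth: "phi \<mu> ! l = (if l = 0 then Suc (\<mu> ! rotl (length \<mu>) l) else \<mu> ! rotl (length \<mu>) l)"
    if "l < length \<mu>" for l
    using assms that by (cases l) (auto simp: nth_phi_0 nth_phi_Suc rotl_def last_conv_nth)
  have "beats (phi \<mu>) l j \<longleftrightarrow> beats \<mu> (rotl (length \<mu>) l) (rotl (length \<mu>) j)"
    if "l < length \<mu>" for l
    using assms that by (auto simp: beats_def nth) (auto simp: rotl_def)
  moreover have "rotl (length \<mu>) j < length \<mu>" using assms by (auto simp: rotl_def)
  ultimately show ?thesis
    using assms by (simp add: kk_beats) (rule card_beats_reindex, auto intro: bij_rotl)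
qed

lemma kk_less:
  assumes "i < length \<mu>" "j < length \<mu>" "beats \<mu> i j"
  shows "kk \<mu> i < kk \<mu> j"
proof -
  have "{l. l < length \<mu> \<and> beats \<mu> l i} \<subset> {l. l < length \<mu> \<and> beats \<mu> l j}"
    using assms by (auto simp: beats_def)
  thus ?thesis using assms by (simp add: kk_beats psubset_card_mono)
qed

lemma kk_eq:
  assumes "Suc i < length \<mu>" "\<mu> ! i = \<mu> ! Suc i"
  shows "kk \<mu> i = Suc (kk \<mu> (Suc i))"
proof -
  have "{l. l < length \<mu> \<and> beats \<mu> l i} = insert (Suc i) {l. l < length \<mu> \<and> beats \<mu> l (Suc i)}"
    using assms by (auto simp: beats_def)
  thus ?thesis using assms by (simp add: kk_beats) (simp add: beats_def)
qed

text \<open>The last hypothesis says that no position ranks strictly between i and i+1. Consecutive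
  ranks are what makes the factor \<open>rho\<close> vanish at q = 1.\<close>

lemma kk_descent:
  assumes "Suc i < length \<mu>" "\<mu> ! i > \<mu> ! Suc i"
    and "\<And>l. l < length \<mu> \<Longrightarrow> l \<noteq> i \<Longrightarrow> beats \<mu> l (Suc i) \<Longrightarrow> beats \<mu> l i"
  shows "kk \<mu> (Suc i) = Suc (kk \<mu> i)"
proof -
  have "{l. l < length \<mu> \<and> beats \<mu> l (Suc i)} = insert i {l. l < length \<mu> \<and> beats \<mu> l i}"
    using assms by (auto simp: beats_def)
  thus ?thesis using assms by (simp add: kk_beats) (simp add: beats_def)
qed

lemma kk_zero:
  assumes "\<mu> \<noteq> []" "\<mu> ! 0 = 0"
  shows "kk \<mu> 0 = length \<mu> - 1"
proof -
  have "{l. l < length \<mu> \<and> beats \<mu> l 0} = {1..<length \<mu>}"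
    using assms by (auto simp: beats_def Suc_le_eq) (metis gr0I less_irrefl)
  thus ?thesis using assms by (simp add: kk_beats)
qed

section \<open>Increasing pairs and sorting\<close>

lemma linv_sw:
  assumes "Suc i < length \<mu>" "\<mu> ! i > \<mu> ! Suc i"
  shows "linv (sw i \<mu>) = Suc (linv \<mu>)"
proof -
  let ?s = "adj i"
  let ?I = "\<lambda>\<mu>. {(a, b). a < b \<and> b < length \<mu> \<and> \<mu> ! a < \<mu> ! b}"
  have fin: "finite (?I \<nu>)" for \<nu> :: "nat list"
    by (rule finite_subset[of _ "{..<length \<nu>} \<times> {..<length \<nu>}"]) auto
  have less: "?s a < ?s b" if "a < b" "(a, b) \<noteq> (i, Suc i)" for a b
    using that by (auto simp: transpose_def)
  \<comment> \<open>Exchanging the two positions matches the increasing pairs of both compositions,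
    apart from the newly created pair \<open>(i, Suc i)\<close>.\<close>
  have "bij_betw (map_prod ?s ?s) (?I \<mu>) (?I (sw i \<mu>) - {(i, Suc i)})"
  proof (rule bij_betwI[of _ _ _ "map_prod ?s ?s"])
    have "?s a = i \<and> ?s b = Suc i \<longleftrightarrow> a = Suc i \<and> b = i" for a b by (auto simp: transpose_eq_iff)
    thus "map_prod ?s ?s \<in> ?I \<mu> \<rightarrow> ?I (sw i \<mu>) - {(i, Suc i)}"
      using assms by (auto simp: nth_sw adj_less intro!: less)
    show "map_prod ?s ?s \<in> ?I (sw i \<mu>) - {(i, Suc i)} \<rightarrow> ?I \<mu>"
      using assms by (auto simp: nth_sw adj_less intro!: less)
  qed auto
  hence "linv \<mu> = card (?I (sw i \<mu>) - {(i, Suc i)})" unfolding linv_def by (rule bij_betw_same_card)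
  also have "Suc \<dots> = linv (sw i \<mu>)"
    unfolding linv_def using assms by (intro card_Suc_Diff1 fin) (simp add: nth_sw)
  finally show ?thesis by simp
qed

lemma descent_of_sw:
  assumes "Suc i < length \<mu>" "\<mu> ! i < \<mu> ! Suc i"
  shows "sw i \<mu> ! i > sw i \<mu> ! Suc i" "linv \<mu> = Suc (linv (sw i \<mu>))"
proof -
  show 1: "sw i \<mu> ! i > sw i \<mu> ! Suc i" using assms by (simp add: nth_sw)
  show "linv \<mu> = Suc (linv (sw i \<mu>))"
    using linv_sw[of i "sw i \<mu>"] 1 assms by simp
qed

lemma linv_sw_le: "Suc i < length \<mu> \<Longrightarrow> linv (sw i \<mu>) \<le> Suc (linv \<mu>)"
  using linv_sw[of i \<mu>] sw_eq_self[of i \<mu>] descent_of_sw(2)[of i \<mu>, symmetric]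
  by (cases "\<mu> ! i" "\<mu> ! Suc i" rule: linorder_cases) auto

lemma sorted_desc_unique:
  assumes "sorted_wrt (\<ge>) xs" "sorted_wrt (\<ge>) ys" "mset xs = mset ys"
  shows "xs = (ys :: nat list)"
proof -
  have "sorted (rev xs)" "sorted (rev ys)" using assms by (simp_all add: sorted_wrt_rev)
  moreover have "mset (rev xs) = mset (rev ys)" using assms by simp
  ultimately have "rev xs = rev ys" by (metis properties_for_sort)
  thus ?thesis by simp
qed

lemma sorted_desc_iff_adjacent:
  "sorted_wrt (\<ge>) (xs :: nat list) \<longleftrightarrow> (\<forall>i. Suc i < length xs \<longrightarrow> xs ! i \<ge> xs ! Suc i)"
  by (rule sorted_wrt_iff_nth_Suc_transp) (auto intro: transpI)

lemma linv_sorted_desc: "sorted_wrt (\<ge>) \<mu> \<Longrightarrow> linv \<mu> = 0"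
  by (auto simp: linv_def sorted_wrt_iff_nth_less card_eq_0_iff not_less[symmetric])

lemma ascent_ex:
  assumes "is_partition n lam" "\<mu> \<in> rearr n lam" "\<mu> \<noteq> lam"
  obtains i where "Suc i < n" "\<mu> ! i < \<mu> ! Suc i"
proof -
  have "\<not> sorted_wrt (\<ge>) \<mu>"
    using assms sorted_desc_unique[of \<mu> lam] by (auto simp: is_partition_def rearr_def)
  with assms that show ?thesis
    by (auto simp: sorted_desc_iff_adjacent rearr_def not_le)
qed

lemma sw_rearr: "\<mu> \<in> rearr n lam \<Longrightarrow> Suc i < n \<Longrightarrow> sw i \<mu> \<in> rearr n lam"
  by (simp add: rearr_def)

lemma finite_rearr: "finite (rearr n lam)"
  unfolding rearr_def
  by (rule finite_subset[OF _ finite_lists_length_eq[of "set lam" n]]) (auto dest: mset_eq_setD)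

text \<open>Bubble sort run backwards: as long as a rearrangement differs from the partition it has
  an ascent, and undoing that ascent lowers \<open>linv\<close> by one.\<close>

lemma rearr_induct [consumes 2, case_names base step]:
  assumes lam: "is_partition n lam" and "\<mu> \<in> rearr n lam" and "P lam"
    and step: "\<And>\<xi> i. \<xi> \<in> rearr n lam \<Longrightarrow> length \<xi> = n \<Longrightarrow> Suc i < n \<Longrightarrow> \<xi> ! i > \<xi> ! Suc i \<Longrightarrow>
      linv (sw i \<xi>) = Suc (linv \<xi>) \<Longrightarrow> P \<xi> \<Longrightarrow> P (sw i \<xi>)"
  shows "P \<mu>"
  using assms(2)
proof (induction "linv \<mu>" arbitrary: \<mu> rule: less_induct)
  case less
  have len: "length \<mu> = n" using less(2) by (simp add: rearr_def)
  show ?case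
  proof (cases "\<mu> = lam")
    case True
    thus ?thesis using assms(3) by simp
  next
    case False
    obtain i where i: "Suc i < n" "\<mu> ! i < \<mu> ! Suc i" using ascent_ex[OF lam less(2) False] .
    thus ?thesis
      using step[of "sw i \<mu>" i] less(1)[of "sw i \<mu>"] sw_rearr[OF less(2)] descent_of_sw[of i \<mu>] len by simp
  qed
qed

section \<open>Recursion on compositions\<close>

lemma lead_eqI:
  assumes "k \<le> length \<mu>" "\<And>j. j < k \<Longrightarrow> \<mu> ! j = 0" "k < length \<mu> \<Longrightarrow> \<mu> ! k > 0"
  shows "lead \<mu> = k"
proof -
  have "takeWhile (\<lambda>x. x = 0) \<mu> = take k \<mu>"
    by (rule takeWhile_eq_take_P_nth) (use assms in auto)
  thus ?thesis using assms by (simp add: lead_def)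
qed

lemma lead_le: "lead \<mu> \<le> length \<mu>"
  by (simp add: lead_def length_takeWhile_le)

lemma nth_before_lead: "j < lead \<mu> \<Longrightarrow> \<mu> ! j = 0"
  unfolding lead_def by (metis (mono_tags, lifting) nth_mem set_takeWhileD takeWhile_nth)

lemma nth_lead: "lead \<mu> < length \<mu> \<Longrightarrow> \<mu> ! lead \<mu> > 0"
  unfolding lead_def using nth_length_takeWhile by fastforce

lemma comp_less_induct [consumes 1, case_names less]:
  assumes "length \<mu> = n"
    and "\<And>\<mu>. length \<mu> = n \<Longrightarrow> (\<And>\<nu>. length \<nu> = n \<Longrightarrow>
      sum_list \<nu> < sum_list \<mu> \<or> sum_list \<nu> = sum_list \<mu> \<and> lead \<nu> < lead \<mu> \<Longrightarrow> P \<nu>) \<Longrightarrow> P \<mu>"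
  shows "P \<mu>"
  using assms(1)
proof (induction \<mu> rule: wf_induct_rule[OF wf_measures[of "[sum_list, lead]"]])
  case (1 \<mu>)
  thus ?case using assms(2)[of \<mu>] by auto
qed

text \<open>The recursion that builds all compositions. A positive first part comes from a rotation
  of a smaller composition; otherwise the first nonzero part is pushed one place to the left, which
  lowers \<open>lead\<close> and keeps the size.\<close>

lemma comp_cases:
  assumes "length \<mu> = n"
  obtains (zero) "\<mu> = replicate n 0"
    | (phi) \<nu> where "0 < n" "length \<nu> = n" "\<mu> = phi \<nu>" "sum_list \<nu> < sum_list \<mu>"
    | (sw) \<nu> i where "Suc i < n" "length \<nu> = n" "\<mu> = sw i \<nu>" "\<And>j. j < i \<Longrightarrow> \<nu> ! j = 0"
        "\<nu> ! i > 0" "\<nu> ! Suc i = 0" "sum_list \<nu> = sum_list \<mu>" "lead \<nu> = i" "lead \<mu> = Suc i"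
proof (cases "lead \<mu> = n")
  case True
  hence "\<mu> = replicate n 0"
    using assms nth_before_lead by (intro nth_equalityI) auto
  thus ?thesis by (rule zero)
next
  case False
  hence l: "lead \<mu> < n" using assms lead_le[of \<mu>] by simp
  show ?thesis
  proof (cases "lead \<mu>")
    case 0
    hence "\<mu> \<noteq> []" "\<mu> ! 0 > 0" using l assms nth_lead[of \<mu>] by auto
    then obtain \<nu> where "\<nu> \<noteq> []" "length \<nu> = length \<mu>" "\<mu> = phi \<nu>" using phi_surj by blast
    thus ?thesis using phi[of \<nu>] assms by (auto simp: sum_list_phi)
  next
    case (Suc i)
    have pos: "\<mu> ! Suc i > 0" using Suc l assms nth_lead[of \<mu>] by simp
    have z: "\<mu> ! j = 0" if "j < Suc i" for j using that Suc nth_before_lead by simp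
    have nth: "sw i \<mu> ! j = \<mu> ! adj i j" if "j < n" for j
      using that assms by (simp add: nth_sw)
    have z': "sw i \<mu> ! j = 0" if "j < i" for j
      using that l Suc nth[of j] z[of j] by (simp add: transpose_def)
    have "sw i \<mu> ! i > 0" using nth[of i] l Suc pos by simp
    moreover have "sw i \<mu> ! Suc i = 0" using nth[of "Suc i"] l Suc z by simp
    moreover from this have "lead (sw i \<mu>) = i"
      using z' calculation l Suc assms by (intro lead_eqI) auto
    ultimately show ?thesis
      using sw[of i "sw i \<mu>"] z' Suc l assms by auto
  qed
qed

lemma phi_sw:
  assumes "Suc (Suc i) < length \<mu>"
  shows "phi (sw i \<mu>) = sw (Suc i) (phi \<mu>)"
proof (rule nth_equalityI)
  have ne: "\<mu> \<noteq> []" "sw i \<mu> \<noteq> []" using assms by (auto simp flip: length_greater_0_conv)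
  show "length (phi (sw i \<mu>)) = length (sw (Suc i) (phi \<mu>))" using ne by simp
  fix j assume "j < length (phi (sw i \<mu>))"
  hence j: "j < length \<mu>" using ne by simp
  show "phi (sw i \<mu>) ! j = sw (Suc i) (phi \<mu>) ! j"
  proof (cases j)
    case 0
    thus ?thesis using j ne assms
      by (simp add: nth_sw nth_phi_0 last_conv_nth)
  next
    case (Suc k)
    have "adj (Suc i) (Suc k) = Suc (adj i k)"
      by (auto simp: transpose_def)
    moreover have "Suc (adj i k) < length \<mu>" using j Suc assms by (auto simp: transpose_def)
    ultimately show ?thesis using j ne Suc by (simp add: nth_sw nth_phi_Suc)
  qed
qed

text \<open>Two rotations carry the last two parts to the front, each raised by one and in the same
  order. A swap at the very front is thereby reduced to one at the very end.\<close>

lemma phi_phi_sw: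
  assumes "length \<mu> = Suc (Suc i)"
  shows "phi (phi (sw i \<mu>)) = sw 0 (phi (phi \<mu>))"
proof (rule nth_equalityI)
  have ne: "\<mu> \<noteq> []" "sw i \<mu> \<noteq> []" "phi \<mu> \<noteq> []" "phi (sw i \<mu>) \<noteq> []"
    using assms by (auto simp flip: length_greater_0_conv)
  show "length (phi (phi (sw i \<mu>))) = length (sw 0 (phi (phi \<mu>)))" using ne by simp
  have two: "phi (phi \<nu>) ! j = (if j = 0 then Suc (\<nu> ! i)
      else if j = 1 then Suc (\<nu> ! Suc i) else \<nu> ! (j - 2))"
    if \<nu>: "length \<nu> = Suc (Suc i)" "j < Suc (Suc i)" for \<nu> j
  proof -
    have [simp]: "\<nu> \<noteq> []" "phi \<nu> \<noteq> []" using \<nu> by (auto simp: phi_def)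
    show ?thesis
      using \<nu> by (cases j; cases "j - 1"; cases i)
        (auto simp: nth_phi_0 nth_phi_Suc last_conv_nth)
  qed
  fix j assume "j < length (phi (phi (sw i \<mu>)))"
  hence j: "j < Suc (Suc i)" using ne assms by simp
  show "phi (phi (sw i \<mu>)) ! j = sw 0 (phi (phi \<mu>)) ! j"
    using j assms ne by (auto simp: nth_sw two adj_less transpose_def)
qed

section \<open>Interpolation points\<close>

text \<open>All that the interpolation theory asks of q and t: they are nonzero and their monomials
  are pairwise distinct. This separates the nodes and keeps the fraction field out of the
  arguments.\<close>

locale generic_params =
  fixes q t :: "'a::field" and n :: nat
  assumes q_nz: "q \<noteq> 0" and t_nz: "t \<noteq> 0"
    and generic: "q ^ a * t ^ b = q ^ c * t ^ d \<Longrightarrow> a = c \<and> b = d"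
begin

abbreviation pt :: "nat list \<Rightarrow> nat \<Rightarrow> 'a" where
  "pt \<equiv> tilde q t"

lemma monomials_eq: "q ^ a / t ^ b = q ^ c / t ^ d \<Longrightarrow> a = c \<and> b = d"
  using generic[of a d c b] t_nz by (auto simp: field_simps)

lemma pt_nz: "pt \<nu> i \<noteq> 0"
  using q_nz t_nz by (simp add: tilde_def)

lemma pt_distinct:
  assumes "i < length \<nu>" "j < length \<nu>" "i \<noteq> j"
  shows "pt \<nu> i \<noteq> pt \<nu> j"
proof
  assume "pt \<nu> i = pt \<nu> j"
  hence *: "\<nu> ! i = \<nu> ! j" "kk \<nu> i = kk \<nu> j"
    using monomials_eq unfolding tilde_def by blast+
  with assms(3) have "beats \<nu> i j \<or> beats \<nu> j i" by (auto simp: beats_def)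
  thus False using *(2) kk_less assms by (metis less_irrefl)
qed

lemma pt_adj_distinct: "Suc i < length \<nu> \<Longrightarrow> pt \<nu> i \<noteq> pt \<nu> (Suc i)"
  by (rule pt_distinct) auto

lemma pt_sw:
  assumes "Suc i < length \<nu>" "\<nu> ! i \<noteq> \<nu> ! Suc i" "j < length \<nu>"
  shows "pt (sw i \<nu>) j = pt \<nu> (adj i j)"
  using assms by (simp add: tilde_def kk_sw nth_sw)

lemma pt_equal_parts:
  assumes "Suc i < length \<nu>" "\<nu> ! i = \<nu> ! Suc i"
  shows "pt \<nu> (Suc i) = t * pt \<nu> i"
  using assms t_nz by (simp add: tilde_def kk_eq[OF assms])

lemma pt_descent:
  assumes "Suc i < length \<nu>" "\<nu> ! i > \<nu> ! Suc i"
  shows "t * pt \<nu> (Suc i) \<noteq> pt \<nu> i"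
proof
  assume "t * pt \<nu> (Suc i) = pt \<nu> i"
  hence "q ^ (\<nu> ! Suc i) * t ^ Suc (kk \<nu> i) = q ^ (\<nu> ! i) * t ^ kk \<nu> (Suc i)"
    using t_nz by (simp add: tilde_def field_simps)
  thus False using generic assms by (metis less_irrefl)
qed

text \<open>The node of \<open>phi \<nu>\<close> is the rotated node of \<open>\<nu>\<close> with
  the former last coordinate multiplied by q. The change of variables in the operator
  \<open>Phi\<close> undoes exactly this.\<close>

lemma pt_phi_0: "\<nu> \<noteq> [] \<Longrightarrow> pt (phi \<nu>) 0 = q * pt \<nu> (length \<nu> - 1)"
  by (simp add: tilde_def kk_phi rotl_def nth_phi_0 last_conv_nth)

lemma pt_phi_Suc: "Suc j < length \<nu> \<Longrightarrow> pt (phi \<nu>) (Suc j) = pt \<nu> j"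
  by (subgoal_tac "\<nu> \<noteq> []") (auto simp: tilde_def kk_phi rotl_def nth_phi_Suc)

lemma pt_leading_zero: "\<nu> \<noteq> [] \<Longrightarrow> \<nu> ! 0 = 0 \<Longrightarrow> pt \<nu> 0 = 1 / t ^ (length \<nu> - 1)"
  by (simp add: tilde_def kk_zero)

lemma q_pt_nontrivial: "q * pt \<nu> i \<noteq> 1 / t ^ k"
proof
  assume "q * pt \<nu> i = 1 / t ^ k"
  hence "q ^ Suc (\<nu> ! i) / t ^ kk \<nu> i = q ^ 0 / t ^ k" by (simp add: tilde_def)
  thus False using monomials_eq by blast
qed

end

section \<open>Compositions as exponent vectors\<close>

lemma coeff_beyond_deg: "total_deg_le p d \<Longrightarrow> d < mdeg m \<Longrightarrow> coeff_at p m = 0"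
  by (metis in_keys_iff leD total_deg_le_def)

lemma sw_neq:
  assumes "Suc i < length \<nu>" "\<nu> ! i \<noteq> \<nu> ! Suc i" shows "sw i \<nu> \<noteq> \<nu>"
proof
  assume "sw i \<nu> = \<nu>"
  hence "sw i \<nu> ! i = \<nu> ! i" by simp
  thus False using assms by (simp add: nth_sw)
qed

lemma zero_comp_unique: "length \<nu> = n \<Longrightarrow> sum_list \<nu> = 0 \<Longrightarrow> \<nu> = replicate n (0::nat)"
  by (metis replicate_eqI sum_list_eq_0_iff)

lemma expo_mmon: "length \<mu> = n \<Longrightarrow> expo (mmon \<mu>) j = (if j < n then \<mu> ! j else 0)"
  by (simp add: mmon_def nth_default_def)

lemma keys_mmon: "length \<mu> = n \<Longrightarrow> mkeys (mmon \<mu>) \<subseteq> {..<n}"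
  by (auto simp: in_keys_iff expo_mmon split: if_splits)

lemma mdeg_mmon: "mdeg (mmon \<mu>) = sum_list \<mu>"
proof -
  have "mdeg (mmon \<mu>) = (\<Sum>i<length \<mu>. expo (mmon \<mu>) i)"
    by (rule mdeg_superset) (auto intro!: keys_mmon)
  also have "\<dots> = sum_list \<mu>"
    by (simp add: expo_mmon[OF refl] sum_list_sum_nth atLeast0LessThan)
  finally show ?thesis .
qed

lemma mmon_surj:
  assumes "mkeys m \<subseteq> {..<n}"
  shows "\<exists>\<mu>. length \<mu> = n \<and> m = mmon \<mu>"
proof (intro exI conjI)
  show "m = mmon (map (expo m) [0..<n])"
    by (rule poly_mapping_eqI) (use assms in \<open>auto simp: expo_mmon[of _ n] in_keys_iff subset_iff\<close>)
qed simp

lemma mon_perm_eqI: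
  assumes "bij \<sigma>" "\<And>j. expo m' (\<sigma> j) = expo m j"
  shows "mon_perm \<sigma> m = m'"
proof (rule poly_mapping_eqI)
  fix k
  obtain j where "k = \<sigma> j" using assms(1) by (metis bij_pointE)
  thus "expo (mon_perm \<sigma> m) k = expo m' k" using assms by (simp add: expo_mon_perm)
qed

lemma mon_perm_adj_mmon:
  assumes "Suc i < length \<mu>"
  shows "mon_perm (adj i) (mmon (sw i \<mu>)) = mmon \<mu>"
  by (rule mon_perm_eqI) (use assms in \<open>auto simp: expo_mmon[OF refl] nth_sw transpose_def\<close>)

lemma expo_mon_perm_adj:
  "expo (mon_perm (adj i) m) j = expo m (adj i j)"
  using expo_mon_perm[of "adj i" m "adj i j"] by simp

section \<open>Rotation and rescaling of the variables\<close>

definition rotr :: "nat \<Rightarrow> nat \<Rightarrow> nat" where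
  "rotr n j = (if Suc j = n then 0 else if Suc j < n then Suc j else j)"

lemma rotr_permutes: "rotr n permutes {..<n}"
proof (rule bij_imp_permutes)
  show "bij_betw (rotr n) {..<n} {..<n}"
    by (rule bij_betwI[of _ _ _ "rotl n"]) (auto simp: rotl_def rotr_def)
  show "\<And>j. j \<notin> {..<n} \<Longrightarrow> rotr n j = j" by (auto simp: rotr_def)
qed

lemma bij_rotr: "bij (rotr n)"
  by (rule permutes_bij[OF rotr_permutes])

lemma mmon_phi:
  assumes "length \<mu> = n" "0 < n"
  shows "mmon (phi \<mu>) = mvexp 0 + mon_perm (rotr n) (mmon \<mu>)"
proof (rule poly_mapping_eqI)
  fix k
  obtain j where k: "k = rotr n j" using bij_rotr by (metis bij_pointE)
  have ne: "\<mu> \<noteq> []" using assms by auto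
  have len: "length (phi \<mu>) = n" using ne assms by simp
  show "expo (mmon (phi \<mu>)) k = expo (mvexp 0 + mon_perm (rotr n) (mmon \<mu>)) k"
    using assms ne unfolding k
    by (simp add: lookup_add expo_mon_perm bij_rotr expo_mmon[OF len] expo_mmon[of \<mu> n])
       (auto simp: rotr_def lookup_single when_def nth_phi_0 nth_phi_Suc last_conv_nth, metis One_nat_def diff_Suc_1)
qed

text \<open>The substitution of \<open>x_k / q\<close> for \<open>x_k\<close>. Written on
  coefficients, it visibly keeps monomials and becomes the identity at q = 1.\<close>

definition scale_last :: "'a::field \<Rightarrow> nat \<Rightarrow> 'a mpoly \<Rightarrow> 'a mpoly" where
  "scale_last q k p = Poly_Mapping.mapp (\<lambda>m c. c / q ^ expo m k) p"

lemma coeff_scale_last: "coeff_at (scale_last q k p) m = coeff_at p m / q ^ expo m k"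
  by (simp add: scale_last_def lookup_mapp when_def in_keys_iff)

lemma keys_scale_last: "mkeys (scale_last q k p) \<subseteq> mkeys p"
  by (auto simp: in_keys_iff coeff_scale_last)

lemma mon_val_scale: "mon_val (z(k := z k / q)) m = mon_val z m / (q :: 'a::field) ^ expo m k"
proof -
  let ?A = "mkeys m - {k}"
  have *: "mon_val w m = w k ^ expo m k * (\<Prod>i\<in>?A. w i ^ expo m i)" for w :: "nat \<Rightarrow> 'a"
    using mon_val_superset[of "insert k (mkeys m)" m w]
    by (simp add: prod.insert_remove subset_insertI)
  show ?thesis unfolding *[of z] *[of "z(k := z k / q)"]
    by (simp add: power_divide)
qed

lemma meval_superset:
  assumes "finite A" "mkeys p \<subseteq> A"
  shows "meval p z = (\<Sum>m\<in>A. coeff_at p m * mon_val z m)"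
  unfolding meval_heval using assms by (rule id_hom.heval_superset)

lemma meval_scale_last: "meval (scale_last q k p) z = meval p (z(k := z k / q))"
proof -
  have "meval (scale_last q k p) z = (\<Sum>m\<in>mkeys p. coeff_at (scale_last q k p) m * mon_val z m)"
    by (rule meval_superset) (simp_all add: keys_scale_last)
  also have "\<dots> = meval p (z(k := z k / q))"
    by (simp add: meval_superset[of "mkeys p"] coeff_scale_last mon_val_scale)
  finally show ?thesis .
qed

section \<open>Interpolation polynomials\<close>

context generic_params
begin

lemma meval_pt_sw:
  assumes "in_vars n p" "length \<nu> = n" "Suc i < n" "\<nu> ! i \<noteq> \<nu> ! Suc i"
  shows "meval p (pt \<nu> \<circ> adj i) = meval p (pt (sw i \<nu>))"
  using assms by (intro meval_cong[of n]) (auto simp: pt_sw)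

lemma val_sw_sym:
  assumes "mswap i p = p" "in_vars n p" "length \<nu> = n" "Suc i < n"
  shows "meval p (pt (sw i \<nu>)) = meval p (pt \<nu>)"
proof (cases "\<nu> ! i = \<nu> ! Suc i")
  case True
  thus ?thesis using assms by (simp add: sw_eq_self)
next
  case False
  thus ?thesis using meval_pt_sw[OF assms(2-4)] meval_mswap[of i p "pt \<nu>"] assms(1) by simp
qed

text \<open>At such a node the next coordinate is t times the present one, so the factor
  \<open>t x_i - x_{i+1}\<close> vanishes. The exchanged point, which is not a node, thus drops out:
  values of T_i p at nodes depend only on values of p at nodes.\<close>

lemma val_Ti_eq:
  assumes "length \<nu> = n" "Suc i < n" "\<nu> ! i = \<nu> ! Suc i"
  shows "meval (Ti t i p) (pt \<nu>) = t * meval p (pt \<nu>)"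
proof -
  have "pt \<nu> (Suc i) = t * pt \<nu> i" using assms by (simp add: pt_equal_parts)
  moreover have "pt \<nu> i \<noteq> pt \<nu> (Suc i)" using assms by (simp add: pt_adj_distinct)
  ultimately have "1 - t \<noteq> 0" "pt \<nu> i - t * pt \<nu> i = (1 - t) * pt \<nu> i" by (auto simp: algebra_simps)
  thus ?thesis
    using \<open>pt \<nu> (Suc i) = _\<close> \<open>pt \<nu> i \<noteq> pt \<nu> (Suc i)\<close> pt_nz[of \<nu> i]
    by (simp add: meval_Ti)
qed

lemma val_Ti_neq:
  assumes "in_vars n p" "length \<nu> = n" "Suc i < n" "\<nu> ! i \<noteq> \<nu> ! Suc i"
  shows "meval (Ti t i p) (pt \<nu>) = ((1 - t) * pt \<nu> (Suc i) * meval p (pt \<nu>)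
    + (t * pt \<nu> i - pt \<nu> (Suc i)) * meval p (pt (sw i \<nu>))) / (pt \<nu> i - pt \<nu> (Suc i))"
  using assms by (simp add: meval_Ti pt_adj_distinct meval_pt_sw)

text \<open>The linear factor vanishes at each node whose composition starts with 0, where the first
  coordinate is \<open>1 / t ^ (n - 1)\<close>. Any other composition is some
  \<open>phi \<nu>\<close>, and there the rotated factor returns the value of \<open>p\<close> at
  the node of \<open>\<nu>\<close>.\<close>

definition Phi :: "'a mpoly \<Rightarrow> 'a mpoly" where
  "Phi p = (mvar 0 - mconst (1 / t ^ (n - 1))) * mperm (rotr n) (scale_last q (n - 1) p)"

lemma in_vars_scale_last: "in_vars n p \<Longrightarrow> in_vars n (scale_last q k p)"
  using keys_scale_last[of q k p] by (auto simp: in_vars_def)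

lemma total_deg_le_scale_last: "total_deg_le p d \<Longrightarrow> total_deg_le (scale_last q k p) d"
  using keys_scale_last[of q k p] by (auto simp: total_deg_le_def)

lemma total_deg_le_rot: "total_deg_le p d \<Longrightarrow> total_deg_le (mperm (rotr n) (scale_last q (n - 1) p)) d"
  by (intro total_deg_le_mperm bij_rotr total_deg_le_scale_last)

lemma in_vars_Phi: "0 < n \<Longrightarrow> in_vars n p \<Longrightarrow> in_vars n (Phi p)"
  unfolding Phi_def using permutes_image[OF rotr_permutes, of n]
  by (intro in_vars_mult in_vars_diff in_vars_var in_vars_mperm in_vars_scale_last bij_rotr) auto

lemma total_deg_le_Phi: "total_deg_le p d \<Longrightarrow> total_deg_le (Phi p) (Suc d)"
  unfolding Phi_def
  by (intro total_deg_le_mult[of _ 1 _ d] total_deg_le_diff total_deg_le_var total_deg_le_rot) auto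

lemma val_Phi:
  assumes "in_vars n p" "length \<nu> = n" "0 < n"
  shows "meval (Phi p) (pt (phi \<nu>)) = (q * pt \<nu> (n - 1) - 1 / t ^ (n - 1)) * meval p (pt \<nu>)"
proof -
  have ne: "\<nu> \<noteq> []" using assms by auto
  have "meval (mperm (rotr n) (scale_last q (n - 1) p)) (pt (phi \<nu>)) = meval p (pt \<nu>)"
    unfolding meval_mperm meval_scale_last
  proof (rule meval_cong[OF assms(1)])
    fix j assume "j < n"
    then consider "Suc j < n" | "Suc j = n" by linarith
    thus "((\<lambda>i. pt (phi \<nu>) (rotr n i)) (n - 1 := pt (phi \<nu>) (rotr n (n - 1)) / q)) j = pt \<nu> j"
    proof cases
      case 1
      hence "j \<noteq> n - 1" by simp
      thus ?thesis using 1 assms by (simp add: rotr_def pt_phi_Suc)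
    next
      case 2
      thus ?thesis using assms ne q_nz by (auto simp: rotr_def pt_phi_0)
    qed
  qed
  thus ?thesis unfolding Phi_def using assms ne by (simp add: pt_phi_0)
qed

lemma val_Phi_0:
  assumes "length \<nu> = n" "0 < n" "\<nu> ! 0 = 0"
  shows "meval (Phi p) (pt \<nu>) = 0"
  unfolding Phi_def using assms pt_leading_zero[of \<nu>] by auto

lemma coeff_Phi_top:
  assumes "total_deg_le p d" "mdeg m = Suc d" "expo m 0 = 0"
  shows "coeff_at (Phi p) m = 0"
proof -
  have "coeff_at (mperm (rotr n) (scale_last q (n - 1) p)) m = 0"
    using assms(2) by (intro coeff_beyond_deg[OF total_deg_le_rot[OF assms(1)]]) simp
  thus ?thesis unfolding Phi_def
    by (simp add: left_diff_distrib lookup_minus coeff_var_mult_0 assms)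
qed

lemma coeff_Phi:
  assumes "total_deg_le p (sum_list \<mu>)" "length \<mu> = n" "0 < n"
  shows "coeff_at (Phi p) (mmon (phi \<mu>)) = coeff_at p (mmon \<mu>) / q ^ last \<mu>"
proof -
  let ?r = "mperm (rotr n) (scale_last q (n - 1) p)"
  have ne: "\<mu> \<noteq> []" using assms by auto
  have "coeff_at ?r (mmon (phi \<mu>)) = 0"
    using ne by (intro coeff_beyond_deg[OF total_deg_le_rot[OF assms(1)]]) (simp add: mdeg_mmon sum_list_phi)
  moreover have "coeff_at (mvar 0 * ?r) (mmon (phi \<mu>)) = coeff_at p (mmon \<mu>) / q ^ last \<mu>"
    unfolding mmon_phi[OF assms(2,3)] coeff_var_mult_add coeff_mperm[OF bij_rotr]
    using assms ne by (simp add: coeff_scale_last expo_mmon[of \<mu> n] last_conv_nth)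
  ultimately show ?thesis unfolding Phi_def by (simp add: left_diff_distrib lookup_minus)
qed

section \<open>Existence of E* by recursion\<close>

definition isE :: "nat list \<Rightarrow> 'a mpoly \<Rightarrow> bool" where
  "isE \<mu> p \<longleftrightarrow> in_vars n p \<and> total_deg_le p (sum_list \<mu>) \<and> coeff_at p (mmon \<mu>) = 1 \<and>
      (\<forall>\<nu>. length \<nu> = n \<and> sum_list \<nu> \<le> sum_list \<mu> \<and> \<nu> \<noteq> \<mu> \<longrightarrow> meval p (pt \<nu>) = 0)"

text \<open>Chosen so that \<open>Tcorr \<mu> i p\<close> vanishes at the node of
  \<open>\<mu>\<close> when \<open>p\<close> vanishes at that of \<open>sw i \<mu>\<close>: it is
  minus the coefficient with which T_i keeps the old value.\<close>

definition corr :: "nat list \<Rightarrow> nat \<Rightarrow> 'a" where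
  "corr \<mu> i = (t - 1) * pt \<mu> (Suc i) / (pt \<mu> i - pt \<mu> (Suc i))"

abbreviation Tcorr :: "nat list \<Rightarrow> nat \<Rightarrow> 'a mpoly \<Rightarrow> 'a mpoly" where
  "Tcorr \<mu> i p \<equiv> Ti t i p + mconst (corr \<mu> i) * p"

text \<open>With x and y the coordinates of the node of \<open>\<mu>\<close> at i and i+1, this is
  the coefficient with which T_i carries the value at \<open>\<mu>\<close> over to
  \<open>sw i \<mu>\<close>.\<close>

definition rho :: "'a \<Rightarrow> 'a \<Rightarrow> 'a" where
  "rho x y = (t * y - x) / (y - x)"

text \<open>The power of q restores the leading coefficient, which \<open>scale_last\<close> has
  divided by \<open>q ^ last \<mu>\<close>. The nodes to be tested either start with 0 or come from
  nodes of size at most that of \<open>\<mu>\<close>.\<close>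

lemma isE_phi:
  assumes "isE \<mu> p" "length \<mu> = n" "0 < n"
  shows "isE (phi \<mu>) (mconst (q ^ last \<mu>) * Phi p)"
  unfolding isE_def
proof (intro conjI allI impI)
  have ne: "\<mu> \<noteq> []" using assms by auto
  show "in_vars n (mconst (q ^ last \<mu>) * Phi p)"
    using assms by (intro in_vars_mult in_vars_Phi) (simp_all add: isE_def)
  show "total_deg_le (mconst (q ^ last \<mu>) * Phi p) (sum_list (phi \<mu>))"
    unfolding sum_list_phi[OF ne] using assms
    by (intro total_deg_le_cmult total_deg_le_Phi) (simp add: isE_def)
  show "coeff_at (mconst (q ^ last \<mu>) * Phi p) (mmon (phi \<mu>)) = 1"
    using assms q_nz by (simp add: isE_def coeff_Phi)
  fix \<nu> assume \<nu>: "length \<nu> = n \<and> sum_list \<nu> \<le> sum_list (phi \<mu>) \<and> \<nu> \<noteq> phi \<mu>"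
  have ne': "\<nu> \<noteq> []" using \<nu> assms by auto
  show "meval (mconst (q ^ last \<mu>) * Phi p) (pt \<nu>) = 0"
  proof (cases "\<nu> ! 0 = 0")
    case True
    thus ?thesis using \<nu> assms by (simp add: val_Phi_0)
  next
    case False
    then obtain \<xi> where \<xi>: "\<xi> \<noteq> []" "length \<xi> = length \<nu>" "\<nu> = phi \<xi>"
      using phi_surj ne' by blast
    hence "meval p (pt \<xi>) = 0"
      using \<nu> assms ne by (auto simp: isE_def sum_list_phi)
    thus ?thesis using \<xi> \<nu> assms by (simp add: val_Phi isE_def)
  qed
qed

text \<open>T_i mixes only the values at \<open>\<nu>\<close> and \<open>sw i \<nu>\<close>, so
  nonzero values can appear at \<open>\<mu>\<close> and \<open>sw i \<mu>\<close> alone, and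
  \<open>corr\<close> removes the former. This works at every descent.\<close>

lemma val_step_other:
  assumes "in_vars n p" "length \<mu> = n" "Suc i < n" "\<mu> ! i > \<mu> ! Suc i"
    and "\<And>\<nu>. length \<nu> = n \<Longrightarrow> sum_list \<nu> \<le> sum_list \<mu> \<Longrightarrow> \<nu> \<noteq> \<mu> \<Longrightarrow> meval p (pt \<nu>) = 0"
    and "length \<nu> = n" "sum_list \<nu> \<le> sum_list \<mu>" "\<nu> \<noteq> sw i \<mu>"
  shows "meval (Tcorr \<mu> i p) (pt \<nu>) = 0"
proof (cases "\<nu> = \<mu>")
  case True
  have "meval p (pt (sw i \<mu>)) = 0"
    using assms by (intro assms(5)) (auto simp: sw_neq)
  thus ?thesis
    using assms pt_adj_distinct[of i \<mu>] unfolding True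
    by (simp add: val_Ti_neq corr_def field_simps)
next
  case False
  hence z: "meval p (pt \<nu>) = 0" using assms by blast
  show ?thesis
  proof (cases "\<nu> ! i = \<nu> ! Suc i")
    case True
    thus ?thesis using assms z by (simp add: val_Ti_eq)
  next
    case neq: False
    have "meval p (pt (sw i \<nu>)) = 0"
      using assms by (intro assms(5)) (auto simp: sw_eq_iff)
    thus ?thesis using assms z neq by (simp add: val_Ti_neq)
  qed
qed

lemma val_step:
  assumes "in_vars n p" "length \<mu> = n" "Suc i < n" "\<mu> ! i > \<mu> ! Suc i" "meval p (pt (sw i \<mu>)) = 0"
  shows "meval (Ti t i p) (pt (sw i \<mu>)) = rho (pt \<mu> i) (pt \<mu> (Suc i)) * meval p (pt \<mu>)"
  using assms by (simp add: val_Ti_neq nth_sw pt_sw rho_def)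

lemma rho_nz:
  assumes "length \<mu> = n" "Suc i < n" "\<mu> ! i > \<mu> ! Suc i"
  shows "rho (pt \<mu> i) (pt \<mu> (Suc i)) \<noteq> 0"
  using pt_descent[of i \<mu>] pt_adj_distinct[of i \<mu>] assms by (auto simp: rho_def)

text \<open>Normalisation is the restrictive part. \<open>coeff_Ti\<close> gives the coefficient at
  the exponent of \<open>sw i \<mu>\<close>, which has a 0 at i, and the terms other than the wanted
  one disappear because each top-degree monomial of \<open>p\<close> involves one of the variables
  up to i. The second claim passes this property on.\<close>

lemma isE_step:
  assumes E: "isE \<mu> p" and \<mu>: "length \<mu> = n" "Suc i < n" "\<And>j. j < i \<Longrightarrow> \<mu> ! j = 0" "\<mu> ! i > 0" "\<mu> ! Suc i = 0"
    and top: "\<And>m. m \<in> mkeys p \<Longrightarrow> mdeg m = sum_list \<mu> \<Longrightarrow> \<exists>j\<le>i. expo m j \<noteq> 0"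
  shows "isE (sw i \<mu>) (Tcorr \<mu> i p)"
    and "m \<in> mkeys (Tcorr \<mu> i p) \<Longrightarrow> mdeg m = sum_list \<mu> \<Longrightarrow>
      \<exists>j\<le>Suc i. expo m j \<noteq> 0"
proof -
  let ?s = "adj i"
  have zero: "coeff_at p m = 0" if "mdeg m = sum_list \<mu>" "\<And>j. j \<le> i \<Longrightarrow> expo m j = 0" for m
    using top[of m] that by (metis in_keys_iff)
  show "isE (sw i \<mu>) (Tcorr \<mu> i p)"
    unfolding isE_def
  proof (intro conjI allI impI)
    show "in_vars n (Tcorr \<mu> i p)"
      using assms by (auto simp: isE_def intro!: in_vars_Ti)
    show "total_deg_le (Tcorr \<mu> i p) (sum_list (sw i \<mu>))"
      using assms by (auto simp: isE_def intro!: total_deg_le_Ti)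
    have "expo (mmon (sw i \<mu>)) j = 0" if "j \<le> i" for j
      using \<mu> that by (auto simp: expo_mmon[of "sw i \<mu>" n] nth_sw transpose_def)
    hence "coeff_at p (mmon (sw i \<mu>)) = 0" "expo (mmon (sw i \<mu>)) i = 0"
      using \<mu> by (auto intro!: zero simp: mdeg_mmon)
    thus "coeff_at (Tcorr \<mu> i p) (mmon (sw i \<mu>)) = 1"
      using \<mu> E by (simp add: lookup_add coeff_Ti mon_perm_adj_mmon isE_def)
    fix \<nu> assume "length \<nu> = n \<and> sum_list \<nu> \<le> sum_list (sw i \<mu>) \<and> \<nu> \<noteq> sw i \<mu>"
    thus "meval (Tcorr \<mu> i p) (pt \<nu>) = 0"
      using assms by (intro val_step_other) (auto simp: isE_def)
  qed
  assume m: "m \<in> mkeys (Tcorr \<mu> i p)" "mdeg m = sum_list \<mu>"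
  show "\<exists>j\<le>Suc i. expo m j \<noteq> 0"
  proof (rule ccontr)
    assume "\<not> (\<exists>j\<le>Suc i. expo m j \<noteq> 0)"
    hence z: "expo m j = 0" if "j \<le> Suc i" for j using that by blast
    have "coeff_at p m = 0" using m z by (intro zero) auto
    moreover have "coeff_at p (mon_perm ?s m) = 0"
      using m z by (intro zero) (auto simp: mdeg_mon_perm expo_mon_perm_adj transpose_def)
    ultimately have "coeff_at (Tcorr \<mu> i p) m = 0"
      using z by (simp add: lookup_add coeff_Ti)
    thus False using m by (simp add: in_keys_iff)
  qed
qed

lemma isE_zero: "isE (replicate n 0) 1"
proof -
  have "mmon (replicate n 0) = 0" by (rule poly_mapping_eqI) (simp add: expo_mmon[of _ n])
  moreover have "\<nu> = replicate n 0" if "length \<nu> = n" "sum_list \<nu> \<le> sum_list (replicate n 0)"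
    for \<nu> :: "nat list"
    using that by (intro zero_comp_unique) (simp_all add: sum_list_replicate)
  ultimately show ?thesis
    unfolding isE_def by (intro conjI allI impI) (simp_all, blast)
qed

text \<open>The statement is strengthened for the recursion by the value at the own node, needed for
  unisolvence, and by the condition on top-degree monomials. The guard \<open>lead \<mu> < n\<close>
  exempts the zero composition, whose polynomial 1 contains no variable.\<close>

lemma E_ex:
  assumes "length \<mu> = n"
  shows "\<exists>p. isE \<mu> p \<and> meval p (pt \<mu>) \<noteq> 0 \<and>
    (lead \<mu> < n \<longrightarrow> (\<forall>m\<in>mkeys p. mdeg m = sum_list \<mu> \<longrightarrow> (\<exists>j\<le>lead \<mu>. expo m j \<noteq> 0)))"
  using assms
proof (induction \<mu> rule: comp_less_induct)
  case (less \<mu>)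
  from less(1) show ?case
  proof (cases \<mu> rule: comp_cases)
    case zero
    have "lead \<mu> = n" unfolding zero by (rule lead_eqI) auto
    moreover have "isE \<mu> 1" unfolding zero by (rule isE_zero)
    ultimately show ?thesis by (intro exI[of _ 1]) auto
  next
    case (phi \<nu>)
    then obtain p where p: "isE \<nu> p" "meval p (pt \<nu>) \<noteq> 0" using less by blast
    have ne: "\<nu> \<noteq> []" using phi by auto
    have "lead \<mu> = 0" using phi ne by (intro lead_eqI) (auto simp: nth_phi_0)
    moreover have "expo m 0 \<noteq> 0"
      if "m \<in> mkeys (mconst (q ^ last \<nu>) * Phi p)" "mdeg m = sum_list \<mu>" for m
    proof
      assume "expo m 0 = 0"
      hence "coeff_at (Phi p) m = 0"
        using that phi ne p by (intro coeff_Phi_top[of _ "sum_list \<nu>"]) (auto simp: isE_def sum_list_phi)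
      thus False using that by (simp add: in_keys_iff)
    qed
    moreover have "meval (mconst (q ^ last \<nu>) * Phi p) (pt \<mu>) \<noteq> 0"
      using p phi q_nz q_pt_nontrivial[of \<nu> "n - 1" "n - 1"] by (simp add: val_Phi isE_def)
    ultimately show ?thesis
      using isE_phi[OF p(1) phi(2,1)] phi(3) by (intro exI[of _ "mconst (q ^ last \<nu>) * Phi p"]) auto
  next
    case (sw \<nu> i)
    hence "sum_list \<nu> = sum_list \<mu> \<and> lead \<nu> < lead \<mu>" by simp
    then obtain p where p: "isE \<nu> p" "meval p (pt \<nu>) \<noteq> 0"
      and top: "lead \<nu> < n \<longrightarrow> (\<forall>m\<in>mkeys p. mdeg m = sum_list \<nu> \<longrightarrow> (\<exists>j\<le>lead \<nu>. expo m j \<noteq> 0))"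
      using less(2)[OF sw(2)] by blast
    have top: "\<exists>j\<le>i. expo m j \<noteq> 0" if "m \<in> mkeys p" "mdeg m = sum_list \<nu>" for m
      using top that sw(1,8) by simp
    note step = isE_step[OF p(1) sw(2,1,4,5,6) top]
    have "sw i \<nu> \<noteq> \<nu>" using sw by (intro sw_neq) auto
    hence z: "meval p (pt (sw i \<nu>)) = 0" using p(1) sw(1,2) unfolding isE_def by simp
    have desc: "\<nu> ! i > \<nu> ! Suc i" using sw(5,6) by simp
    have "in_vars n p" using p(1) by (simp add: isE_def)
    hence "meval (Ti t i p) (pt (sw i \<nu>)) \<noteq> 0"
      using rho_nz[OF sw(2,1) desc] p(2) by (simp add: val_step[OF _ sw(2,1) desc z])
    hence "meval (Tcorr \<nu> i p) (pt \<mu>) \<noteq> 0" unfolding sw(3) using z by simp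
    thus ?thesis using step unfolding sw(9) sw(7)[symmetric] sw(3)[symmetric] by blast
  qed
qed

text \<open>Dimension count. The polynomials of \<open>E_ex\<close> are triangular with respect to
  evaluation at the nodes, hence independent, and there are as many as monomials of degree at most
  d. A nonzero \<open>p\<close> vanishing at all nodes would be independent of them, which is one
  vector too many.\<close>

lemma interp_zero:
  assumes "in_vars n p" "total_deg_le p d"
    and "\<And>\<nu>. length \<nu> = n \<Longrightarrow> sum_list \<nu> \<le> d \<Longrightarrow> meval p (pt \<nu>) = 0"
  shows "p = 0"
proof (rule ccontr)
  assume "p \<noteq> 0"
  interpret vs: vector_space "\<lambda>c (p :: 'a mpoly). mconst c * p"
    by unfold_locales (auto simp: algebra_simps mconst_add mconst_mult)
  define X where "X = {\<nu>. length \<nu> = n \<and> sum_list \<nu> \<le> d}"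
  let ?M = "(\<lambda>\<nu>. mterm (mmon \<nu>) (1::'a)) ` X"
  have finX: "finite X"
  proof (rule finite_subset)
    show "X \<subseteq> {\<nu>. set \<nu> \<subseteq> {..d} \<and> length \<nu> = n}"
      unfolding X_def using member_le_sum_list by fastforce
    show "finite {\<nu>. set \<nu> \<subseteq> {..d} \<and> length \<nu> = n}"
      by (rule finite_lists_length_eq) simp
  qed
  obtain e where e: "\<And>\<mu>. length \<mu> = n \<Longrightarrow> isE \<mu> (e \<mu>) \<and> meval (e \<mu>) (pt \<mu>) \<noteq> 0"
    using E_ex by metis
  have e_zero: "meval (e \<mu>) (pt \<nu>) = 0"
    if "length \<mu> = n" "length \<nu> = n" "sum_list \<nu> \<le> sum_list \<mu>" "\<nu> \<noteq> \<mu>" for \<mu> \<nu>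
    using e[OF that(1)] that unfolding isE_def by blast
  have inj: "inj_on e X"
  proof (rule inj_onI, rule ccontr)
    fix \<mu> \<nu> assume *: "\<mu> \<in> X" "\<nu> \<in> X" "e \<mu> = e \<nu>" "\<mu> \<noteq> \<nu>"
    hence "length \<mu> = n" "length \<nu> = n" by (auto simp: X_def)
    hence "meval (e \<mu>) (pt \<nu>) = 0 \<or> meval (e \<nu>) (pt \<mu>) = 0"
      using e_zero[of \<mu> \<nu>] e_zero[of \<nu> \<mu>] *(4) by (metis nat_le_linear)
    thus False using * e[of \<mu>] e[of \<nu>] unfolding X_def by auto
  qed
  have p_new: "p \<notin> e ` X"
    using assms(3) e unfolding X_def by blast
  have in_span: "r \<in> vs.span ?M" if "in_vars n r" "total_deg_le r d" for r
  proof -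
    have "mterm m (coeff_at r m) \<in> vs.span ?M" if m: "m \<in> mkeys r" for m
    proof -
      obtain \<mu> where \<mu>: "length \<mu> = n" "m = mmon \<mu>"
        using m \<open>in_vars n r\<close> mmon_surj unfolding in_vars_def by blast
      hence "\<mu> \<in> X" using m \<open>total_deg_le r d\<close> unfolding X_def total_deg_le_def
        by (auto simp: mdeg_mmon)
      hence "mconst (coeff_at r m) * mterm (mmon \<mu>) 1 \<in> vs.span ?M"
        by (intro vs.span_scale vs.span_base imageI)
      thus ?thesis using \<mu> by (simp add: mconst_def mult_single)
    qed
    hence "(\<Sum>m\<in>mkeys r. mterm m (coeff_at r m)) \<in> vs.span ?M"
      by (rule vs.span_sum)
    thus ?thesis by (simp flip: mpoly_as_sum)
  qed
  have "vs.independent (insert p (e ` X))"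
  proof
    assume "vs.dependent (insert p (e ` X))"
    then obtain u where u: "\<exists>v\<in>insert p (e ` X). u v \<noteq> 0" "(\<Sum>v\<in>insert p (e ` X). mconst (u v) * v) = 0"
      using finX by (auto simp: vs.dependent_finite)
    have sum: "mconst (u p) * p + (\<Sum>\<nu>\<in>X. mconst (u (e \<nu>)) * e \<nu>) = 0"
      using u(2) p_new inj finX by (simp add: sum.reindex)
    \<comment> \<open>Evaluate the relation at the node of \<open>\<nu>\<close>: \<open>p\<close>
      vanishes there, polynomials of the same or larger size vanish except that of
      \<open>\<nu>\<close>, and smaller sizes already have coefficient 0.\<close>
    have z: "u (e \<nu>) = 0" if "\<nu> \<in> X" for \<nu>
      using that
    proof (induction "sum_list \<nu>" arbitrary: \<nu> rule: less_induct)
      case less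
      have "0 = meval (mconst (u p) * p + (\<Sum>\<xi>\<in>X. mconst (u (e \<xi>)) * e \<xi>)) (pt \<nu>)"
        unfolding sum by simp
      also have "\<dots> = (\<Sum>\<xi>\<in>X. u (e \<xi>) * meval (e \<xi>) (pt \<nu>))"
        using less assms(3) unfolding X_def by simp
      also have "\<dots> = (\<Sum>\<xi>\<in>{\<nu>}. u (e \<xi>) * meval (e \<xi>) (pt \<nu>))"
      proof (rule sum.mono_neutral_right)
        show "\<forall>\<xi>\<in>X - {\<nu>}. u (e \<xi>) * meval (e \<xi>) (pt \<nu>) = 0"
        proof
          fix \<xi> assume \<xi>: "\<xi> \<in> X - {\<nu>}"
          show "u (e \<xi>) * meval (e \<xi>) (pt \<nu>) = 0"
          proof (cases "sum_list \<xi> < sum_list \<nu>")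
            case True
            thus ?thesis using less(1) \<xi> by simp
          next
            case False
            thus ?thesis using e_zero[of \<xi> \<nu>] \<xi> less(2) unfolding X_def by auto
          qed
        qed
      qed (use finX less in auto)
      finally show ?case using e[of \<nu>] less(2) unfolding X_def by auto
    qed
    hence "mconst (u p) * p = 0" using sum by simp
    moreover obtain m where "coeff_at p m \<noteq> 0" using \<open>p \<noteq> 0\<close> by (metis lookup_zero poly_mapping_eqI)
    ultimately have "u p = 0" using coeff_cmult[of "u p" p m] by (metis lookup_zero mult_eq_0_iff)
    thus False using u(1) z by auto
  qed
  moreover have "insert p (e ` X) \<subseteq> vs.span ?M"
  proof
    fix r assume "r \<in> insert p (e ` X)"
    then consider "r = p" | \<mu> where "\<mu> \<in> X" "r = e \<mu>" by blast
    thus "r \<in> vs.span ?M"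
    proof cases
      case 1
      thus ?thesis using assms in_span by blast
    next
      case 2
      hence "isE \<mu> (e \<mu>)" "sum_list \<mu> \<le> d" using e[of \<mu>] by (auto simp: X_def)
      thus ?thesis unfolding 2(2) isE_def by (blast intro: in_span total_deg_le_mono)
    qed
  qed
  ultimately have "card (insert p (e ` X)) \<le> card ?M"
    using finX vs.independent_span_bound by blast
  also have "\<dots> \<le> card X" using finX by (rule card_image_le)
  finally show False using p_new finX card_image[OF inj] by simp
qed

section \<open>Uniqueness and Lagrange expansion\<close>

lemma interp_unique:
  assumes "in_vars n p" "total_deg_le p d" "in_vars n r" "total_deg_le r d"
    and "\<And>\<nu>. length \<nu> = n \<Longrightarrow> sum_list \<nu> \<le> d \<Longrightarrow> meval p (pt \<nu>) = meval r (pt \<nu>)"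
  shows "p = r"
  using interp_zero[of "p - r" d] assms by (simp add: in_vars_diff total_deg_le_diff)

abbreviation E :: "nat list \<Rightarrow> 'a mpoly" where
  "E \<equiv> Estar q t n"

definition H :: "nat list \<Rightarrow> 'a" where
  "H \<mu> = meval (E \<mu>) (pt \<mu>)"

text \<open>The interpolation conditions leave the value at the own node free. Matching it by a
  scalar makes two solutions proportional, and the leading coefficient makes the scalar 1.\<close>

lemma isE_unique:
  assumes "length \<mu> = n" "isE \<mu> p" "isE \<mu> r"
  shows "p = r"
proof -
  obtain e where e: "isE \<mu> e" "meval e (pt \<mu>) \<noteq> 0" using E_ex[OF assms(1)] by blast
  have "s = e" if s: "isE \<mu> s" for s
  proof -
    define c where "c = meval s (pt \<mu>) / meval e (pt \<mu>)"
    have *: "s = mconst c * e"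
    proof (rule interp_unique[of _ "sum_list \<mu>"])
      fix \<nu> assume "length \<nu> = n" "sum_list \<nu> \<le> sum_list \<mu>"
      thus "meval s (pt \<nu>) = meval (mconst c * e) (pt \<nu>)"
        using e s unfolding isE_def c_def by (cases "\<nu> = \<mu>") auto
    qed (use e s in \<open>auto simp: isE_def\<close>)
    have "c = 1"
      using arg_cong[OF *, of "\<lambda>x. coeff_at x (mmon \<mu>)"] e s by (simp add: isE_def)
    thus ?thesis using * by simp
  qed
  thus ?thesis using assms by metis
qed

lemma isE_E: "length \<mu> = n \<Longrightarrow> isE \<mu> (E \<mu>)"
proof -
  assume \<mu>: "length \<mu> = n"
  have "E \<mu> = (THE p. isE \<mu> p)" by (simp add: Estar_def isE_def)
  thus ?thesis using theI'[of "isE \<mu>"] E_ex[OF \<mu>] isE_unique[OF \<mu>] by metis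
qed

lemma E_eqI: "length \<mu> = n \<Longrightarrow> isE \<mu> p \<Longrightarrow> E \<mu> = p"
  using isE_unique isE_E by blast

lemma E_props:
  assumes "length \<mu> = n"
  shows "in_vars n (E \<mu>)" "total_deg_le (E \<mu>) (sum_list \<mu>)" "coeff_at (E \<mu>) (mmon \<mu>) = 1"
    "length \<nu> = n \<Longrightarrow> sum_list \<nu> \<le> sum_list \<mu> \<Longrightarrow> \<nu> \<noteq> \<mu> \<Longrightarrow> meval (E \<mu>) (pt \<nu>) = 0"
  using isE_E[OF assms] unfolding isE_def by blast+

lemma H_nz: "length \<mu> = n \<Longrightarrow> H \<mu> \<noteq> 0"
  unfolding H_def using E_ex E_eqI by blast

text \<open>Lagrange interpolation: among the nodes of size at most d, \<open>E \<xi>\<close> with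
  \<open>\<xi>\<close> of size d is nonzero only at its own.\<close>

lemma E_expansion:
  assumes "finite A" "\<And>\<xi>. \<xi> \<in> A \<Longrightarrow> length \<xi> = n \<and> sum_list \<xi> = d"
    and "in_vars n p" "total_deg_le p d"
    and "\<And>\<nu>. length \<nu> = n \<Longrightarrow> sum_list \<nu> \<le> d \<Longrightarrow> \<nu> \<notin> A \<Longrightarrow> meval p (pt \<nu>) = 0"
  shows "p = (\<Sum>\<xi>\<in>A. mconst (meval p (pt \<xi>) / H \<xi>) * E \<xi>)"
proof (rule interp_unique[of _ d])
  show "in_vars n (\<Sum>\<xi>\<in>A. mconst (meval p (pt \<xi>) / H \<xi>) * E \<xi>)"
    using assms(2) E_props(1) by (intro in_vars_sum in_vars_mult) auto
  show "total_deg_le (\<Sum>\<xi>\<in>A. mconst (meval p (pt \<xi>) / H \<xi>) * E \<xi>) d"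
    using assms(2) E_props(2) by (intro total_deg_le_sum total_deg_le_cmult) fastforce
  fix \<nu> assume \<nu>: "length \<nu> = n" "sum_list \<nu> \<le> d"
  have "meval p (pt \<xi>) / H \<xi> * meval (E \<xi>) (pt \<nu>) = (if \<xi> = \<nu> then meval p (pt \<nu>) else 0)"
    if "\<xi> \<in> A" for \<xi>
    using H_nz[of \<nu>] E_props(4)[of \<xi> \<nu>] assms(2)[OF that] \<nu> by (simp add: H_def)
  hence "meval (\<Sum>\<xi>\<in>A. mconst (meval p (pt \<xi>) / H \<xi>) * E \<xi>) (pt \<nu>)
      = (\<Sum>\<xi>\<in>A. if \<xi> = \<nu> then meval p (pt \<nu>) else 0)"
    unfolding meval_simps by (intro sum.cong) auto
  also have "\<dots> = meval p (pt \<nu>)" using assms(1,5) \<nu> by (auto simp: sum.delta)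
  finally show "meval p (pt \<nu>) = meval (\<Sum>\<xi>\<in>A. mconst (meval p (pt \<xi>) / H \<xi>) * E \<xi>) (pt \<nu>)" by simp
qed (fact assms)+

lemma E_zero: "E (replicate n 0) = 1"
  using isE_zero by (intro E_eqI) auto

lemma E_phi:
  assumes "length \<mu> = n" "0 < n"
  shows "E (phi \<mu>) = mconst (q ^ last \<mu>) * Phi (E \<mu>)"
  using assms isE_phi[OF isE_E] by (intro E_eqI) auto

lemma H_phi:
  assumes "length \<mu> = n" "0 < n"
  shows "H (phi \<mu>) = q ^ last \<mu> * (q * pt \<mu> (n - 1) - 1 / t ^ (n - 1)) * H \<mu>"
  using assms by (simp add: H_def E_phi val_Phi E_props)

lemma E_canonical_step:
  assumes "length \<mu> = n" "Suc i < n" "\<And>j. j < i \<Longrightarrow> \<mu> ! j = 0" "\<mu> ! i > 0" "\<mu> ! Suc i = 0"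
  shows "E (sw i \<mu>) = Tcorr \<mu> i (E \<mu>)"
proof -
  have lead: "lead \<mu> = i" using assms by (intro lead_eqI) auto
  obtain p where p: "isE \<mu> p"
    "lead \<mu> < n \<longrightarrow> (\<forall>m\<in>mkeys p. mdeg m = sum_list \<mu> \<longrightarrow> (\<exists>j\<le>lead \<mu>. expo m j \<noteq> 0))"
    using E_ex[OF assms(1)] by blast
  hence "\<exists>j\<le>i. expo m j \<noteq> 0" if "m \<in> mkeys (E \<mu>)" "mdeg m = sum_list \<mu>" for m
    using that lead assms E_eqI[OF assms(1) p(1)] by simp
  hence "isE (sw i \<mu>) (Tcorr \<mu> i (E \<mu>))"
    using isE_step(1)[OF isE_E[OF assms(1)] assms] by blast
  thus ?thesis using assms by (intro E_eqI) auto
qed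

section \<open>The value H under a swap of parts\<close>

definition H_step_at :: "nat list \<Rightarrow> nat \<Rightarrow> bool" where
  "H_step_at \<mu> i \<longleftrightarrow> H (sw i \<mu>) = rho (pt \<mu> i) (pt \<mu> (Suc i)) * H \<mu>"

text \<open>Here E* of the swapped composition is T_i plus a constant applied to E* of the old one.
  The latter vanishes at the new node, so only the coefficient \<open>rho\<close> of T_i
  remains.\<close>

lemma H_step_canonical:
  assumes "length \<mu> = n" "Suc i < n" "\<And>j. j < i \<Longrightarrow> \<mu> ! j = 0" "\<mu> ! i > 0" "\<mu> ! Suc i = 0"
  shows "H_step_at \<mu> i"
proof -
  have "sw i \<mu> \<noteq> \<mu>" using assms by (intro sw_neq) auto
  hence z: "meval (E \<mu>) (pt (sw i \<mu>)) = 0" using assms by (intro E_props(4)) auto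
  have desc: "\<mu> ! i > \<mu> ! Suc i" using assms by simp
  have "E (sw i \<mu>) = Tcorr \<mu> i (E \<mu>)"
    using assms by (intro E_canonical_step) auto
  thus ?thesis unfolding H_step_at_def H_def
    using z val_step[OF E_props(1)[OF assms(1)] assms(1,2) desc z] by simp
qed

lemma H_step_phi:
  assumes "length \<nu> = n" "Suc (Suc k) < n" "\<nu> ! k > \<nu> ! Suc k" "H_step_at \<nu> k"
  shows "H_step_at (phi \<nu>) (Suc k)"
proof -
  have ne: "\<nu> \<noteq> []" using assms by auto
  have "last (sw k \<nu>) = last \<nu>"
    using assms ne by (subst (1 2) last_conv_nth) (auto simp: nth_sw transpose_def simp flip: length_greater_0_conv)
  moreover have "pt (sw k \<nu>) (n - 1) = pt \<nu> (n - 1)"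
    using assms by (subst pt_sw) (auto simp: transpose_def)
  ultimately show ?thesis
    using assms by (simp add: H_step_at_def pt_phi_Suc H_phi flip: phi_sw)
qed

lemma H_phi_phi:
  assumes "length \<xi> = n" "n = Suc (Suc j)"
  shows "H (phi (phi \<xi>)) = q ^ (\<xi> ! j) * q ^ (\<xi> ! Suc j) * (q * pt \<xi> j - 1 / t ^ (n - 1))
    * (q * pt \<xi> (Suc j) - 1 / t ^ (n - 1)) * H \<xi>"
proof -
  have ne: "\<xi> \<noteq> []" "phi \<xi> \<noteq> []" using assms by (auto simp: phi_def)
  have "last \<xi> = \<xi> ! Suc j" using ne assms by (simp add: last_conv_nth)
  moreover have "last (phi \<xi>) = \<xi> ! j" using ne assms by (simp add: last_conv_nth nth_phi_Suc)
  moreover have "pt (phi \<xi>) (Suc j) = pt \<xi> j" using assms by (simp add: pt_phi_Suc)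
  moreover have n: "n - 1 = Suc j" "0 < n" using assms(2) by simp_all
  moreover have len: "length (phi \<xi>) = n" using assms(1) ne by simp
  ultimately show ?thesis
    using H_phi[OF assms(1) n(2)] H_phi[OF len n(2)] by (simp only: mult_ac)
qed

text \<open>The two rotations multiply H by a product symmetric in the two parts involved, and
  \<open>rho\<close> is homogeneous of degree 0, hence blind to the common factor q of the new
  coordinates.\<close>

lemma H_step_phi_phi:
  assumes "length \<xi> = n" "n = Suc (Suc j)" "\<xi> ! j > \<xi> ! Suc j" "H_step_at \<xi> j"
  shows "H_step_at (phi (phi \<xi>)) 0"
proof -
  have ne: "\<xi> \<noteq> []" "phi \<xi> \<noteq> []" using assms by (auto simp: phi_def)
  have "pt (phi (phi \<xi>)) 0 = q * pt \<xi> j" "pt (phi (phi \<xi>)) 1 = q * pt \<xi> (Suc j)"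
    using assms ne by (simp_all add: pt_phi_0 pt_phi_Suc)
  moreover have "rho (q * x) (q * y) = rho x y" for x y
    unfolding rho_def using q_nz by (simp add: mult.left_commute[of t] flip: right_diff_distrib)
  moreover have "pt (sw j \<xi>) j = pt \<xi> (Suc j)" "pt (sw j \<xi>) (Suc j) = pt \<xi> j"
    "sw j \<xi> ! j = \<xi> ! Suc j" "sw j \<xi> ! Suc j = \<xi> ! j"
    using assms by (auto simp: pt_sw nth_sw)
  moreover have "sw 0 (phi (phi \<xi>)) = phi (phi (sw j \<xi>))" using assms by (simp add: phi_phi_sw)
  ultimately show ?thesis
    using H_phi_phi[OF assms(1,2)] H_phi_phi[OF _ assms(2), of "sw j \<xi>"] assms(1,4) by (simp add: H_step_at_def)
qed

text \<open>Two disjoint swaps span a square of compositions; the rule on three sides gives it on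
  the fourth.\<close>

lemma H_step_commute:
  assumes "length \<nu> = n" "Suc j < i" "Suc i < n" "\<nu> ! i > \<nu> ! Suc i" "\<nu> ! j > \<nu> ! Suc j"
    and "H_step_at \<nu> i" "H_step_at \<nu> j" "H_step_at (sw i \<nu>) j"
  shows "H_step_at (sw j \<nu>) i"
proof -
  have "pt (sw i \<nu>) j = pt \<nu> j" "pt (sw i \<nu>) (Suc j) = pt \<nu> (Suc j)"
    "pt (sw j \<nu>) i = pt \<nu> i" "pt (sw j \<nu>) (Suc i) = pt \<nu> (Suc i)"
    using assms(1-5) by (auto simp: pt_sw transpose_def)
  moreover have "sw i (sw j \<nu>) = sw j (sw i \<nu>)" using assms(1-3) by (simp add: sw_commute)
  ultimately show ?thesis using assms(6-8) by (simp add: H_step_at_def)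
qed

text \<open>Three decreasing parts span a hexagon; the rule on five sides gives it on the sixth,
  because both ways around collect the same three factors.\<close>

lemma H_step_braid:
  assumes "length \<alpha> = n" "Suc (Suc j) < n" "\<alpha> ! j > \<alpha> ! Suc j" "\<alpha> ! Suc j > \<alpha> ! Suc (Suc j)"
    and "H_step_at \<alpha> (Suc j)" "H_step_at (sw (Suc j) \<alpha>) j"
    and "H_step_at \<alpha> j" "H_step_at (sw j \<alpha>) (Suc j)" "H_step_at (sw (Suc j) (sw j \<alpha>)) j"
  shows "H_step_at (sw j (sw (Suc j) \<alpha>)) (Suc j)"
proof -
  have "sw (Suc j) (sw j (sw (Suc j) \<alpha>)) = sw j (sw (Suc j) (sw j \<alpha>))" using assms(1,2) by (simp add: sw_braid)
  thus ?thesis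
    using assms(5-9) assms(1-4) by (simp add: H_step_at_def pt_sw nth_sw transpose_def)
qed

text \<open>The direct computation covers only descents to 0 at the first nonzero part. Other
  descents are undone by rotation if the first part is positive, and related to compositions with
  fewer leading zeros by a square or a hexagon otherwise.\<close>

lemma H_step_holds: "length \<mu> = n \<Longrightarrow> \<forall>i. Suc i < n \<longrightarrow> \<mu> ! i > \<mu> ! Suc i \<longrightarrow> H_step_at \<mu> i"
proof (induction \<mu> rule: comp_less_induct)
  case (less \<mu>)
  note IH = less(2)[rule_format]
  show ?case
  proof (intro allI impI)
    fix i assume i: "Suc i < n" and desc: "\<mu> ! i > \<mu> ! Suc i"
    from less(1) show "H_step_at \<mu> i"
    proof (cases \<mu> rule: comp_cases)
      case zero
      thus ?thesis using i desc by simp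
    next
      case (phi \<nu>)
      have ne: "\<nu> \<noteq> []" using phi by auto
      show ?thesis
      proof (cases i)
        case (Suc k)
        have "\<nu> ! k > \<nu> ! Suc k" using desc i Suc phi by (simp add: nth_phi_Suc)
        thus ?thesis using H_step_phi[of \<nu> k] IH[of \<nu> k] i Suc phi by simp
      next
        case 0
        show ?thesis
        proof (cases "\<mu> ! 1 = 0")
          case True
          thus ?thesis using 0 i desc less(1) by (intro H_step_canonical) auto
        next
          case False
          \<comment> \<open>Both leading parts are positive, so the composition arises by two
            rotations and the descent was between the last two parts.\<close>
          obtain j where n: "n = Suc (Suc j)" using i 0 by (cases n; cases "n - 1") auto
          have "\<nu> ! 0 > 0" using False phi n by (simp add: nth_phi_Suc)
          then obtain \<xi> where \<xi>: "\<xi> \<noteq> []" "length \<xi> = length \<nu>" "\<nu> = phi \<xi>" using phi_surj ne by blast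
          have len: "length \<xi> = n" using \<xi> phi by simp
          have "\<mu> ! 0 = Suc (\<xi> ! j)" "\<mu> ! 1 = Suc (\<xi> ! Suc j)"
            unfolding phi(3) \<xi>(3) using len n \<xi>(1) ne \<xi>(3)
            by (simp_all add: nth_phi_0 nth_phi_Suc last_conv_nth)
          hence "\<xi> ! j > \<xi> ! Suc j" using desc 0 by simp
          moreover have "sum_list \<xi> < sum_list \<mu>" using phi(3) ne \<xi> by (simp add: sum_list_phi)
          ultimately show ?thesis
            using H_step_phi_phi[OF len n] IH[of \<xi> j] len n phi(3) \<xi>(3) 0 by simp
        qed
      qed
    next
      case (sw \<nu> j)
      have \<mu>0: "\<mu> ! k = 0" if "k < Suc j" for k
        using that nth_before_lead sw(9) by simp
      have desc\<nu>: "\<nu> ! j > \<nu> ! Suc j" using sw(5,6) by simp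
      have step\<nu>: "H_step_at \<nu> j" by (rule H_step_canonical[OF sw(2,1,4,5,6)])
      have \<mu>nth: "\<mu> ! k = \<nu> ! adj j k" if "k < n" for k
        unfolding sw(3) using that sw(2) by (simp add: nth_sw)
      have "i \<ge> Suc j" using \<mu>0[of i] desc by (cases "i < Suc j") auto
      then consider "Suc j < i" | "i = Suc j" "\<mu> ! Suc i = 0" | "i = Suc j" "\<mu> ! Suc i > 0" by force
      thus ?thesis
      proof cases
        case 1
        hence "\<nu> ! i > \<nu> ! Suc i" using desc \<mu>nth[of i] \<mu>nth[of "Suc i"] i by (simp add: transpose_def)
        moreover have "H_step_at (sw i \<nu>) j"
          using sw(1,2,4,5,6) 1 i by (intro H_step_canonical) (auto simp: nth_sw transpose_def)
        ultimately show ?thesis unfolding sw(3)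
          using H_step_commute[OF sw(2) 1 i _ desc\<nu>] IH[OF sw(2) _ i] step\<nu> sw(7,8,9) by simp
      next
        case 2
        thus ?thesis using i desc less(1) \<mu>0 by (intro H_step_canonical) auto
      next
        case 3
        \<comment> \<open>Around position j the composition reads (0, a, b) with a > b > 0, and
          \<open>\<alpha>\<close> reads (a, b, 0). Both ways around the hexagon lead from
          \<open>\<alpha>\<close> to (0, b, a); the missing side is the last one, from (0, a,
          b).\<close>
        define \<alpha> where "\<alpha> = sw (Suc j) \<nu>"
        have j: "Suc (Suc j) < n" using i 3 by simp
        have len: "length \<alpha> = n" using sw(2) by (simp add: \<alpha>_def)
        have \<nu>\<alpha>: "\<nu> = sw (Suc j) \<alpha>" using sw(2) j by (simp add: \<alpha>_def)
        have \<alpha>: "\<alpha> ! j > \<alpha> ! Suc j" "\<alpha> ! Suc j > 0" "\<alpha> ! Suc (Suc j) = 0" "\<And>k. k < j \<Longrightarrow> \<alpha> ! k = 0"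
          using sw(2,4,6) j 3 desc \<mu>nth[of "Suc j"] \<mu>nth[of "Suc (Suc j)"]
          by (auto simp: \<alpha>_def nth_sw transpose_def)
        have \<beta>: "sw j \<alpha> ! j > 0" "sw j \<alpha> ! Suc j > sw j \<alpha> ! Suc (Suc j)" "\<And>k. k < j \<Longrightarrow> sw j \<alpha> ! k = 0"
          using len j \<alpha> by (auto simp: nth_sw transpose_def)
        have "lead \<alpha> = j" "lead (sw j \<alpha>) = j"
          using len j \<alpha> \<beta> by (auto intro!: lead_eqI)
        moreover have "sum_list \<alpha> = sum_list \<mu>" "sum_list (sw j \<alpha>) = sum_list \<mu>"
          using sw(2,7) j by (simp_all add: \<alpha>_def)
        ultimately have "H_step_at \<alpha> (Suc j)" "H_step_at \<alpha> j" "H_step_at (sw j \<alpha>) (Suc j)"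
          using IH[of \<alpha>] IH[of "sw j \<alpha>"] len j \<alpha> \<beta> sw(9) by auto
        moreover have "H_step_at (sw (Suc j) (sw j \<alpha>)) j"
          using len j \<alpha> by (intro H_step_canonical) (auto simp: nth_sw transpose_def)
        ultimately show ?thesis
          using H_step_braid[OF len j \<alpha>(1)] \<alpha> step\<nu> unfolding sw(3) \<nu>\<alpha> 3(1) by simp
      qed
    qed
  qed
qed

lemma H_step:
  assumes "length \<mu> = n" "Suc i < n" "\<mu> ! i > \<mu> ! Suc i"
  shows "H (sw i \<mu>) = rho (pt \<mu> i) (pt \<mu> (Suc i)) * H \<mu>"
  using H_step_holds[OF assms(1)] assms by (simp add: H_step_at_def)

end

section \<open>Words and permutations\<close>

lemma perm_word_Cons: "perm_word (i # w) = adj i \<circ> perm_word w"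
  by (simp add: perm_word_def)

lemma perm_word_Nil: "perm_word [] = id"
  by (simp add: perm_word_def)

lemma perm_word_permutes: "valid_word n w \<Longrightarrow> perm_word w permutes {..<n}"
proof (induction w)
  case (Cons i w)
  thus ?case unfolding perm_word_Cons
    by (intro permutes_compose adj_permutes) (auto simp: valid_word_def)
qed (simp add: perm_word_Nil permutes_id)

lemma length_foldr_sw [simp]: "length (foldr sw w \<mu>) = length \<mu>"
  by (induction w) auto

lemma comp_act_perm_word:
  assumes "valid_word n w" "length lam = n"
  shows "comp_act n (perm_word w) lam = foldr sw w lam"
  using assms(1)
proof (induction w)
  case Nil
  thus ?case using assms(2) by (auto simp: comp_act_def perm_word_Nil intro!: nth_equalityI)
next
  case (Cons i w)
  have i: "Suc i < n" and w: "valid_word n w" using Cons.prems by (auto simp: valid_word_def)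
  have "inv (perm_word (i # w)) = inv (perm_word w) \<circ> adj i"
    unfolding perm_word_Cons using permutes_bij[OF perm_word_permutes[OF w]]
    by (simp add: o_inv_distrib)
  hence "comp_act n (perm_word (i # w)) lam ! j = sw i (comp_act n (perm_word w) lam) ! j" if "j < n" for j
    using that i by (simp add: comp_act_def nth_sw adj_less)
  hence "comp_act n (perm_word (i # w)) lam = sw i (comp_act n (perm_word w) lam)"
    by (intro nth_equalityI) (auto simp: comp_act_def)
  thus ?case using Cons w by simp
qed

lemma linv_foldr_sw_le:
  assumes "valid_word n w" "length lam = n"
  shows "linv (foldr sw w lam) \<le> length w + linv lam"
  using assms(1)
proof (induction w)
  case (Cons i w)
  thus ?case
    using assms(2) linv_sw_le[of i "foldr sw w lam"] by (auto simp: valid_word_def)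
qed simp

lemma word_ex:
  assumes "is_partition n lam" "\<mu> \<in> rearr n lam"
  shows "\<exists>w. valid_word n w \<and> foldr sw w lam = \<mu> \<and> length w = linv \<mu>"
  using assms
proof (induction \<mu> rule: rearr_induct)
  case base
  thus ?case using assms(1)
    by (intro exI[of _ "[]"]) (auto simp: valid_word_def is_partition_def linv_sorted_desc)
next
  case (step \<xi> i)
  then obtain w where "valid_word n w" "foldr sw w lam = \<xi>" "length w = linv \<xi>" by blast
  thus ?case using step by (intro exI[of _ "i # w"]) (auto simp: valid_word_def)
qed

text \<open>A permutation is determined by its effect on a list of distinct entries, here the
  decreasing staircase, and every rearrangement of that list is reached by adjacent swaps.\<close>

lemma perm_word_ex:
  assumes \<sigma>: "\<sigma> permutes {..<n}"
  shows "\<exists>w. valid_word n w \<and> perm_word w = \<sigma>"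
proof -
  define \<delta> where "\<delta> = rev [0..<n]"
  have \<delta>: "is_partition n \<delta>" "length \<delta> = n" "distinct \<delta>"
    by (auto simp: \<delta>_def is_partition_def sorted_wrt_rev)
  have inv: "inv \<sigma> permutes {..<n}" by (rule permutes_inv[OF \<sigma>])
  have "comp_act n \<sigma> \<delta> = permute_list (inv \<sigma>) \<delta>"
    using \<delta>(2) by (simp add: comp_act_def permute_list_def)
  hence "comp_act n \<sigma> \<delta> \<in> rearr n \<delta>"
    using \<delta>(2) inv by (simp add: rearr_def)
  then obtain w where w: "valid_word n w" "foldr sw w \<delta> = comp_act n \<sigma> \<delta>"
    using word_ex[OF \<delta>(1)] by blast
  have p: "perm_word w permutes {..<n}" by (rule perm_word_permutes[OF w(1)])
  have p': "inv (perm_word w) permutes {..<n}" by (rule permutes_inv[OF p])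
  have "inv (perm_word w) j = inv \<sigma> j" for j
  proof (cases "j < n")
    case True
    have "comp_act n (perm_word w) \<delta> ! j = comp_act n \<sigma> \<delta> ! j"
      using w comp_act_perm_word[OF w(1) \<delta>(2)] by simp
    hence "\<delta> ! inv (perm_word w) j = \<delta> ! inv \<sigma> j" using True by (simp add: comp_act_def)
    thus ?thesis
      using True \<delta> permutes_in_image[OF inv, of j] permutes_in_image[OF p', of j]
      by (simp add: nth_eq_iff_index_eq)
  next
    case False
    thus ?thesis using permutes_not_in[OF inv] permutes_not_in[OF p'] by simp
  qed
  hence "inv (perm_word w) = inv \<sigma>" by (rule ext)
  hence "perm_word w = \<sigma>" using permutes_inv_inv[OF p] permutes_inv_inv[OF \<sigma>] by metis
  thus ?thesis using w by blast
qed

text \<open>The two choices in the definition of f* need not be resolved: it matters only that the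
  chosen word has length \<open>linv \<mu>\<close>. It is at most that by minimality, and at least
  that because a letter raises \<open>linv\<close> by at most one.\<close>

lemma sigma_mu_word:
  assumes lam: "is_partition n lam" and \<mu>: "\<mu> \<in> rearr n lam"
    and w_def: "w = (SOME w. reduced_word n (sigma_mu n lam \<mu>) w)"
  shows "valid_word n w \<and> foldr sw w lam = \<mu> \<and> length w = linv \<mu>"
proof -
  have len: "length lam = n" using lam by (simp add: is_partition_def)
  obtain w0 where w0: "valid_word n w0" "foldr sw w0 lam = \<mu>" "length w0 = linv \<mu>"
    using word_ex[OF lam \<mu>] by blast
  let ?P = "\<lambda>\<sigma>. \<sigma> permutes {..<n} \<and> comp_act n \<sigma> lam = \<mu>"
  have P0: "?P (perm_word w0)"
    using w0 perm_word_permutes comp_act_perm_word[OF w0(1) len] by blast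
  define \<sigma> where "\<sigma> = sigma_mu n lam \<mu>"
  let ?Q = "\<lambda>\<sigma>. \<sigma> permutes {..<n} \<and> comp_act n \<sigma> lam = \<mu> \<and>
      (\<forall>\<tau>. \<tau> permutes {..<n} \<and> comp_act n \<tau> lam = \<mu> \<longrightarrow> perm_len n \<sigma> \<le> perm_len n \<tau>)"
  obtain \<sigma>1 where "?P \<sigma>1" "\<forall>\<tau>. ?P \<tau> \<longrightarrow> perm_len n \<sigma>1 \<le> perm_len n \<tau>"
    using ex_has_least_nat[of ?P "perm_word w0" "perm_len n", OF P0] by auto
  hence "?Q \<sigma>1" by blast
  hence \<sigma>: "?Q \<sigma>" unfolding \<sigma>_def sigma_mu_def by (rule someI[of ?Q])
  have "perm_len n (perm_word w0) \<le> length w0"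
    unfolding perm_len_def by (rule Least_le) (use w0 in blast)
  hence short: "perm_len n \<sigma> \<le> linv \<mu>" using \<sigma> P0 w0(3) le_trans by metis
  obtain w1 where "valid_word n w1" "perm_word w1 = \<sigma>" using perm_word_ex \<sigma> by blast
  hence "\<exists>k w. valid_word n w \<and> perm_word w = \<sigma> \<and> length w = k" by blast
  from LeastI_ex[OF this] have "\<exists>w. reduced_word n \<sigma> w"
    unfolding reduced_word_def perm_len_def by blast
  hence "reduced_word n \<sigma> w" unfolding w_def \<sigma>_def[symmetric] by (rule someI_ex)
  hence w: "valid_word n w" "perm_word w = \<sigma>" "length w = perm_len n \<sigma>"
    by (auto simp: reduced_word_def)
  have w_act: "foldr sw w lam = \<mu>" using comp_act_perm_word[OF w(1) len] w(2) \<sigma> by simp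
  hence "linv \<mu> \<le> length w"
    using linv_foldr_sw_le[OF w(1) len] lam by (simp add: is_partition_def linv_sorted_desc)
  thus ?thesis using w w_act short by simp
qed

section \<open>Hecke relations\<close>

text \<open>The Hecke relations are checked at points with distinct coordinates, where T_i is given
  by a quotient. Nodes are such points, so unisolvence turns the pointwise relations into polynomial
  ones.\<close>

lemma meval_Ti_commute:
  assumes "Suc i < j" "z i \<noteq> z (Suc i)" "z j \<noteq> z (Suc j)"
  shows "meval (Ti t i (Ti t j p)) z = meval (Ti t j (Ti t i p)) z"
proof -
  let ?s = "adj i" and ?r = "adj j"
  have v: "(z \<circ> ?s) j = z j" "(z \<circ> ?s) (Suc j) = z (Suc j)" "(z \<circ> ?r) i = z i" "(z \<circ> ?r) (Suc i) = z (Suc i)"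
    using assms(1) by (auto simp: transpose_def)
  have c: "z \<circ> ?s \<circ> ?r = z \<circ> ?r \<circ> ?s"
    using assms(1) by (auto simp: fun_eq_iff transpose_def)
  have d: "z i - z (Suc i) \<noteq> 0" "z j - z (Suc j) \<noteq> 0" using assms by auto
  show ?thesis
    unfolding meval_Ti[of z, OF assms(2)] meval_Ti[of z, OF assms(3)]
      meval_Ti[of "z \<circ> ?s" j, unfolded v, OF assms(3)] meval_Ti[of "z \<circ> ?r" i, unfolded v, OF assms(2)] c
    using d by (simp add: divide_simps) (simp add: algebra_simps)
qed

lemma meval_Ti_quadratic:
  assumes "z i \<noteq> z (Suc i)"
  shows "meval (Ti t i (Ti t i p)) z = meval (mconst (t - 1) * Ti t i p + mconst t * p) z"
proof -
  let ?s = "adj i"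
  have v: "(z \<circ> ?s) i = z (Suc i)" "(z \<circ> ?s) (Suc i) = z i" "z \<circ> ?s \<circ> ?s = z"
    by (auto simp: comp_assoc)
  have d: "z i - z (Suc i) \<noteq> 0" "z (Suc i) - z i \<noteq> 0" using assms by auto
  show ?thesis
    unfolding meval_simps meval_Ti[of z, OF assms] meval_Ti[of "z \<circ> ?s" i, unfolded v, OF assms[symmetric]]
    using d by (simp add: divide_simps) (simp add: algebra_simps)
qed

lemma meval_Ti_braid:
  assumes "z i \<noteq> z (Suc i)" "z i \<noteq> z (Suc (Suc i))" "z (Suc i) \<noteq> z (Suc (Suc i))"
  shows "meval (Ti t i (Ti t (Suc i) (Ti t i p))) z = meval (Ti t (Suc i) (Ti t i (Ti t (Suc i) p))) z"
proof -
  let ?s = "adj i" and ?r = "adj (Suc i)"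
  define x y w where "x = z i" and "y = z (Suc i)" and "w = z (Suc (Suc i))"
  have ne: "x \<noteq> y" "x \<noteq> w" "y \<noteq> w" "y \<noteq> x" "w \<noteq> x" "w \<noteq> y"
    using assms by (auto simp: x_def y_def w_def)
  \<comment> \<open>T_j has at a point the value A times the old value plus B times the value at the
    exchanged point, so both sides become combinations of six values of \<open>p\<close>.\<close>
  define A where "A = (\<lambda>a b. (1 - t) * b / (a - b))"
  define B where "B = (\<lambda>a b. (t * a - b) / (a - b))"
  have T: "meval (Ti t j f) u = A (u j) (u (Suc j)) * meval f u + B (u j) (u (Suc j)) * meval f (u \<circ> adj j)"
    if "u j \<noteq> u (Suc j)" for j f u
    unfolding meval_Ti[OF that] A_def B_def by (simp add: add_divide_distrib)
  have ss: "u \<circ> ?s \<circ> ?s = u" "u \<circ> ?r \<circ> ?r = u" for u :: "nat \<Rightarrow> 'a" by (auto simp: comp_assoc)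
  have srs: "z \<circ> ?r \<circ> ?s \<circ> ?r = z \<circ> ?s \<circ> ?r \<circ> ?s"
    by (auto simp: fun_eq_iff transpose_def)
  have vals:
    "z i = x" "z (Suc i) = y" "z (Suc (Suc i)) = w"
    "(z \<circ> ?s) i = y" "(z \<circ> ?s) (Suc i) = x" "(z \<circ> ?s) (Suc (Suc i)) = w"
    "(z \<circ> ?r) i = x" "(z \<circ> ?r) (Suc i) = w" "(z \<circ> ?r) (Suc (Suc i)) = y"
    "(z \<circ> ?s \<circ> ?r) i = y" "(z \<circ> ?s \<circ> ?r) (Suc i) = w" "(z \<circ> ?s \<circ> ?r) (Suc (Suc i)) = x"
    "(z \<circ> ?r \<circ> ?s) i = w" "(z \<circ> ?r \<circ> ?s) (Suc i) = x" "(z \<circ> ?r \<circ> ?s) (Suc (Suc i)) = y"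
    by (auto simp: x_def y_def w_def transpose_def)
  define f1 f2 f3 f4 f5 f6 where f_defs: "f1 = meval p z" "f2 = meval p (z \<circ> ?s)" "f3 = meval p (z \<circ> ?r)"
    "f4 = meval p (z \<circ> ?s \<circ> ?r)" "f5 = meval p (z \<circ> ?r \<circ> ?s)" "f6 = meval p (z \<circ> ?s \<circ> ?r \<circ> ?s)"
  have nz: "x - y \<noteq> 0" "x - w \<noteq> 0" "y - w \<noteq> 0" using ne by auto
  have neg: "A y x = - ((1 - t) * x / (x - y))" "B y x = - ((t * y - x) / (x - y))"
    "A w y = - ((1 - t) * y / (y - w))" "B w y = - ((t * w - y) / (y - w))"
    unfolding A_def B_def by (metis minus_diff_eq minus_divide_right)+
  \<comment> \<open>The coefficients of \<open>f4\<close>, \<open>f5\<close> and \<open>f6\<close>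
    agree on both sides as they stand; those of \<open>f1\<close>, \<open>f2\<close> and
    \<open>f3\<close> need one rational identity each.\<close>
  have c1: "A x y * A y w * A x y + B x y * A x w * B y x = A y w * A x y * A y w + B y w * A x w * B w y"
    unfolding neg unfolding A_def B_def using nz by (simp add: divide_simps) (simp add: algebra_simps)
  have c2: "A x y * A y w + A x w * A y x = A y w * A x w"
    unfolding neg unfolding A_def using nz by (simp add: divide_simps) (simp add: algebra_simps)
  have c3: "A x y * A x w = A y w * A x y + A x w * A w y"
    unfolding neg unfolding A_def using nz by (simp add: divide_simps) (simp add: algebra_simps)
  have "meval (Ti t i (Ti t (Suc i) (Ti t i p))) z =
      (A x y * A y w * A x y + B x y * A x w * B y x) * f1 + B x y * (A x y * A y w + A x w * A y x) * f2
      + B y w * (A x y * A x w) * f3 + A x y * B y w * B x w * f5 + B x y * B x w * A y w * f4 + B x y * B x w * B y w * f6"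
    by (simp only: T vals ss ne f_defs not_False_eq_True) (simp add: algebra_simps)
  also have "\<dots> = meval (Ti t (Suc i) (Ti t i (Ti t (Suc i) p))) z"
    unfolding c1 c2 c3 by (simp only: T vals ss srs ne f_defs not_False_eq_True) (simp add: algebra_simps)
  finally show ?thesis .
qed

context generic_params
begin

lemma Ti_commute:
  assumes "Suc i < j" "Suc j < n" "in_vars n p" "total_deg_le p d"
  shows "Ti t i (Ti t j p) = Ti t j (Ti t i p)"
  using assms
  by (intro interp_unique[of _ d]) (auto intro!: in_vars_Ti total_deg_le_Ti meval_Ti_commute simp: pt_distinct)

lemma Ti_braid:
  assumes "Suc (Suc i) < n" "in_vars n p" "total_deg_le p d"
  shows "Ti t i (Ti t (Suc i) (Ti t i p)) = Ti t (Suc i) (Ti t i (Ti t (Suc i) p))"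
  using assms
  by (intro interp_unique[of _ d]) (auto intro!: in_vars_Ti total_deg_le_Ti meval_Ti_braid simp: pt_distinct)

lemma Ti_quadratic:
  assumes "Suc i < n" "in_vars n p" "total_deg_le p d"
  shows "Ti t i (Ti t i p) = mconst (t - 1) * Ti t i p + mconst t * p"
  using assms meval_Ti_quadratic[of "pt _" i t p] pt_distinct[of i _ "Suc i"]
  by (intro interp_unique[of _ d]) (auto intro!: in_vars_Ti total_deg_le_Ti)

end

section \<open>Rearrangements supported in the first k positions\<close>

definition Bset :: "nat \<Rightarrow> nat list \<Rightarrow> nat \<Rightarrow> nat list set" where
  "Bset n lam k = {\<mu> \<in> rearr n lam. \<forall>j. k \<le> j \<and> j < n \<longrightarrow> \<mu> ! j = 0}"

text \<open>For a partition with no positive part after position k this is the composition M of the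
  overview; it has the largest \<open>linv\<close> in \<open>Bset n lam k\<close>.\<close>

definition rev_upto :: "nat \<Rightarrow> nat list \<Rightarrow> nat list" where
  "rev_upto k lam = rev (take k lam) @ drop k lam"

lemma finite_Bset: "finite (Bset n lam k)"
  unfolding Bset_def by (rule finite_subset[OF _ finite_rearr[of n lam]]) auto

lemma Bset_length: "\<mu> \<in> Bset n lam k \<Longrightarrow> length \<mu> = n"
  by (simp add: Bset_def rearr_def)

lemma Bset_rearr: "\<mu> \<in> Bset n lam k \<Longrightarrow> \<mu> \<in> rearr n lam"
  by (simp add: Bset_def)

lemma rearr_sum_list: "\<mu> \<in> rearr n lam \<Longrightarrow> sum_list \<mu> = sum_list lam"
proof -
  assume "\<mu> \<in> rearr n lam"
  hence "mset \<mu> = mset lam" by (simp add: rearr_def)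
  thus ?thesis using sum_mset_sum_list[of \<mu>] sum_mset_sum_list[of lam] by simp
qed

lemma sw_Bset:
  assumes "\<mu> \<in> Bset n lam k" "Suc i < k" "k \<le> n" shows "sw i \<mu> \<in> Bset n lam k"
  using assms unfolding Bset_def rearr_def by (auto simp: nth_sw transpose_def)

lemma sw_Bset_iff:
  assumes "length \<mu> = n" "Suc i < k" "k \<le> n"
  shows "sw i \<mu> \<in> Bset n lam k \<longleftrightarrow> \<mu> \<in> Bset n lam k"
  using sw_Bset[of \<mu> n lam k i] sw_Bset[of "sw i \<mu>" n lam k i] assms by auto

lemma asc_unique:
  assumes "\<mu> \<in> Bset n lam k" "\<nu> \<in> Bset n lam k" "k \<le> n"
    and "\<And>i. Suc i < k \<Longrightarrow> \<mu> ! i \<le> \<mu> ! Suc i" "\<And>i. Suc i < k \<Longrightarrow> \<nu> ! i \<le> \<nu> ! Suc i"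
  shows "\<mu> = \<nu>"
proof -
  have *: "drop k \<xi> = replicate (n - k) 0 \<and> length \<xi> = n \<and> mset \<xi> = mset lam" if "\<xi> \<in> Bset n lam k" for \<xi>
    using that assms(3) by (auto simp: Bset_def rearr_def intro!: nth_equalityI)
  have sorted: "sorted (take k \<xi>)" if "length \<xi> = n" "\<And>i. Suc i < k \<Longrightarrow> \<xi> ! i \<le> \<xi> ! Suc i" for \<xi> :: "nat list"
    using that assms(3) by (auto simp: sorted_iff_nth_Suc)
  have "mset (take k \<mu>) + mset (drop k \<mu>) = mset (take k \<nu>) + mset (drop k \<nu>)"
    using *[OF assms(1)] *[OF assms(2)] by (metis append_take_drop_id mset_append)
  hence "mset (take k \<mu>) = mset (take k \<nu>)" using *[OF assms(1)] *[OF assms(2)] by simp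
  hence "take k \<mu> = take k \<nu>"
    using sorted[of \<mu>] sorted[of \<nu>] *[OF assms(1)] *[OF assms(2)] assms(4,5)
    by (metis properties_for_sort)
  thus ?thesis using *[OF assms(1)] *[OF assms(2)] by (metis append_take_drop_id)
qed

lemma rev_upto_Bset:
  assumes "is_partition n lam" "k \<le> n" "\<And>j. k \<le> j \<Longrightarrow> j < n \<Longrightarrow> lam ! j = 0"
  shows "rev_upto k lam \<in> Bset n lam k"
proof -
  have "mset (rev_upto k lam) = mset (take k lam @ drop k lam)"
    unfolding rev_upto_def by (simp only: mset_append mset_rev)
  hence "mset (rev_upto k lam) = mset lam" by simp
  moreover have "rev_upto k lam ! j = 0" if "k \<le> j" "j < n" for j
    using that assms by (auto simp: rev_upto_def is_partition_def nth_append)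
  ultimately show ?thesis
    using assms by (auto simp: Bset_def rearr_def rev_upto_def is_partition_def)
qed

lemma rev_upto_asc:
  assumes "is_partition n lam" "k \<le> n" "i \<le> j" "j < k"
  shows "rev_upto k lam ! i \<le> rev_upto k lam ! j"
proof -
  have len: "length lam = n" and srt: "sorted_wrt (\<ge>) lam" using assms by (auto simp: is_partition_def)
  have "sorted (rev (take k lam))"
    using srt by (simp add: sorted_wrt_rev sorted_wrt_take)
  thus ?thesis
    using assms len by (auto simp: rev_upto_def nth_append sorted_iff_nth_mono)
qed

section \<open>The polynomials f* without reference to words\<close>

context generic_params
begin

text \<open>Relates a composition to every polynomial obtained from E* of the partition along some
  chain of descents. Once shown to be functional it replaces the chosen reduced word, and T_i can be
  applied at any convenient descent.\<close>

inductive Fpath :: "nat list \<Rightarrow> nat list \<Rightarrow> 'a mpoly \<Rightarrow> bool" for lam where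
  base: "Fpath lam lam (E lam)"
| step: "Fpath lam \<mu> p \<Longrightarrow> Suc i < n \<Longrightarrow> \<mu> ! i > \<mu> ! Suc i \<Longrightarrow> Fpath lam (sw i \<mu>) (Ti t i p)"

lemma Fpath_props:
  assumes "Fpath lam \<mu> p" "is_partition n lam"
  shows "\<mu> \<in> rearr n lam \<and> in_vars n p \<and> total_deg_le p (sum_list lam)"
  using assms
proof (induction rule: Fpath.induct)
  case base
  hence len: "length lam = n" by (simp add: is_partition_def)
  show ?case using E_props(1,2)[OF len] len by (simp add: rearr_def)
next
  case (step \<mu> p i)
  thus ?case using sw_rearr in_vars_Ti total_deg_le_Ti by blast
qed

text \<open>Each letter raises \<open>linv\<close> by at most one. If the length equals the final
  \<open>linv\<close>, every letter must raise it, which means that it acts at a descent.\<close>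

lemma Fpath_of_word:
  assumes lam: "is_partition n lam"
  shows "valid_word n w \<Longrightarrow> length w = linv (foldr sw w lam) \<Longrightarrow>
    Fpath lam (foldr sw w lam) (foldr (Ti t) w (E lam))"
proof (induction w)
  case Nil
  show ?case by (simp add: base)
next
  case (Cons i w)
  let ?\<mu> = "foldr sw w lam"
  have len: "length lam = n" using lam by (simp add: is_partition_def)
  have i: "Suc i < n" and w: "valid_word n w" using Cons.prems by (auto simp: valid_word_def)
  have "linv ?\<mu> \<le> length w"
    using linv_foldr_sw_le[OF w len] lam by (simp add: is_partition_def linv_sorted_desc)
  moreover have L: "linv (sw i ?\<mu>) = Suc (length w)" using Cons.prems(2) by simp
  moreover have "linv (sw i ?\<mu>) \<le> Suc (linv ?\<mu>)" using i len by (intro linv_sw_le) simp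
  ultimately have lw: "length w = linv ?\<mu>" by simp
  have "?\<mu> ! i > ?\<mu> ! Suc i"
    using sw_eq_self[of i ?\<mu>] descent_of_sw(2)[of i ?\<mu>, symmetric] L lw i len
    by (cases "?\<mu> ! i" "?\<mu> ! Suc i" rule: linorder_cases) auto
  thus ?case using step[OF Cons.IH[OF w lw] i] by simp
qed

lemma Fpath_fstar:
  assumes "is_partition n lam" "\<mu> \<in> rearr n lam"
  shows "Fpath lam \<mu> (fstar q t n lam \<mu>)"
  using sigma_mu_word[OF assms refl] Fpath_of_word[OF assms(1)]
  unfolding fstar_def Tperm_def by metis

lemma Fpath_lam:
  assumes "is_partition n lam" "Fpath lam lam p"
  shows "p = E lam"
  using assms(2)
proof (cases rule: Fpath.cases)
  case (step \<mu> r i)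
  have len: "length \<mu> = n" using Fpath_props[OF step(3) assms(1)] by (simp add: rearr_def)
  have "linv lam = Suc (linv \<mu>)"
    using step len linv_sw[of i \<mu>] by metis
  thus ?thesis using assms(1) by (simp add: is_partition_def linv_sorted_desc)
qed simp

lemma Fpath_last_step:
  assumes lam: "is_partition n lam" and "Fpath lam \<mu> p" "\<mu> \<noteq> lam"
  obtains i r where "Suc i < n" "\<mu> ! i < \<mu> ! Suc i" "Fpath lam (sw i \<mu>) r" "p = Ti t i r"
  using assms(2)
proof (cases rule: Fpath.cases)
  case base
  thus ?thesis using assms(3) by simp
next
  case (step \<nu> r i)
  have len: "length \<nu> = n" using Fpath_props[OF step(3) lam] by (simp add: rearr_def)
  have "\<mu> ! i < \<mu> ! Suc i" unfolding step(1) using step(4,5) len by (simp add: nth_sw)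
  moreover have "Fpath lam (sw i \<mu>) r" unfolding step(1) using step(3,4) len by simp
  ultimately show ?thesis using that step by blast
qed

lemma Fpath_ex: "is_partition n lam \<Longrightarrow> \<mu> \<in> rearr n lam \<Longrightarrow> \<exists>p. Fpath lam \<mu> p"
  using Fpath_fstar by blast

text \<open>Two last steps of a path can be completed to a common shorter path, by commutation or by a
  braid relation; in the braid case the three parts involved are pairwise distinct.\<close>

lemma Fpath_unique:
  assumes lam: "is_partition n lam"
  shows "Fpath lam \<mu> p \<Longrightarrow> Fpath lam \<mu> p' \<Longrightarrow> p = p'"
proof (induction "linv \<mu>" arbitrary: \<mu> p p' rule: less_induct)
  case less
  have \<mu>: "\<mu> \<in> rearr n lam" using Fpath_props[OF less(2) lam] by simp
  hence len: "length \<mu> = n" by (simp add: rearr_def)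
  have IH: "r = r'" if "Suc i < n" "\<mu> ! i < \<mu> ! Suc i" "Fpath lam (sw i \<mu>) r" "Fpath lam (sw i \<mu>) r'" for i r r'
    using less(1)[of "sw i \<mu>" r r'] descent_of_sw(2)[of i \<mu>] that len by simp
  show ?case
  proof (cases "\<mu> = lam")
    case True
    thus ?thesis using Fpath_lam[OF lam] less by metis
  next
    case False
    have main: "Ti t i r = Ti t j r'"
      if ij: "i \<le> j" and i: "Suc i < n" "\<mu> ! i < \<mu> ! Suc i" "Fpath lam (sw i \<mu>) r"
        and j: "Suc j < n" "\<mu> ! j < \<mu> ! Suc j" "Fpath lam (sw j \<mu>) r'" for i j r r'
    proof -
      consider "i = j" | "j = Suc i" | "Suc i < j" using ij by linarith
      thus ?thesis
      proof cases
        case 1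
        thus ?thesis using IH i j by blast
      next
        case 2
        define \<eta> where "\<eta> = sw i (sw (Suc i) (sw i \<mu>))"
        have \<eta>: "\<eta> \<in> rearr n lam" unfolding \<eta>_def using \<mu> i j 2 by (intro sw_rearr) auto
        obtain s where s: "Fpath lam \<eta> s" using Fpath_ex[OF lam \<eta>] by blast
        have len\<eta>: "length \<eta> = n" using len by (simp add: \<eta>_def)
        have nth: "\<eta> ! i = \<mu> ! Suc (Suc i)" "\<eta> ! Suc i = \<mu> ! Suc i" "\<eta> ! Suc (Suc i) = \<mu> ! i"
          unfolding \<eta>_def using len i j 2 by (simp_all add: nth_sw transpose_def)
        have big: "\<mu> ! i < \<mu> ! Suc i" "\<mu> ! Suc i < \<mu> ! Suc (Suc i)" using i j 2 by auto
        have n2: "Suc (Suc i) < n" using j 2 by simp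
        have e1: "sw (Suc i) (sw i \<eta>) = sw i \<mu>" unfolding \<eta>_def using len n2 by simp
        have e2: "sw i (sw (Suc i) \<eta>) = sw (Suc i) \<mu>"
          unfolding \<eta>_def sw_braid[of i \<mu>, unfolded len, OF n2] using len n2 by simp
        have "Fpath lam (sw (Suc i) (sw i \<eta>)) (Ti t (Suc i) (Ti t i s))"
          using n2 big nth len\<eta> by (intro step s) (auto simp: nth_sw)
        hence r: "r = Ti t (Suc i) (Ti t i s)" unfolding e1 using IH i by blast
        have "Fpath lam (sw i (sw (Suc i) \<eta>)) (Ti t i (Ti t (Suc i) s))"
          using n2 big nth len\<eta> by (intro step s) (auto simp: nth_sw)
        hence r': "r' = Ti t i (Ti t (Suc i) s)" unfolding e2 using IH j 2 by blast
        show ?thesis unfolding r r' 2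
          using Ti_braid[OF n2] Fpath_props[OF s lam] by blast
      next
        case 3
        define \<eta> where "\<eta> = sw i (sw j \<mu>)"
        have \<eta>': "\<eta> = sw j (sw i \<mu>)" unfolding \<eta>_def using 3 j len by (intro sw_commute) auto
        have \<eta>: "\<eta> \<in> rearr n lam" unfolding \<eta>_def using \<mu> i j by (intro sw_rearr) auto
        obtain s where s: "Fpath lam \<eta> s" using Fpath_ex[OF lam \<eta>] by blast
        have "\<eta> ! i > \<eta> ! Suc i" "\<eta> ! j > \<eta> ! Suc j"
          unfolding \<eta>_def using 3 i j len by (auto simp: nth_sw transpose_def)
        hence "Fpath lam (sw j \<eta>) (Ti t j s)" "Fpath lam (sw i \<eta>) (Ti t i s)"
          using i j by (auto intro!: step s)
        moreover have "sw j \<eta> = sw i \<mu>" unfolding \<eta>' using len j by simp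
        moreover have "sw i \<eta> = sw j \<mu>" unfolding \<eta>_def using len i by simp
        ultimately have "r = Ti t j s" "r' = Ti t i s" using IH i j by metis+
        thus ?thesis using Ti_commute[OF 3 j(1)] Fpath_props[OF s lam] by blast
      qed
    qed
    obtain i r where i: "Suc i < n" "\<mu> ! i < \<mu> ! Suc i" "Fpath lam (sw i \<mu>) r" "p = Ti t i r"
      using Fpath_last_step[OF lam less(2) False] .
    obtain j r' where j: "Suc j < n" "\<mu> ! j < \<mu> ! Suc j" "Fpath lam (sw j \<mu>) r'" "p' = Ti t j r'"
      using Fpath_last_step[OF lam less(3) False] .
    show ?thesis
      using main[of i j r r'] main[of j i r' r] i j by (metis nat_le_linear)
  qed
qed

abbreviation F :: "nat list \<Rightarrow> nat list \<Rightarrow> 'a mpoly" where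
  "F lam \<mu> \<equiv> fstar q t n lam \<mu>"

lemma F_eqI: "is_partition n lam \<Longrightarrow> Fpath lam \<mu> p \<Longrightarrow> F lam \<mu> = p"
  using Fpath_unique Fpath_fstar Fpath_props by blast

lemma F_lam: "is_partition n lam \<Longrightarrow> F lam lam = E lam"
  by (intro F_eqI base)

lemma F_props:
  assumes "is_partition n lam" "\<mu> \<in> rearr n lam"
  shows "in_vars n (F lam \<mu>)" "total_deg_le (F lam \<mu>) (sum_list lam)"
  using Fpath_props[OF Fpath_fstar[OF assms] assms(1)] by auto

lemma F_step:
  assumes "is_partition n lam" "\<mu> \<in> rearr n lam" "Suc i < n" "\<mu> ! i > \<mu> ! Suc i"
  shows "F lam (sw i \<mu>) = Ti t i (F lam \<mu>)"
  using assms Fpath_fstar by (intro F_eqI step) auto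

lemma F_ascent:
  assumes "is_partition n lam" "\<mu> \<in> rearr n lam" "Suc i < n" "\<mu> ! i < \<mu> ! Suc i"
  shows "F lam \<mu> = Ti t i (F lam (sw i \<mu>))"
proof -
  have len: "length \<mu> = n" using assms by (simp add: rearr_def)
  have "F lam (sw i (sw i \<mu>)) = Ti t i (F lam (sw i \<mu>))"
    using assms len by (intro F_step sw_rearr) (auto simp: nth_sw)
  thus ?thesis using assms len by simp
qed

text \<open>Compared at nodes: where the parts i and i+1 of \<open>\<nu>\<close> agree, T_i
  multiplies the value by t; where they differ, neither \<open>\<nu>\<close> nor
  \<open>sw i \<nu>\<close> is \<open>\<mu>\<close> and both sides vanish.\<close>

lemma E_equal_parts:
  assumes "length \<mu> = n" "Suc i < n" "\<mu> ! i = \<mu> ! Suc i"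
  shows "Ti t i (E \<mu>) = mconst t * E \<mu>"
proof (rule interp_unique[of _ "sum_list \<mu>"])
  fix \<nu> assume \<nu>: "length \<nu> = n" "sum_list \<nu> \<le> sum_list \<mu>"
  show "meval (Ti t i (E \<mu>)) (pt \<nu>) = meval (mconst t * E \<mu>) (pt \<nu>)"
  proof (cases "\<nu> ! i = \<nu> ! Suc i")
    case True
    thus ?thesis using \<nu> assms by (simp add: val_Ti_eq)
  next
    case False
    have "\<nu> \<noteq> \<mu>" "sw i \<nu> \<noteq> \<mu>" using False assms \<nu> by (auto simp: sw_eq_iff nth_sw)
    thus ?thesis using False \<nu> assms E_props by (simp add: val_Ti_neq)
  qed
qed (use E_props(1,2)[OF assms(1)] assms(2) in \<open>auto intro!: in_vars_Ti total_deg_le_Ti\<close>)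

text \<open>Induction along the last swap j. Far apart, T_i and T_j commute. For neighbours one goes
  back two steps, and \<open>T_i T_j T_i = T_j T_i T_j\<close> moves the pair of equal parts to
  position j of a shorter composition.\<close>

lemma F_equal_parts:
  assumes lam: "is_partition n lam"
  shows "\<mu> \<in> rearr n lam \<Longrightarrow> Suc i < n \<Longrightarrow> \<mu> ! i = \<mu> ! Suc i \<Longrightarrow>
    Ti t i (F lam \<mu>) = mconst t * F lam \<mu>"
proof (induction "linv \<mu>" arbitrary: \<mu> i rule: less_induct)
  case less
  note \<mu> = less(2) and i = less(3) and eq = less(4)
  have len: "length \<mu> = n" using \<mu> by (simp add: rearr_def)
  show ?case
  proof (cases "\<mu> = lam")
    case True
    thus ?thesis using F_lam[OF lam] E_equal_parts[OF len i eq] by simp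
  next
    case False
    obtain j where j: "Suc j < n" "\<mu> ! j < \<mu> ! Suc j" using ascent_ex[OF lam \<mu> False] .
    define \<xi> where "\<xi> = sw j \<mu>"
    have \<xi>: "\<xi> \<in> rearr n lam" "length \<xi> = n" "linv \<mu> = Suc (linv \<xi>)"
      using sw_rearr[OF \<mu> j(1)] descent_of_sw[of j \<mu>] j len by (simp_all add: \<xi>_def)
    have F\<mu>: "F lam \<mu> = Ti t j (F lam \<xi>)" unfolding \<xi>_def by (rule F_ascent[OF lam \<mu> j])
    have "i \<noteq> j" using eq j by auto
    then consider "Suc i < j \<or> Suc j < i" | "j = Suc i \<or> i = Suc j" by linarith
    thus ?thesis
    proof cases
      case 1
      have "\<xi> ! i = \<xi> ! Suc i" using 1 eq len i j by (auto simp: \<xi>_def nth_sw transpose_def)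
      hence "Ti t i (F lam \<xi>) = mconst t * F lam \<xi>" using less(1) \<xi> i by simp
      moreover have "Ti t i (Ti t j (F lam \<xi>)) = Ti t j (Ti t i (F lam \<xi>))"
        using 1 Ti_commute[OF _ j(1) F_props[OF lam \<xi>(1)]] Ti_commute[OF _ i F_props[OF lam \<xi>(1)]] by auto
      ultimately show ?thesis unfolding F\<mu> by (simp add: Ti_cmult)
    next
      case 2
      define \<eta> where "\<eta> = sw i \<xi>"
      have asc: "\<xi> ! i < \<xi> ! Suc i"
        using 2 by (elim disjE; use len i j eq in \<open>simp add: \<xi>_def nth_sw transpose_def\<close>)
      have \<eta>: "\<eta> \<in> rearr n lam" "linv \<xi> = Suc (linv \<eta>)"
        using sw_rearr[OF \<xi>(1) i] descent_of_sw[of i \<xi>] asc \<xi>(2) i by (simp_all add: \<eta>_def)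
      have F\<xi>: "F lam \<xi> = Ti t i (F lam \<eta>)" unfolding \<eta>_def by (rule F_ascent[OF lam \<xi>(1) i asc])
      have "\<eta> ! j = \<eta> ! Suc j"
        using 2 by (elim disjE; use len i j eq in \<open>simp add: \<eta>_def \<xi>_def nth_sw transpose_def\<close>)
      hence "Ti t j (F lam \<eta>) = mconst t * F lam \<eta>" using less(1)[of \<eta> j] \<eta> \<xi> j by simp
      moreover have "Ti t i (Ti t j (Ti t i (F lam \<eta>))) = Ti t j (Ti t i (Ti t j (F lam \<eta>)))"
        using 2 Ti_braid[OF _ F_props[OF lam \<eta>(1)]] i j by (elim disjE; simp)
      ultimately show ?thesis unfolding F\<mu> F\<xi> by (simp add: Ti_cmult)
    qed
  qed
qed

section \<open>Values of f* at the nodes\<close>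

lemma F_val_outside:
  assumes lam: "is_partition n lam" and k: "k \<le> n" and \<mu>: "\<mu> \<in> Bset n lam k"
  shows "length \<nu> = n \<Longrightarrow> sum_list \<nu> \<le> sum_list lam \<Longrightarrow> \<nu> \<notin> Bset n lam k \<Longrightarrow> meval (F lam \<mu>) (pt \<nu>) = 0"
  using lam Bset_rearr[OF \<mu>] \<mu>
proof (induction \<mu> arbitrary: \<nu> rule: rearr_induct)
  case base
  thus ?case using F_lam[OF lam] E_props(4)[of lam \<nu>] Bset_length by auto
next
  case (step \<xi> i)
  \<comment> \<open>The swap leaves a positive part at \<open>Suc i\<close>, so this position lies
    below k and the swap stays among the first k positions.\<close>
  have "sw i \<xi> ! Suc i > 0" using step by (simp add: nth_sw)
  hence ik: "Suc i < k" using step by (auto simp: Bset_def not_less[symmetric])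
  hence \<xi>: "\<xi> \<in> Bset n lam k" using step k by (simp add: sw_Bset_iff)
  have "meval (F lam \<xi>) (pt \<nu>) = 0" "meval (F lam \<xi>) (pt (sw i \<nu>)) = 0"
    using step \<xi> ik k by (auto simp: sw_Bset_iff)
  thus ?case unfolding F_step[OF lam step(1,3,4)]
    using F_props(1)[OF lam step(1)] step by (cases "\<nu> ! i = \<nu> ! Suc i") (simp_all add: val_Ti_eq val_Ti_neq)
qed

text \<open>T_i mixes the values at \<open>\<nu>\<close> and \<open>sw i \<nu>\<close>, whose
  \<open>linv\<close> differ by at most one, so vanishing at high \<open>linv\<close> is inherited
  with the bound raised by one.\<close>

lemma F_val_triangular:
  assumes "is_partition n lam" "\<mu> \<in> rearr n lam"
  shows "\<nu> \<in> rearr n lam \<Longrightarrow> linv \<mu> \<le> linv \<nu> \<Longrightarrow> \<nu> \<noteq> \<mu> \<Longrightarrow> meval (F lam \<mu>) (pt \<nu>) = 0"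
  using assms
proof (induction \<mu> arbitrary: \<nu> rule: rearr_induct)
  case base
  thus ?case using F_lam[OF assms(1)] E_props(4)[of lam \<nu>] rearr_sum_list[OF base(1)] assms(1)
    by (simp add: rearr_def is_partition_def)
next
  case (step \<xi> i)
  have len: "length \<nu> = n" using step by (simp add: rearr_def)
  have "linv \<nu> \<le> Suc (linv (sw i \<nu>))" using linv_sw_le[of i "sw i \<nu>"] len step by simp
  moreover have "sw i \<nu> \<noteq> \<xi>" using step len by (simp add: sw_eq_iff)
  ultimately have "meval (F lam \<xi>) (pt (sw i \<nu>)) = 0" using step sw_rearr by simp
  moreover have "meval (F lam \<xi>) (pt \<nu>) = 0" using step by (cases "\<nu> = \<xi>") auto
  ultimately show ?case unfolding F_step[OF assms(1) step(1,3,4)]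
    using F_props(1)[OF assms(1) step(1)] step len
    by (cases "\<nu> ! i = \<nu> ! Suc i") (simp_all add: val_Ti_eq val_Ti_neq)
qed

text \<open>In general f* differs from E*, but by triangularity its value at its own node acquires
  in each step the same factor \<open>rho\<close> as H.\<close>

lemma F_val_diag:
  assumes "is_partition n lam" "\<mu> \<in> rearr n lam"
  shows "meval (F lam \<mu>) (pt \<mu>) = H \<mu>"
  using assms
proof (induction \<mu> rule: rearr_induct)
  case base
  thus ?case using F_lam[OF assms(1)] by (simp add: H_def)
next
  case (step \<xi> i)
  have "sw i \<xi> \<noteq> \<xi>" using step(5) by auto
  hence z: "meval (F lam \<xi>) (pt (sw i \<xi>)) = 0"
    using F_val_triangular[OF assms(1) step(1) sw_rearr[OF step(1,3)]] step(5) by simp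
  thus ?case unfolding F_step[OF assms(1) step(1,3,4)]
    using val_step[OF F_props(1)[OF assms(1) step(1)] step(2,3,4) z] H_step[OF step(2)] step by simp
qed

section \<open>The sum of f* over a block and its expansion\<close>

definition hsum :: "nat list \<Rightarrow> nat \<Rightarrow> 'a mpoly" where
  "hsum lam k = (\<Sum>\<mu>\<in>Bset n lam k. F lam \<mu>)"

text \<open>The rearrangements pair off under the swap at i. Each pair contributes
  \<open>(T_i + 1) F\<close>, and \<open>(T_i - t)(T_i + 1) = 0\<close> is the quadratic relation;
  fixed rearrangements are eigenvectors already.\<close>

lemma hsum_Ti:
  assumes lam: "is_partition n lam" and k: "k \<le> n" "Suc i < k"
  shows "Ti t i (hsum lam k) = mconst t * hsum lam k"
proof -
  define g where "g \<mu> = Ti t i (F lam \<mu>) - mconst t * F lam \<mu>" for \<mu>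
  let ?B = "Bset n lam k"
  let ?D = "{\<mu> \<in> ?B. \<mu> ! i > \<mu> ! Suc i}" and ?A = "{\<mu> \<in> ?B. \<mu> ! i < \<mu> ! Suc i}"
  have i: "Suc i < n" using k by simp
  \<comment> \<open>The quadratic relation in the form
    \<open>(T_i - t) T_i F = - (T_i - t) F\<close>.\<close>
  have anti: "g (sw i \<mu>) = - g \<mu>" if "\<mu> \<in> ?D" for \<mu>
  proof -
    have \<mu>: "\<mu> \<in> rearr n lam" "\<mu> ! i > \<mu> ! Suc i" using that Bset_rearr by auto
    show ?thesis unfolding g_def F_step[OF lam \<mu>(1) i \<mu>(2)] Ti_quadratic[OF i F_props[OF lam \<mu>(1)]]
      by (simp add: algebra_simps mconst_diff)
  qed
  have maps: "sw i \<in> ?D \<rightarrow> ?A" "sw i \<in> ?A \<rightarrow> ?D"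
    using sw_Bset[OF _ k(2,1)] i by (auto simp: nth_sw Bset_length)
  have bij: "bij_betw (sw i) ?D ?A" by (rule bij_betwI[OF maps]) (use i Bset_length in auto)
  have "Ti t i (hsum lam k) - mconst t * hsum lam k = sum g ?B"
    by (simp add: hsum_def g_def Ti_sum sum_subtractf sum_distrib_left)
  also have "\<dots> = sum g (?D \<union> ?A)"
    using F_equal_parts[OF lam Bset_rearr i] finite_Bset
    by (intro sum.mono_neutral_right) (auto simp: g_def not_less order_le_less)
  also have "\<dots> = sum g ?D + sum g ?A"
    using finite_Bset[of n lam k] by (intro sum.union_disjoint) auto
  also have "sum g ?A = (\<Sum>\<mu>\<in>?D. g (sw i \<mu>))" by (rule sum.reindex_bij_betw[OF bij, symmetric])
  also have "\<dots> = (\<Sum>\<mu>\<in>?D. - g \<mu>)" by (rule sum.cong[OF refl anti])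
  finally show ?thesis by (simp add: sum_negf)
qed

lemma hsum_sym:
  assumes "is_partition n lam" "k \<le> n" "Suc i < k"
  shows "mswap i (hsum lam k) = hsum lam k"
  using Ti_eq_iff_sym[OF t_nz hsum_Ti[OF assms]] .

lemma hsum_props:
  assumes "is_partition n lam"
  shows "in_vars n (hsum lam k)" "total_deg_le (hsum lam k) (sum_list lam)"
  unfolding hsum_def using F_props[OF assms Bset_rearr] by auto

lemma descent_in_Bset:
  assumes "is_partition n lam" "k \<le> n" "\<And>j. k \<le> j \<Longrightarrow> j < n \<Longrightarrow> lam ! j = 0"
    and "\<xi> \<in> Bset n lam k" "\<xi> \<noteq> rev_upto k lam"
  obtains i where "Suc i < k" "\<xi> ! i > \<xi> ! Suc i"
proof -
  have "\<not> (\<forall>i. Suc i < k \<longrightarrow> \<xi> ! i \<le> \<xi> ! Suc i)"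
    using asc_unique[OF assms(4) rev_upto_Bset[OF assms(1-3)] assms(2)] rev_upto_asc[OF assms(1,2)] assms(5)
    by (meson le_SucI le_refl)
  thus ?thesis using that by (auto simp: not_le)
qed

text \<open>Runs downwards from M: any other member has a descent within the first k positions, and
  swapping it moves up in \<open>linv\<close>, which is bounded on the finite set.\<close>

lemma Bset_induct:
  assumes lam: "is_partition n lam" and k: "k \<le> n" "\<And>j. k \<le> j \<Longrightarrow> j < n \<Longrightarrow> lam ! j = 0"
    and "\<xi> \<in> Bset n lam k" and "P (rev_upto k lam)"
    and step: "\<And>\<xi> i. \<xi> \<in> Bset n lam k \<Longrightarrow> length \<xi> = n \<Longrightarrow> Suc i < k \<Longrightarrow> \<xi> ! i > \<xi> ! Suc i \<Longrightarrow>
      linv (sw i \<xi>) = Suc (linv \<xi>) \<Longrightarrow> sw i \<xi> \<in> Bset n lam k \<Longrightarrow> P (sw i \<xi>) \<Longrightarrow> P \<xi>"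
  shows "P \<xi>"
  using assms(4)
proof (induction "Max (linv ` Bset n lam k) - linv \<xi>" arbitrary: \<xi> rule: less_induct)
  case less
  show ?case
  proof (cases "\<xi> = rev_upto k lam")
    case True
    thus ?thesis using assms(5) by simp
  next
    case False
    obtain i where i: "Suc i < k" "\<xi> ! i > \<xi> ! Suc i" using descent_in_Bset[OF lam k less(2) False] .
    have len: "length \<xi> = n" using Bset_length[OF less(2)] .
    have l: "linv (sw i \<xi>) = Suc (linv \<xi>)" using i k len by (intro linv_sw) auto
    have B: "sw i \<xi> \<in> Bset n lam k" by (rule sw_Bset[OF less(2) i(1) k(1)])
    hence "linv (sw i \<xi>) \<le> Max (linv ` Bset n lam k)" using finite_Bset by (intro Max_ge) auto
    hence "P (sw i \<xi>)" using less(1)[OF _ B] l by simp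
    thus ?thesis using step less(2) len i l B by blast
  qed
qed

lemma linv_rev_upto_max:
  assumes "is_partition n lam" "k \<le> n" "\<And>j. k \<le> j \<Longrightarrow> j < n \<Longrightarrow> lam ! j = 0"
  shows "\<xi> \<in> Bset n lam k \<Longrightarrow> linv \<xi> \<le> linv (rev_upto k lam)"
  by (rule Bset_induct[OF assms, of \<xi>]) auto

text \<open>Symmetry in the first k variables makes the value constant on the block, so M may be
  taken. Its \<open>linv\<close> is maximal, hence triangularity leaves only f* of M itself, with
  value H(M).\<close>

lemma hsum_val:
  assumes lam: "is_partition n lam" and k: "k \<le> n" "\<And>j. k \<le> j \<Longrightarrow> j < n \<Longrightarrow> lam ! j = 0"
  shows "\<xi> \<in> Bset n lam k \<Longrightarrow> meval (hsum lam k) (pt \<xi>) = H (rev_upto k lam)"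
proof (rule Bset_induct[OF assms, of \<xi>])
  let ?M = "rev_upto k lam"
  have M: "?M \<in> Bset n lam k" by (rule rev_upto_Bset[OF assms])
  have "meval (hsum lam k) (pt ?M) = (\<Sum>\<mu>\<in>Bset n lam k. if \<mu> = ?M then H ?M else 0)"
    unfolding hsum_def meval_simps
  proof (rule sum.cong)
    fix \<mu> assume \<mu>: "\<mu> \<in> Bset n lam k"
    show "meval (F lam \<mu>) (pt ?M) = (if \<mu> = ?M then H ?M else 0)"
      using F_val_diag[OF lam Bset_rearr[OF M]] linv_rev_upto_max[OF assms \<mu>]
        F_val_triangular[OF lam Bset_rearr[OF \<mu>] Bset_rearr[OF M]] by auto
  qed simp
  thus "meval (hsum lam k) (pt ?M) = H ?M" using M finite_Bset by (simp add: sum.delta)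
qed (use val_sw_sym[OF hsum_sym[OF lam k(1)] hsum_props(1)[OF lam]] k in auto)

lemma hsum_expansion:
  assumes lam: "is_partition n lam" and k: "k \<le> n" "\<And>j. k \<le> j \<Longrightarrow> j < n \<Longrightarrow> lam ! j = 0"
  shows "hsum lam k = (\<Sum>\<xi>\<in>Bset n lam k. mconst (H (rev_upto k lam) / H \<xi>) * E \<xi>)"
proof -
  have "hsum lam k = (\<Sum>\<xi>\<in>Bset n lam k. mconst (meval (hsum lam k) (pt \<xi>) / H \<xi>) * E \<xi>)"
  proof (rule E_expansion[OF finite_Bset _ hsum_props[OF lam]])
    show "length \<xi> = n \<and> sum_list \<xi> = sum_list lam" if "\<xi> \<in> Bset n lam k" for \<xi>
      using Bset_length[OF that] rearr_sum_list[OF Bset_rearr[OF that]] by simp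
    fix \<nu> assume "length \<nu> = n" "sum_list \<nu> \<le> sum_list lam" "\<nu> \<notin> Bset n lam k"
    thus "meval (hsum lam k) (pt \<nu>) = 0"
      unfolding hsum_def meval_simps using F_val_outside[OF lam k(1)] by (intro sum.neutral) blast
  qed
  thus ?thesis using hsum_val[OF assms] by (simp cong: sum.cong)
qed

end

section \<open>Specialisation at \<open>q = 1\<close>\<close>

lemma spec_Fract: "poly b 1 \<noteq> 0 \<Longrightarrow> spec (Fract a b) = poly a 1 / poly b 1"
  unfolding spec_def
proof (rule the_equality)
  assume b: "poly b 1 \<noteq> 0"
  thus "\<exists>a' b'. Fract a b = Fract a' b' \<and> poly b' 1 \<noteq> 0 \<and> poly a 1 / poly b 1 = poly a' 1 / poly b' 1"
    by blast
  fix v assume "\<exists>a' b'. Fract a b = Fract a' b' \<and> poly b' 1 \<noteq> 0 \<and> v = poly a' 1 / poly b' 1"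
  then obtain a' b' where *: "Fract a b = Fract a' b'" "poly b' 1 \<noteq> 0" "v = poly a' 1 / poly b' 1" by blast
  have "b \<noteq> 0" "b' \<noteq> 0" using b *(2) by auto
  hence "a * b' = a' * b" using *(1) by (simp add: eq_fract)
  hence "poly a 1 * poly b' 1 = poly a' 1 * poly b 1" by (metis poly_mult)
  thus "v = poly a 1 / poly b 1" unfolding *(3) using b *(2) by (simp add: frac_eq_eq)
qed

lemma spec_ok_Fract: "poly b 1 \<noteq> 0 \<Longrightarrow> spec_ok (Fract a b)"
  unfolding spec_ok_def by blast

lemma spec_okE:
  assumes "spec_ok c"
  obtains a b where "c = Fract a b" "poly b 1 \<noteq> 0" "b \<noteq> 0" "spec c = poly a 1 / poly b 1"
  using assms spec_Fract unfolding spec_ok_def by (metis poly_0)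

lemma spec_eqI:
  assumes "c = Fract a b" "poly b 1 \<noteq> 0" "poly a 1 / poly b 1 = v"
  shows "spec_ok c \<and> spec c = v"
  using assms spec_ok_Fract spec_Fract by auto

lemma spec_0: "spec_ok 0" "spec 0 = 0"
  using spec_eqI[OF Zero_fract_def] by auto

lemma spec_1: "spec_ok 1" "spec 1 = 1"
  using spec_eqI[OF One_fract_def] by auto

lemma spec_arith:
  assumes "spec_ok c" "spec_ok d"
  shows "spec_ok (c + d) \<and> spec (c + d) = spec c + spec d"
    and "spec_ok (c * d) \<and> spec (c * d) = spec c * spec d"
    and "spec_ok (- c) \<and> spec (- c) = - spec c"
    and "spec c \<noteq> 0 \<Longrightarrow> spec_ok (inverse c) \<and> spec (inverse c) = inverse (spec c)"
proof -
  obtain a b where c: "c = Fract a b" "poly b 1 \<noteq> 0" "b \<noteq> 0" "spec c = poly a 1 / poly b 1"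
    using spec_okE[OF assms(1)] .
  obtain a' b' where d: "d = Fract a' b'" "poly b' 1 \<noteq> 0" "b' \<noteq> 0" "spec d = poly a' 1 / poly b' 1"
    using spec_okE[OF assms(2)] .
  show "spec_ok (c + d) \<and> spec (c + d) = spec c + spec d"
    using c d by (intro spec_eqI[of _ "a * b' + a' * b" "b * b'"]) (simp_all add: add_frac_eq)
  show "spec_ok (c * d) \<and> spec (c * d) = spec c * spec d"
    using c d by (intro spec_eqI[of _ "a * a'" "b * b'"]) simp_all
  show "spec_ok (- c) \<and> spec (- c) = - spec c"
    using c by (intro spec_eqI[of _ "- a" b]) simp_all
  show "spec_ok (inverse c) \<and> spec (inverse c) = inverse (spec c)" if "spec c \<noteq> 0"
    using c that by (intro spec_eqI[of _ b a]) auto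
qed

lemma spec_add:
  assumes "spec_ok c" "spec_ok d" shows "spec_ok (c + d)" "spec (c + d) = spec c + spec d"
  using spec_arith(1)[OF assms] by auto

lemma spec_mult:
  assumes "spec_ok c" "spec_ok d" shows "spec_ok (c * d)" "spec (c * d) = spec c * spec d"
  using spec_arith(2)[OF assms] by auto

lemma spec_uminus:
  assumes "spec_ok c" shows "spec_ok (- c)" "spec (- c) = - spec c"
  using spec_arith(3)[OF assms assms] by auto

lemma spec_inverse:
  assumes "spec_ok c" "spec c \<noteq> 0" shows "spec_ok (inverse c)" "spec (inverse c) = inverse (spec c)"
  using spec_arith(4)[OF assms(1,1,2)] by auto

lemma spec_diff:
  assumes "spec_ok c" "spec_ok d" shows "spec_ok (c - d)" "spec (c - d) = spec c - spec d"
  using spec_add[of c "- d"] spec_uminus[of d] assms by simp_all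

lemma spec_divide:
  assumes "spec_ok c" "spec_ok d" "spec d \<noteq> 0" shows "spec_ok (c / d)" "spec (c / d) = spec c / spec d"
  using spec_mult[of c "inverse d"] spec_inverse[of d] assms by (simp_all add: divide_inverse)

lemma spec_power:
  assumes "spec_ok c" shows "spec_ok (c ^ k)" "spec (c ^ k) = spec c ^ k"
  using assms by (induction k) (auto simp: spec_1 spec_mult)

text \<open>The local ring at q = 1. Closure of regular polynomials under T_i becomes an instance of
  the general statement on coefficient subrings.\<close>

interpretation sok: coeff_subring spec_ok
  by unfold_locales (auto simp: spec_0 spec_1 spec_add spec_uminus spec_mult)

lemma mspec_ok_iff: "mspec_ok p \<longleftrightarrow> sok.coeffs_in p"
  by (simp add: mspec_ok_def sok.coeffs_in_def)

lemma spec_qq: "spec_ok qq" "spec qq = 1"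
  unfolding qq_def by (simp_all add: spec_ok_Fract spec_Fract)

lemma spec_tq: "spec_ok tq" "spec tq = tt"
  unfolding tq_def tt_def by (simp_all add: spec_ok_Fract spec_Fract)

lemma Fract_power: "Fract (a :: 'b::idom) 1 ^ k = Fract (a ^ k) 1"
  by (induction k) (auto simp: One_fract_def)

lemma X_power: "[:0, 1 :: 'b::comm_semiring_1:] ^ k = monom 1 k"
  by (simp add: monom_altdef)

lemma tt_power_inj: "tt ^ a = tt ^ b \<longleftrightarrow> a = b"
proof
  assume "tt ^ a = tt ^ b"
  hence "(monom 1 a :: rat poly) = monom 1 b"
    by (simp add: tt_def Fract_power eq_fract X_power)
  thus "a = b" by (metis degree_monom_eq one_neq_zero)
qed simp

lemma tt_nz: "tt \<noteq> 0"
proof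
  assume "tt = 0"
  hence "tt ^ 1 = tt ^ 2" by simp
  thus False using tt_power_inj[of 1 2] by simp
qed

text \<open>In the polynomial ring in q over Q(t) the element in question is a monomial: its degree
  shows a, and its leading coefficient is a power of t that shows b.\<close>

lemma generic_qq_tq:
  assumes "qq ^ a * tq ^ b = qq ^ c * tq ^ d"
  shows "a = c \<and> b = d"
proof -
  have "[:0, 1:] ^ a * [:tt:] ^ b = monom (tt ^ b) a" for a b
    by (simp add: poly_const_pow monom_altdef)
  hence *: "qq ^ a * tq ^ b = Fract (monom (tt ^ b) a) 1" for a b
    unfolding qq_def tq_def tt_def[symmetric] Fract_power by simp
  have "monom (tt ^ b) a = monom (tt ^ d) c"
    using assms unfolding * by (simp add: eq_fract)
  hence "coeff (monom (tt ^ b) a) a = coeff (monom (tt ^ d) c) a" by simp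
  hence "a = c" using tt_nz by (auto split: if_splits)
  moreover from this have "tt ^ b = tt ^ d" using \<open>monom (tt ^ b) a = _\<close> by (metis lead_coeff_monom)
  ultimately show ?thesis by (simp add: tt_power_inj)
qed

interpretation G: generic_params qq tq n for n
proof
  show "qq \<noteq> 0" using spec_qq spec_0 by auto
  show "tq \<noteq> 0" using spec_tq spec_0 tt_nz by auto
qed (fact generic_qq_tq)

section \<open>Coefficientwise specialisation and the operators\<close>

lemma coeff_mspec: "coeff_at (mspec p) m = spec (coeff_at p m)"
  unfolding mspec_def by (simp add: Poly_Mapping.map.rep_eq when_def spec_0)

lemma mspec_0 [simp]: "mspec 0 = 0"
  by (rule poly_mapping_eqI) (simp add: coeff_mspec spec_0)

lemma mspec_1: "mspec 1 = 1"
  by (rule poly_mapping_eqI) (simp add: coeff_mspec spec_0 spec_1 lookup_one when_def)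

lemma mspec_add: "mspec_ok p \<Longrightarrow> mspec_ok r \<Longrightarrow> mspec (p + r) = mspec p + mspec r"
  by (rule poly_mapping_eqI) (simp add: coeff_mspec lookup_add spec_add mspec_ok_def)

lemma mspec_diff: "mspec_ok p \<Longrightarrow> mspec_ok r \<Longrightarrow> mspec (p - r) = mspec p - mspec r"
  by (rule poly_mapping_eqI) (simp add: coeff_mspec lookup_minus spec_diff mspec_ok_def)

lemma mspec_sum: "(\<And>a. a \<in> A \<Longrightarrow> mspec_ok (f a)) \<Longrightarrow> mspec (sum f A) = (\<Sum>a\<in>A. mspec (f a))"
  by (induction A rule: infinite_finite_induct)
     (auto simp: mspec_add mspec_ok_iff sok.coeffs_in_sum)

lemma mspec_cmult: "spec_ok c \<Longrightarrow> mspec_ok p \<Longrightarrow> mspec (mconst c * p) = mconst (spec c) * mspec p"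
  by (rule poly_mapping_eqI) (simp add: coeff_mspec spec_mult mspec_ok_def)

lemma mspec_var_mult: "mspec (mvar i * p) = mvar i * mspec p"
  by (rule poly_mapping_eqI) (simp add: coeff_mspec coeff_var_mult spec_0)

lemma mspec_mperm: "bij \<sigma> \<Longrightarrow> mspec (mperm \<sigma> p) = mperm \<sigma> (mspec p)"
  by (rule poly_mapping_eqI) (simp add: coeff_mspec coeff_mperm_inv)

lemma mspec_ok_mperm: "bij \<sigma> \<Longrightarrow> mspec_ok p \<Longrightarrow> mspec_ok (mperm \<sigma> p)"
  by (simp add: mspec_ok_def coeff_mperm_inv)

lemma mspec_ok_Ti: "mspec_ok f \<Longrightarrow> mspec_ok (Ti tq i f)"
  by (simp add: mspec_ok_iff sok.coeffs_in_Ti spec_tq)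

text \<open>A quotient cannot be specialised directly. The equation without division is specialised
  instead, and its solution at q = 1 is unique.\<close>

lemma mspec_Ti:
  assumes f: "mspec_ok f"
  shows "mspec (Ti tq i f) = Ti tt i (mspec f)"
proof (rule Ti_eqI[symmetric])
  have s: "mspec_ok (mswap i f)" using f unfolding mswap_def by (simp add: mspec_ok_mperm)
  have ok: "mspec_ok (mvar j * p)" "spec_ok c \<Longrightarrow> mspec_ok (mconst c * p)" if "mspec_ok p" for j c p
    using that by (auto simp: mspec_ok_iff sok.coeffs_in_var_mult sok.coeffs_in_cmult)
  have ok2: "mspec_ok (p + r)" "mspec_ok (p - r)" if "mspec_ok p" "mspec_ok r" for p r
    using that by (auto simp: mspec_ok_iff sok.coeffs_in_add sok.coeffs_in_diff)
  have c: "spec_ok (1 - tq)" "spec (1 - tq) = 1 - tt" "spec_ok tq" "spec tq = tt"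
    by (simp_all add: spec_diff spec_1 spec_tq)
  have "vdiff i * mspec (Ti tq i f) = mspec (vdiff i * Ti tq i f)"
    using mspec_ok_Ti[OF f] by (simp add: left_diff_distrib mspec_diff mspec_var_mult ok)
  also have "\<dots> = mspec (mconst (1 - tq) * (mvar (Suc i) * f)
      + (mconst tq * (mvar i * mswap i f) - mvar (Suc i) * mswap i f))"
    unfolding Ti_mult by (simp add: algebra_simps)
  also have "\<dots> = mconst (1 - tt) * (mvar (Suc i) * mspec f)
      + (mconst tt * (mvar i * mspec (mswap i f)) - mvar (Suc i) * mspec (mswap i f))"
    using f s c by (simp add: mspec_add mspec_diff mspec_cmult mspec_var_mult ok ok2)
  also have "\<dots> = mconst (1 - tt) * mvar (Suc i) * mspec f + (mconst tt * mvar i - mvar (Suc i)) * mswap i (mspec f)"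
    by (simp add: mswap_def mspec_mperm algebra_simps)
  finally show "vdiff i * mspec (Ti tq i f) = \<dots>" .
qed

lemma spec_pt: "spec_ok (G.pt \<mu> i)" "spec (G.pt \<mu> i) = 1 / tt ^ kk \<mu> i"
  unfolding tilde_def using tt_nz
  by (simp_all add: spec_divide spec_power spec_qq spec_tq)

lemma spec_pt_diff:
  assumes "kk \<mu> i \<noteq> kk \<mu> j" shows "spec (G.pt \<mu> i - G.pt \<mu> j) \<noteq> 0"
  using assms tt_nz by (simp add: spec_diff spec_pt tt_power_inj)

lemma kk_adj_descent:
  assumes "Suc i < length \<mu>" "\<mu> ! i > \<mu> ! Suc i" shows "kk \<mu> i < kk \<mu> (Suc i)"
  using assms by (intro kk_less) (auto simp: beats_def)

text \<open>At a descent the two ranks differ, so the denominator remains nonzero at q = 1.\<close>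

lemma spec_ok_corr:
  assumes "Suc i < length \<mu>" "\<mu> ! i > \<mu> ! Suc i"
  shows "spec_ok (G.corr \<mu> i)"
  unfolding G.corr_def using kk_adj_descent[OF assms]
  by (intro spec_divide spec_mult spec_diff spec_pt spec_tq spec_1 spec_pt_diff) auto

text \<open>At q = 1 the coordinates are powers of \<open>1 / tt\<close> with the ranks as
  exponents, so the numerator \<open>t y - x\<close> becomes 0 for consecutive ranks.\<close>

lemma spec_rho:
  assumes "Suc i < length \<mu>" "\<mu> ! i > \<mu> ! Suc i"
  shows "spec_ok (G.rho (G.pt \<mu> i) (G.pt \<mu> (Suc i)))"
    and "kk \<mu> (Suc i) = Suc (kk \<mu> i) \<Longrightarrow> spec (G.rho (G.pt \<mu> i) (G.pt \<mu> (Suc i))) = 0"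
proof -
  have d: "spec (G.pt \<mu> (Suc i) - G.pt \<mu> i) \<noteq> 0"
    using kk_adj_descent[OF assms] by (intro spec_pt_diff) simp
  show "spec_ok (G.rho (G.pt \<mu> i) (G.pt \<mu> (Suc i)))"
    unfolding G.rho_def by (intro spec_divide spec_mult spec_diff spec_pt spec_tq d)
  assume k: "kk \<mu> (Suc i) = Suc (kk \<mu> i)"
  have "spec (G.rho (G.pt \<mu> i) (G.pt \<mu> (Suc i))) =
      spec (tq * G.pt \<mu> (Suc i) - G.pt \<mu> i) / spec (G.pt \<mu> (Suc i) - G.pt \<mu> i)"
    unfolding G.rho_def by (intro spec_divide spec_mult spec_diff spec_pt spec_tq d)
  also have "spec (tq * G.pt \<mu> (Suc i) - G.pt \<mu> i) = 0"
    using k tt_nz by (simp add: spec_diff spec_mult spec_pt spec_tq)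
  finally show "spec (G.rho (G.pt \<mu> i) (G.pt \<mu> (Suc i))) = 0" by simp
qed

lemma spec_scale_last:
  assumes "mspec_ok p" shows "mspec_ok (scale_last qq k p)" "mspec (scale_last qq k p) = mspec p"
proof -
  have "spec_ok (c / qq ^ j)" "spec (c / qq ^ j) = spec c" if "spec_ok c" for c j
    using that by (simp_all add: spec_divide spec_power spec_qq)
  thus "mspec_ok (scale_last qq k p)" "mspec (scale_last qq k p) = mspec p"
    using assms by (auto simp: mspec_ok_def coeff_scale_last coeff_mspec intro!: poly_mapping_eqI)
qed

lemma spec_Phi:
  assumes "mspec_ok p"
  shows "mspec_ok (G.Phi n p)"
    "mspec (G.Phi n p) = (mvar 0 - mconst (1 / tt ^ (n - 1))) * mperm (rotr n) (mspec p)"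
proof -
  let ?r = "mperm (rotr n) (scale_last qq (n - 1) p)"
  have r: "mspec_ok ?r" "mspec ?r = mperm (rotr n) (mspec p)"
    using spec_scale_last[OF assms] by (simp_all add: mspec_ok_mperm mspec_mperm bij_rotr)
  have c: "spec_ok (1 / tq ^ (n - 1))" "spec (1 / tq ^ (n - 1)) = 1 / tt ^ (n - 1)"
    using tt_nz by (simp_all add: spec_divide spec_power spec_tq spec_1)
  have Phi: "G.Phi n p = mvar 0 * ?r - mconst (1 / tq ^ (n - 1)) * ?r"
    by (simp add: G.Phi_def left_diff_distrib)
  have ok: "mspec_ok (mvar 0 * ?r)" "mspec_ok (mconst (1 / tq ^ (n - 1)) * ?r)"
    using r c by (auto simp only: mspec_ok_iff intro!: sok.coeffs_in_var_mult sok.coeffs_in_cmult)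
  show "mspec_ok (G.Phi n p)"
    unfolding Phi using ok by (simp only: mspec_ok_iff sok.coeffs_in_diff)
  have "mspec (G.Phi n p) = mspec (mvar 0 * ?r) - mspec (mconst (1 / tq ^ (n - 1)) * ?r)"
    unfolding Phi by (rule mspec_diff[OF ok])
  also have "\<dots> = (mvar 0 - mconst (1 / tt ^ (n - 1))) * mperm (rotr n) (mspec p)"
    unfolding mspec_var_mult mspec_cmult[OF c(1) r(1)] c(2) r(2) by (rule left_diff_distrib[symmetric])
  finally show "mspec (G.Phi n p) = \<dots>" .
qed

text \<open>No poles arise in the recursion that constructs E*: rotations contribute powers of q and
  t, and the constants \<open>corr\<close> are regular.\<close>

lemma mspec_ok_E: "length \<mu> = n \<Longrightarrow> mspec_ok (G.E n \<mu>)"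
proof (induction \<mu> rule: comp_less_induct)
  case (less \<mu>)
  from less(1) show ?case
  proof (cases \<mu> rule: comp_cases)
    case zero
    thus ?thesis by (simp add: G.E_zero mspec_ok_def lookup_one when_def spec_0 spec_1)
  next
    case (phi \<nu>)
    hence "mspec_ok (G.E n \<nu>)" using less by blast
    thus ?thesis unfolding phi(3) G.E_phi[OF phi(2,1)]
      using spec_Phi(1) spec_power(1)[OF spec_qq(1)] by (simp add: mspec_ok_iff sok.coeffs_in_cmult)
  next
    case (sw \<nu> i)
    have "mspec_ok (G.E n \<nu>)" using less(2)[OF sw(2)] sw(7,8,9) by simp
    moreover have "spec_ok (G.corr \<nu> i)" using sw(1,2,5,6) by (intro spec_ok_corr) auto
    moreover have "G.E n \<mu> = Ti tq i (G.E n \<nu>) + mconst (G.corr \<nu> i) * G.E n \<nu>"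
      unfolding sw(3) by (rule G.E_canonical_step[OF sw(2,1,4,5,6)])
    ultimately show ?thesis
      using mspec_ok_Ti by (simp add: mspec_ok_iff sok.coeffs_in_cmult sok.coeffs_in_add)
  qed
qed

lemma mspec_ok_fstar:
  assumes "is_partition n lam" "\<mu> \<in> rearr n lam"
  shows "mspec_ok (G.F n lam \<mu>)"
proof -
  have len: "length lam = n" using assms(1) by (simp add: is_partition_def)
  have "mspec_ok p" if "G.Fpath n lam \<nu> p" for \<nu> p
    using that by (induction rule: G.Fpath.induct) (auto intro: mspec_ok_E[OF len] mspec_ok_Ti)
  thus ?thesis using G.Fpath_fstar[OF assms] by blast
qed

definition eps :: "nat \<Rightarrow> nat list \<Rightarrow> rat poly fract mpoly" where
  "eps n \<mu> = mspec (G.E n \<mu>)"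

lemma eps_phi:
  assumes "length \<mu> = n" "0 < n"
  shows "eps n (phi \<mu>) = (mvar 0 - mconst (1 / tt ^ (n - 1))) * mperm (rotr n) (eps n \<mu>)"
  unfolding eps_def G.E_phi[OF assms]
  using spec_Phi[OF mspec_ok_E[OF assms(1)]] by (simp add: mspec_cmult spec_power spec_qq)

text \<open>Climbing from \<open>\<xi>\<close> to M through descents writes the ratio as a product
  of factors \<open>rho\<close>, all regular at q = 1. The last one, on arrival at M, has
  consecutive ranks and vanishes, so any nonempty climb gives 0.\<close>

lemma spec_H_ratio:
  assumes lam: "is_partition n lam" and k: "k \<le> n" "\<And>j. k \<le> j \<Longrightarrow> j < n \<Longrightarrow> lam ! j = 0"
    and pos: "k = n \<or> (\<forall>j<k. lam ! j > 0)" and "\<xi> \<in> Bset n lam k"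
  shows "spec_ok (G.H n (rev_upto k lam) / G.H n \<xi>) \<and>
    (\<xi> \<noteq> rev_upto k lam \<longrightarrow> spec (G.H n (rev_upto k lam) / G.H n \<xi>) = 0)"
proof (rule G.Bset_induct[OF lam k assms(5)])
  let ?M = "rev_upto k lam"
  let ?r = "\<lambda>\<xi>. G.H n ?M / G.H n \<xi>"
  have "?M \<in> Bset n lam k" by (rule rev_upto_Bset[OF lam k])
  thus "spec_ok (?r ?M) \<and> (?M \<noteq> ?M \<longrightarrow> spec (?r ?M) = 0)"
    using G.H_nz[OF Bset_length] by (simp add: spec_1)
  fix \<xi> i
  assume \<xi>: "\<xi> \<in> Bset n lam k" and len: "length \<xi> = n" and i: "Suc i < k" "\<xi> ! i > \<xi> ! Suc i"
    and B: "sw i \<xi> \<in> Bset n lam k" and "spec_ok (?r (sw i \<xi>)) \<and>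
      (sw i \<xi> \<noteq> ?M \<longrightarrow> spec (?r (sw i \<xi>)) = 0)"
  hence IH: "spec_ok (?r (sw i \<xi>))"
    "sw i \<xi> \<noteq> ?M \<Longrightarrow> spec (?r (sw i \<xi>)) = 0" by auto
  let ?\<rho> = "G.rho (G.pt \<xi> i) (G.pt \<xi> (Suc i))"
  have "G.H n (sw i \<xi>) = ?\<rho> * G.H n \<xi>" using G.H_step[OF len] i k by simp
  hence ratio: "?r \<xi> = ?r (sw i \<xi>) * ?\<rho>"
    using G.H_nz[OF len] G.H_nz[OF Bset_length[OF B]] by (simp add: field_simps)
  have rho: "spec_ok ?\<rho>" "kk \<xi> (Suc i) = Suc (kk \<xi> i) \<Longrightarrow> spec ?\<rho> = 0"
    using spec_rho[of i \<xi>] i k len by auto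
  have "spec (?r (sw i \<xi>) * ?\<rho>) = 0"
  proof (cases "sw i \<xi> = ?M")
    case True
    \<comment> \<open>Here \<open>\<xi>\<close> is M with two neighbouring parts exchanged. As M
      increases, no other part can rank between these two.\<close>
    have "kk \<xi> (Suc i) = Suc (kk \<xi> i)"
    proof (rule kk_descent)
      show "Suc i < length \<xi>" "\<xi> ! i > \<xi> ! Suc i" using i k len by auto
      fix l assume l: "l < length \<xi>" "l \<noteq> i" "beats \<xi> l (Suc i)"
      have \<xi>M: "\<xi> ! j = ?M ! adj i j" if "j < n" for j
        using that len i k nth_sw[of "adj i j" \<xi> i] True by (simp add: adj_less)
      have \<xi>i: "\<xi> ! i = ?M ! Suc i" "\<xi> ! Suc i = ?M ! i" using \<xi>M[of i] \<xi>M[of "Suc i"] i k by auto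
      have \<xi>l: "\<xi> ! l = ?M ! l" if "l \<noteq> Suc i" using \<xi>M[of l] l len that by (simp add: transpose_def)
      consider "l < i" | "l = Suc i" | "Suc i < l" "l < k" | "k \<le> l" using l(2) by linarith
      thus "beats \<xi> l i"
      proof cases
        case 1
        hence "\<xi> ! l \<le> \<xi> ! Suc i"
          using \<xi>l \<xi>i rev_upto_asc[OF lam k(1), of l i] i by simp
        thus ?thesis using l(3) 1 by (auto simp: beats_def)
      next
        case 2
        thus ?thesis using l(3) by (simp add: beats_def)
      next
        case 3
        hence "\<xi> ! i \<le> \<xi> ! l"
          using \<xi>l \<xi>i rev_upto_asc[OF lam k(1), of "Suc i" l] by simp
        thus ?thesis using 3 by (auto simp: beats_def)
      next
        case 4
        \<comment> \<open>Only here does the alternative \<open>pos\<close> enter: a zero behind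
          position k could rank between two parts only if the lower of them were zero too.\<close>
        hence "\<xi> ! l = 0" using \<xi> l(1) len by (auto simp: Bset_def)
        hence M0: "?M ! i = 0" using l(3) \<xi>i by (auto simp: beats_def)
        have "\<forall>j<k. lam ! j > 0" using pos 4 l len by auto
        moreover have "?M ! i = lam ! (k - Suc i)"
          using i k lam by (simp add: rev_upto_def nth_append rev_nth is_partition_def)
        ultimately have "?M ! i > 0" using i by simp
        thus ?thesis using M0 by simp
      qed
    qed
    thus ?thesis unfolding spec_mult(2)[OF IH(1) rho(1)] using rho(2) by simp
  next
    case False
    thus ?thesis unfolding spec_mult(2)[OF IH(1) rho(1)] using IH(2) by simp
  qed
  thus "spec_ok (?r \<xi>) \<and> (\<xi> \<noteq> ?M \<longrightarrow> spec (?r \<xi>) = 0)"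
    unfolding ratio using spec_mult(1)[OF IH(1) rho(1)] by simp
qed

lemma mspec_hsum:
  assumes lam: "is_partition n lam" and k: "k \<le> n" "\<And>j. k \<le> j \<Longrightarrow> j < n \<Longrightarrow> lam ! j = 0"
    and pos: "k = n \<or> (\<forall>j<k. lam ! j > 0)"
  shows "mspec_ok (G.hsum n lam k)" "mspec (G.hsum n lam k) = eps n (rev_upto k lam)"
proof -
  let ?M = "rev_upto k lam" and ?B = "Bset n lam k"
  let ?r = "\<lambda>\<xi>. G.H n ?M / G.H n \<xi>"
  have ratio: "spec_ok (?r \<xi>) \<and> (\<xi> \<noteq> ?M \<longrightarrow> spec (?r \<xi>) = 0)"
    if "\<xi> \<in> ?B" for \<xi>
    using spec_H_ratio[of n lam k \<xi>] assms that by blast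
  have expansion: "G.hsum n lam k = (\<Sum>\<xi>\<in>?B. mconst (?r \<xi>) * G.E n \<xi>)"
    by (rule G.hsum_expansion[OF lam k])
  have M: "?M \<in> ?B" by (rule rev_upto_Bset[OF lam k])
  have ok: "mspec_ok (mconst (?r \<xi>) * G.E n \<xi>)" if "\<xi> \<in> ?B" for \<xi>
    using ratio[OF that] mspec_ok_E[OF Bset_length[OF that]] by (simp add: mspec_ok_iff sok.coeffs_in_cmult)
  show "mspec_ok (G.hsum n lam k)"
    unfolding expansion using ok by (simp add: mspec_ok_iff sok.coeffs_in_sum)
  have "mspec (G.hsum n lam k) = (\<Sum>\<xi>\<in>?B. mspec (mconst (?r \<xi>) * G.E n \<xi>))"
    unfolding expansion by (rule mspec_sum[OF ok])
  also have "\<dots> = (\<Sum>\<xi>\<in>?B. if \<xi> = ?M then eps n ?M else 0)"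
  proof (rule sum.cong)
    fix \<xi> assume \<xi>: "\<xi> \<in> ?B"
    have "mspec (mconst (?r \<xi>) * G.E n \<xi>) = mconst (spec (?r \<xi>)) * eps n \<xi>"
      unfolding eps_def using ratio[OF \<xi>] mspec_ok_E[OF Bset_length[OF \<xi>]] by (simp add: mspec_cmult)
    thus "mspec (mconst (?r \<xi>) * G.E n \<xi>) = (if \<xi> = ?M then eps n ?M else 0)"
      using ratio[OF \<xi>] G.H_nz[OF Bset_length[OF M]] by (auto simp: spec_1)
  qed simp
  also have "\<dots> = eps n ?M" using M finite_Bset by (simp add: sum.delta)
  finally show "mspec (G.hsum n lam k) = eps n ?M" .
qed

section \<open>Factorisation\<close>

lemma card_supp: "card (supp \<mu>) = size (filter_mset (\<lambda>x. 0 < x) (mset \<mu>))"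
proof -
  have "size (filter_mset (\<lambda>x. 0 < x) (mset \<mu>)) = length (filter (\<lambda>x. 0 < x) \<mu>)"
    by (simp flip: mset_filter)
  thus ?thesis by (simp add: supp_def length_filter_conv_card)
qed

lemma rearr_card_supp: "\<mu> \<in> rearr n lam \<Longrightarrow> card (supp \<mu>) = card (supp lam)"
  by (simp add: card_supp rearr_def)

lemma finite_supp: "finite (supp \<mu>)"
  by (simp add: supp_def)

lemma down_closed_nat_set:
  assumes "finite S" "\<And>i. Suc i \<in> S \<Longrightarrow> i \<in> S"
  shows "S = {..<card S}"
proof (cases "S = {}")
  case False
  have down: "j \<le> i \<Longrightarrow> i \<in> S \<Longrightarrow> j \<in> S" for i j
    by (induction rule: dec_induct) (auto intro: assms(2))
  have "S = {..<Suc (Max S)}"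
    using down[of _ "Max S"] Max_in[OF assms(1) False] Max_ge[OF assms(1)] by (auto simp: less_Suc_eq_le)
  thus ?thesis by (metis card_lessThan)
qed simp

lemma partition_supp:
  assumes "is_partition n lam"
  shows "supp lam = {..<card (supp lam)}"
proof (rule down_closed_nat_set[OF finite_supp])
  fix i assume "Suc i \<in> supp lam"
  moreover have "lam ! Suc i \<le> lam ! i" if "Suc i < length lam"
    using assms that sorted_desc_iff_adjacent by (auto simp: is_partition_def)
  ultimately show "i \<in> supp lam" by (auto simp: supp_def)
qed

lemma partition_parts:
  assumes "is_partition n lam" "k = card (supp lam)"
  shows "k \<le> n" "j < k \<Longrightarrow> lam ! j > 0" "k \<le> j \<Longrightarrow> j < n \<Longrightarrow> lam ! j = 0"
proof -
  have S: "supp lam = {..<k}" using partition_supp[OF assms(1)] assms(2) by simp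
  have len: "length lam = n" using assms by (simp add: is_partition_def)
  have "{..<k} \<subseteq> {..<n}" unfolding S[symmetric] len[symmetric] by (auto simp: supp_def)
  thus "k \<le> n" by simp
  show "lam ! j > 0" if "j < k"
    using that S by (auto simp: supp_def)
  show "lam ! j = 0" if "k \<le> j" "j < n"
    using that S[unfolded supp_def] len by (metis (mono_tags, lifting) gr0I leD lessThan_iff mem_Collect_eq)
qed

lemma Bset_supp:
  assumes "is_partition n lam" "k = card (supp lam)"
  shows "Bset n lam k = {\<mu>. \<mu> \<in> rearr n lam \<and> supp \<mu> = {..<k}}"
proof -
  have "(\<forall>j. k \<le> j \<and> j < n \<longrightarrow> \<mu> ! j = 0) \<longleftrightarrow> supp \<mu> = {..<k}" if \<mu>: "\<mu> \<in> rearr n lam" for \<mu>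
  proof -
    have "(\<forall>j. k \<le> j \<and> j < n \<longrightarrow> \<mu> ! j = 0) \<longleftrightarrow> supp \<mu> \<subseteq> {..<k}"
      using \<mu> by (fastforce simp: supp_def rearr_def not_less[symmetric])
    thus ?thesis
      using rearr_card_supp[OF \<mu>] assms(2) card_subset_eq[of "{..<k}" "supp \<mu>"] by auto
  qed
  thus ?thesis unfolding Bset_def by blast
qed

section \<open>Symmetry of the specialised antidominant polynomial\<close>

lemma symmetric_if_adjacent:
  assumes "\<And>i. Suc i < n \<Longrightarrow> mswap i p = p"
  shows "symmetric_mp n p"
  unfolding symmetric_mp_def
proof (intro allI impI)
  fix \<sigma> assume "\<sigma> permutes {..<n}"
  then obtain w where w: "valid_word n w" "perm_word w = \<sigma>" using perm_word_ex by blast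
  from w(1) have "mperm (perm_word w) p = p"
  proof (induction w)
    case Nil
    thus ?case by (simp only: perm_word_Nil mperm_id)
  next
    case (Cons i w)
    have "mperm (perm_word (i # w)) p = mswap i (mperm (perm_word w) p)"
      unfolding perm_word_Cons mswap_def mperm_mperm ..
    thus ?case using Cons assms by (simp add: valid_word_def)
  qed
  thus "mperm \<sigma> p = p" using w(2) by simp
qed

lemma Bset_n: "Bset n lam n = rearr n lam"
  by (auto simp: Bset_def)

lemma rev_upto_n: "length lam = n \<Longrightarrow> rev_upto n lam = rev lam"
  by (simp add: rev_upto_def)

lemma hsum_full_symmetric:
  assumes "is_partition n lam"
  shows "symmetric_mp n (G.hsum n lam n)"
  using G.hsum_sym[OF assms order_refl] by (rule symmetric_if_adjacent)

lemma mspec_hsum_full: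
  assumes "is_partition n lam"
  shows "mspec_ok (G.hsum n lam n)" "mspec (G.hsum n lam n) = eps n (rev lam)"
  using mspec_hsum[of n lam n] assms rev_upto_n[of lam n] by (auto simp: is_partition_def)

text \<open>The case k = n of the collapse: at q = 1 the sum of f* over all rearrangements, which is
  symmetric, equals E* of the increasing rearrangement.\<close>

lemma eps_antidominant_sym:
  assumes "is_partition n lam" "\<sigma> permutes {..<n}"
  shows "mperm \<sigma> (eps n (rev lam)) = eps n (rev lam)"
proof -
  have "mperm \<sigma> (mspec (G.hsum n lam n)) = mspec (G.hsum n lam n)"
    using hsum_full_symmetric[OF assms(1)] assms(2) mspec_mperm[OF permutes_bij[OF assms(2)], of "G.hsum n lam n"]
    by (simp add: symmetric_mp_def)
  thus ?thesis using mspec_hsum_full[OF assms(1)] by simp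
qed

text \<open>At q = 1 a rotation multiplies by a linear factor in the first variable and rotates the
  rest. An invariant starting polynomial is left alone, so only linear factors accumulate.\<close>

lemma eps_phi_iterate:
  assumes "length \<nu> = n" "mperm (rotr n) (eps n \<nu>) = eps n \<nu>"
  shows "j \<le> n \<Longrightarrow> length ((phi ^^ j) \<nu>) = n \<and>
    eps n ((phi ^^ j) \<nu>) = (\<Prod>i<j. mvar i - mconst (1 / tt ^ (n - 1))) * eps n \<nu>"
proof (induction j)
  case 0
  thus ?case using assms by simp
next
  case (Suc j)
  hence len: "length ((phi ^^ j) \<nu>) = n" and n: "0 < n" by auto
  hence ne: "(phi ^^ j) \<nu> \<noteq> []" by auto
  let ?c = "mconst (1 / tt ^ (n - 1))"
  have "eps n ((phi ^^ Suc j) \<nu>) = (mvar 0 - ?c) * mperm (rotr n) (eps n ((phi ^^ j) \<nu>))"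
    using eps_phi[OF len n] by simp
  also have "mperm (rotr n) (eps n ((phi ^^ j) \<nu>)) = (\<Prod>i<j. mvar (rotr n i) - ?c) * eps n \<nu>"
    using Suc assms(2) by simp
  \<comment> \<open>As \<open>Suc j \<le> n\<close>, the indices below j do not wrap around and the
    rotation acts on them as \<open>Suc\<close>.\<close>
  also have "(\<Prod>i<j. mvar (rotr n i) - ?c) = (\<Prod>i<j. mvar (Suc i) - ?c)"
    using Suc.prems by (intro prod.cong) (auto simp: rotr_def)
  also have "(mvar 0 - ?c) * ((\<Prod>i<j. mvar (Suc i) - ?c) * eps n \<nu>) =
      (\<Prod>i<Suc j. mvar i - ?c) * eps n \<nu>"
    unfolding prod.lessThan_Suc_shift by (simp only: mult.assoc)
  finally show ?case using len ne by simp
qed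

section \<open>Removing the first column\<close>

lemma phi_iterate: "(phi ^^ length \<xi>) (zs @ \<xi>) = map Suc \<xi> @ zs"
proof (induction \<xi> arbitrary: zs rule: rev_induct)
  case (snoc a \<xi>)
  have "phi (zs @ \<xi> @ [a]) = (Suc a # zs) @ \<xi>"
    by (simp add: phi_def butlast_append)
  thus ?case using snoc[of "Suc a # zs"] by (simp add: funpow_Suc_right del: funpow.simps)
qed simp

text \<open>Subtraction is truncated, so zero parts stay zero and the result is the diagram without
  its first column.\<close>

definition strip :: "nat list \<Rightarrow> nat list" where
  "strip lam = map (\<lambda>x. x - 1) lam"

lemma strip_partition: "is_partition n lam \<Longrightarrow> is_partition n (strip lam)"
  by (auto simp: is_partition_def strip_def sorted_wrt_map intro: sorted_wrt_mono_rel[rotated])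

text \<open>The reversed stripped partition starts with the n - k zeros of the old empty rows.
  Rotating k times brings the other k entries to the front in the same order and gives each its box
  of the first column back.\<close>

lemma rev_upto_strip:
  assumes "is_partition n lam" "k = card (supp lam)"
  shows "rev_upto k lam = (phi ^^ k) (rev (strip lam))"
proof -
  note k = partition_parts[OF assms]
  have len: "length lam = n" using assms by (simp add: is_partition_def)
  have "rev (strip lam) = rev (drop k (strip lam)) @ rev (take k (strip lam))"
    by (metis append_take_drop_id rev_append)
  moreover have "length (rev (take k (strip lam))) = k" using k(1) len by (simp add: strip_def)
  ultimately have "(phi ^^ k) (rev (strip lam)) = map Suc (rev (take k (strip lam))) @ rev (drop k (strip lam))"
    using phi_iterate[of "rev (take k (strip lam))" "rev (drop k (strip lam))"] by simp
  moreover have "map Suc (take k (strip lam)) = take k lam"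
    using k len by (intro nth_equalityI) (auto simp: strip_def)
  moreover have "rev (drop k (strip lam)) = drop k lam"
    using k len by (intro nth_equalityI) (auto simp: strip_def rev_nth)
  ultimately show ?thesis by (simp add: rev_upto_def flip: rev_map)
qed

definition gS :: "nat \<Rightarrow> nat set \<Rightarrow> rat poly fract mpoly" where
  "gS n S = (\<Prod>i\<in>S. mvar i - mconst (tt ^ card (({..<n} - S) \<inter> {..<i}) / tt ^ (n - 1)))"

lemma eps_leading_block:
  assumes "is_partition n lam" "k = card (supp lam)"
  shows "eps n (rev_upto k lam) = gS n {..<k} * eps n (rev (strip lam))"
proof -
  have len: "length (rev (strip lam)) = n" using assms by (simp add: is_partition_def strip_def)
  have "eps n (rev_upto k lam) = (\<Prod>i<k. mvar i - mconst (1 / tt ^ (n - 1))) * eps n (rev (strip lam))"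
    unfolding rev_upto_strip[OF assms]
    using eps_phi_iterate[OF len eps_antidominant_sym[OF strip_partition[OF assms(1)] rotr_permutes]]
      partition_parts(1)[OF assms] by blast
  also have "(\<Prod>i<k. mvar i - mconst (1 / tt ^ (n - 1))) = gS n {..<k}"
    unfolding gS_def
  proof (rule prod.cong)
    fix i assume "i \<in> {..<k}"
    hence "({..<n} - {..<k}) \<inter> {..<i} = {}" by auto
    thus "mvar i - mconst (1 / tt ^ (n - 1)) = mvar i - mconst (tt ^ card (({..<n} - {..<k}) \<inter> {..<i}) / tt ^ (n - 1))"
      by simp
  qed simp
  finally show ?thesis .
qed

text \<open>T_i sends \<open>x_i - c\<close> to \<open>x_{i+1} - t c\<close>, and the additional t
  accounts for i, which now lies in the complement below i+1. The remaining factors are symmetric in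
  the two variables and act as scalars.\<close>

lemma gS_step:
  assumes "S \<subseteq> {..<n}" "i \<in> S" "Suc i \<notin> S" "Suc i < n"
  shows "Ti tt i (gS n S) = gS n (insert (Suc i) (S - {i}))"
proof -
  let ?S' = "insert (Suc i) (S - {i})"
  let ?c = "\<lambda>S j. tt ^ card (({..<n} - S) \<inter> {..<j}) / tt ^ (n - 1)"
  have fin: "finite S" using assms(1) finite_subset by blast
  define P where "P = (\<Prod>j\<in>S - {i}. mvar j - mconst (?c S j))"
  define c where "c = ?c S i"
  \<comment> \<open>Below a position j > i+1 the complement gains i and loses i+1, so its
    cardinality is unchanged.\<close>
  have same: "?c ?S' j = ?c S j" if j: "j \<in> S - {i}" for j
  proof (cases "j < i")
    case True
    hence "({..<n} - ?S') \<inter> {..<j} = ({..<n} - S) \<inter> {..<j}" by auto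
    thus ?thesis by simp
  next
    case False
    hence j2: "Suc i < j" using j assms(3) by (metis DiffE Suc_lessI linorder_neqE_nat singletonI)
    let ?A = "({..<n} - (insert (Suc i) S)) \<inter> {..<j}"
    have "({..<n} - ?S') \<inter> {..<j} = insert i ?A" "({..<n} - S) \<inter> {..<j} = insert (Suc i) ?A"
      "i \<notin> ?A" "Suc i \<notin> ?A" using assms j2 by auto
    thus ?thesis by simp
  qed
  have g: "gS n S = (mvar i - mconst c) * P"
    unfolding gS_def P_def c_def using fin assms(2) by (rule prod.remove)
  have "({..<n} - ?S') \<inter> {..<Suc i} = insert i (({..<n} - S) \<inter> {..<i})"
    using assms by (auto simp: less_Suc_eq)
  hence c': "?c ?S' (Suc i) = tt * c" using assms(2) by (simp add: c_def)
  have "gS n ?S' = (mvar (Suc i) - mconst (?c ?S' (Suc i))) * (\<Prod>j\<in>S - {i}. mvar j - mconst (?c ?S' j))"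
    unfolding gS_def using fin assms(3) by (subst prod.insert) auto
  also have "(\<Prod>j\<in>S - {i}. mvar j - mconst (?c ?S' j)) = P"
    unfolding P_def by (rule prod.cong) (rule refl, simp only: same)
  finally have g': "gS n ?S' = (mvar (Suc i) - mconst (tt * c)) * P" unfolding c' .
  have P_sym: "mswap i P = P"
    unfolding P_def mswap_simps using assms(3)
    by (intro prod.cong arg_cong2[of _ _ _ _ "(-)"]) (auto simp: transpose_def)
  have "Ti tt i (mvar i - mconst c) = mvar (Suc i) - mconst (tt * c)"
    by (rule Ti_eqI) (simp add: mconst_diff mconst_mult algebra_simps)
  thus ?thesis unfolding g g' by (simp add: Ti_mult_sym[OF P_sym])
qed

section \<open>Moving the support\<close>

lemma supp_sw:
  assumes "length \<mu> = n" "Suc i < n" "i \<in> S" "Suc i \<notin> S"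
  shows "supp (sw i \<mu>) = insert (Suc i) (S - {i}) \<longleftrightarrow> supp \<mu> = S"
proof -
  let ?s = "adj i"
  have "j \<in> supp (sw i \<mu>) \<longleftrightarrow> ?s j \<in> supp \<mu>" for j
    using assms(1,2) by (auto simp: supp_def nth_sw transpose_def)
  moreover have "j \<in> insert (Suc i) (S - {i}) \<longleftrightarrow> ?s j \<in> S" for j
    using assms(3,4) by (auto simp: transpose_def)
  ultimately show ?thesis by (metis set_eqI transpose_involutory)
qed

definition Fsum :: "nat \<Rightarrow> nat list \<Rightarrow> nat set \<Rightarrow> rat poly fract mpoly" where
  "Fsum n lam S = (\<Sum>\<mu> | \<mu> \<in> rearr n lam \<and> supp \<mu> = S. mspec (G.F n lam \<mu>))"

text \<open>With i in the support and i+1 outside, every summand has a descent to 0 at i, so T_i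
  carries the summands for one support bijectively to those for the other.\<close>

lemma Fsum_step:
  assumes lam: "is_partition n lam" and i: "Suc i < n" "i \<in> S" "Suc i \<notin> S"
  shows "Fsum n lam (insert (Suc i) (S - {i})) = Ti tt i (Fsum n lam S)"
proof -
  let ?A = "{\<mu>. \<mu> \<in> rearr n lam \<and> supp \<mu> = S}"
  let ?A' = "{\<mu>. \<mu> \<in> rearr n lam \<and> supp \<mu> = insert (Suc i) (S - {i})}"
  have len: "length \<mu> = n" if "\<mu> \<in> rearr n lam" for \<mu> using that by (simp add: rearr_def)
  have bij: "bij_betw (sw i) ?A ?A'"
  proof (rule bij_betwI[of _ _ _ "sw i"])
    show "sw i \<in> ?A \<rightarrow> ?A'" using sw_rearr[OF _ i(1)] supp_sw[OF len i] by auto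
    show "sw i \<in> ?A' \<rightarrow> ?A"
    proof
      fix \<mu> assume \<mu>: "\<mu> \<in> ?A'"
      hence "supp (sw i (sw i \<mu>)) = insert (Suc i) (S - {i})" using len[of \<mu>] i by simp
      thus "sw i \<mu> \<in> ?A"
        using \<mu> sw_rearr[of \<mu> n lam i] supp_sw[of "sw i \<mu>" n i S] i len by auto
    qed
  qed (use len i in auto)
  have "Fsum n lam (insert (Suc i) (S - {i})) = (\<Sum>\<mu>\<in>?A. mspec (G.F n lam (sw i \<mu>)))"
    unfolding Fsum_def by (rule sum.reindex_bij_betw[OF bij, symmetric])
  also have "\<dots> = (\<Sum>\<mu>\<in>?A. Ti tt i (mspec (G.F n lam \<mu>)))"
  proof (rule sum.cong)
    fix \<mu> assume "\<mu> \<in> ?A"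
    hence \<mu>: "\<mu> \<in> rearr n lam" "supp \<mu> = S" by auto
    have "\<mu> ! i > 0" "\<mu> ! Suc i = 0" using \<mu> i len[OF \<mu>(1)] unfolding supp_def by auto
    hence "G.F n lam (sw i \<mu>) = Ti tq i (G.F n lam \<mu>)"
      using G.F_step[OF lam \<mu>(1) i(1)] by simp
    thus "mspec (G.F n lam (sw i \<mu>)) = Ti tt i (mspec (G.F n lam \<mu>))"
      using mspec_Ti[OF mspec_ok_fstar[OF lam \<mu>(1)]] by simp
  qed simp
  also have "\<dots> = Ti tt i (Fsum n lam S)" unfolding Fsum_def by (rule Ti_sum[symmetric])
  finally show ?thesis .
qed

text \<open>Any S other than an initial segment has an element directly above a gap; moving it down
  lowers the sum of the elements of S by one. The cofactor is symmetric, so T_i acts on the product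
  over S alone. The initial segment is the collapsed sum.\<close>

lemma Fsum_factor:
  assumes lam: "is_partition n lam"
  shows "S \<subseteq> {..<n} \<Longrightarrow> card S = card (supp lam) \<Longrightarrow> Fsum n lam S = gS n S * eps n (rev (strip lam))"
proof (induction "\<Sum>S" arbitrary: S rule: less_induct)
  case less
  let ?k = "card (supp lam)"
  note parts = partition_parts[OF lam refl]
  have fin: "finite S" using less(2) finite_subset by blast
  show ?case
  proof (cases "\<exists>i. Suc i \<in> S \<and> i \<notin> S")
    case False
    hence S: "S = {..<?k}" using down_closed_nat_set[OF fin] less(3) by metis
    have "mspec (G.hsum n lam ?k) = (\<Sum>\<mu>\<in>Bset n lam ?k. mspec (G.F n lam \<mu>))"
      unfolding G.hsum_def using mspec_ok_fstar[OF lam Bset_rearr] by (rule mspec_sum)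
    also have "\<dots> = Fsum n lam S" unfolding Fsum_def S Bset_supp[OF lam refl] ..
    finally have "Fsum n lam S = mspec (G.hsum n lam ?k)" by simp
    also have "\<dots> = eps n (rev_upto ?k lam)"
      using parts by (intro mspec_hsum[OF lam]) auto
    finally show ?thesis unfolding eps_leading_block[OF lam refl] S .
  next
    case True
    then obtain i where i: "Suc i \<in> S" "i \<notin> S" by blast
    define S0 where "S0 = insert i (S - {Suc i})"
    have S0: "S = insert (Suc i) (S0 - {i})" using i by (auto simp: S0_def)
    have i0: "i \<in> S0" "Suc i \<notin> S0" "Suc i < n" using i less(2) by (auto simp: S0_def)
    have sub: "S0 \<subseteq> {..<n}" using less(2) i0 by (auto simp: S0_def)
    have "card S0 = Suc (card (S - {Suc i}))"
      unfolding S0_def using fin i by (intro card_insert_disjoint) auto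
    also have "\<dots> = card S" by (rule card_Suc_Diff1[OF fin i(1)])
    finally have "card S0 = card S" .
    moreover have "\<Sum>S0 < \<Sum>S"
    proof -
      have "\<Sum>S0 = i + \<Sum>(S - {Suc i})" using fin i by (simp add: S0_def)
      moreover have "\<Sum>S = Suc i + \<Sum>(S - {Suc i})" using fin i(1) by (rule sum.remove)
      ultimately show ?thesis by simp
    qed
    ultimately have IH: "Fsum n lam S0 = gS n S0 * eps n (rev (strip lam))" using less sub by simp
    have sym: "mswap i (eps n (rev (strip lam))) = eps n (rev (strip lam))"
      unfolding mswap_def using eps_antidominant_sym[OF strip_partition[OF lam] adj_permutes[OF i0(3)]] .
    have "Fsum n lam S = Ti tt i (Fsum n lam S0)"
      using Fsum_step[OF lam i0(3,1,2)] S0 by simp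
    also have "\<dots> = gS n S * eps n (rev (strip lam))"
      unfolding IH Ti_mult_sym[OF sym] using gS_step[OF sub i0] S0 by simp
    finally show ?thesis .
  qed
qed

text \<open>Grouping the rearrangements by support leaves the same cofactor in each group, and the
  products over S add up to e*.\<close>

lemma eps_antidominant_step:
  assumes lam: "is_partition n lam"
  shows "eps n (rev lam) = estar tt n (card (supp lam)) * eps n (rev (strip lam))"
proof -
  let ?T = "{S. S \<subseteq> {..<n} \<and> card S = card (supp lam)}"
  have finT: "finite ?T" by (rule finite_subset[of _ "Pow {..<n}"]) auto
  have "eps n (rev lam) = (\<Sum>\<mu>\<in>rearr n lam. mspec (G.F n lam \<mu>))"
    unfolding mspec_hsum_full(2)[OF lam, symmetric] G.hsum_def Bset_n
    using mspec_ok_fstar[OF lam] by (rule mspec_sum)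
  also have "\<dots> = (\<Sum>S\<in>?T. \<Sum>\<mu> | \<mu> \<in> rearr n lam \<and> supp \<mu> = S. mspec (G.F n lam \<mu>))"
  proof (rule sum.group[OF finite_rearr finT, symmetric], rule image_subsetI)
    fix \<mu> assume \<mu>: "\<mu> \<in> rearr n lam"
    thus "supp \<mu> \<in> ?T" using rearr_card_supp[OF \<mu>] by (auto simp: supp_def rearr_def)
  qed
  also have "\<dots> = (\<Sum>S\<in>?T. gS n S * eps n (rev (strip lam)))"
    using Fsum_factor[OF lam] unfolding Fsum_def by (intro sum.cong) auto
  also have "\<dots> = estar tt n (card (supp lam)) * eps n (rev (strip lam))"
    by (simp add: estar_def gS_def sum_distrib_right)
  finally show ?thesis .
qed

lemma first_part_strip: "first_part (strip lam) = first_part lam - 1"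
proof -
  have "Max ((\<lambda>x. x - 1) ` insert 0 (set lam)) = (\<lambda>x. x - 1) (Max (insert 0 (set lam)))"
    by (rule mono_Max_commute[symmetric]) (auto simp: mono_def)
  thus ?thesis by (simp add: first_part_def strip_def)
qed

lemma conj_part_strip: "1 \<le> i \<Longrightarrow> conj_part (strip lam) i = conj_part lam (Suc i)"
  unfolding conj_part_def by (rule arg_cong[of _ _ card]) (auto simp: strip_def)

lemma conj_part_1: "conj_part lam 1 = card (supp lam)"
  unfolding conj_part_def supp_def by (rule arg_cong[of _ _ card]) auto

lemma prod_estar_strip:
  "(\<Prod>i\<in>{1..first_part (strip lam)}. estar tt n (conj_part (strip lam) i)) =
    (\<Prod>i\<in>{2..first_part lam}. estar tt n (conj_part lam i))"
proof (rule prod.reindex_bij_witness[of _ "\<lambda>i. i - 1" Suc])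
  fix i assume "i \<in> {1..first_part (strip lam)}"
  thus "estar tt n (conj_part lam (Suc i)) = estar tt n (conj_part (strip lam) i)"
    by (simp add: conj_part_strip)
qed (auto simp: first_part_strip)

lemma first_part_0:
  assumes "first_part lam = 0" "length lam = n"
  shows "lam = replicate n 0"
proof -
  have "x \<le> first_part lam" if "x \<in> set lam" for x
    unfolding first_part_def using that by (intro Max_ge) auto
  thus ?thesis using assms by (intro replicate_eqI) auto
qed

text \<open>One column is split off at a time, the length of the first being the number of positive
  parts.\<close>

lemma eps_antidominant:
  "is_partition n lam \<Longrightarrow> eps n (rev lam) = (\<Prod>i\<in>{1..first_part lam}. estar tt n (conj_part lam i))"
proof (induction "first_part lam" arbitrary: lam)
  case 0
  hence "lam = replicate n 0" by (intro first_part_0) (auto simp: is_partition_def)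
  thus ?case using 0 by (simp add: eps_def G.E_zero mspec_1)
next
  case (Suc m)
  have "eps n (rev (strip lam)) = (\<Prod>i\<in>{2..first_part lam}. estar tt n (conj_part lam i))"
    using Suc(1)[of "strip lam"] Suc(2,3) strip_partition[of n lam]
    by (simp add: first_part_strip prod_estar_strip[symmetric])
  moreover have "{1..first_part lam} = insert 1 {2..first_part lam}" using Suc(2) by auto
  ultimately show ?case
    using eps_antidominant_step[OF Suc(3)] conj_part_1[of lam] by simp
qed

section \<open>The symmetric polynomials\<close>

lemma (in generic_params) symmetric_val:
  assumes r: "symmetric_mp n r" "in_vars n r" and "is_partition n \<mu>" "\<nu> \<in> rearr n \<mu>"
  shows "meval r (pt \<nu>) = meval r (pt \<mu>)"
  using assms(3,4)
proof (induction \<nu> rule: rearr_induct)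
  case (step \<xi> i)
  have "mswap i r = r" using r(1) adj_permutes[OF step(3)] by (simp add: symmetric_mp_def mswap_def)
  thus ?case using val_sw_sym[OF _ r(2) step(2,3)] step(6) by simp
qed simp

lemma sort_desc_partition:
  assumes "length \<nu> = n"
  shows "is_partition n (rev (sort \<nu>))" "\<nu> \<in> rearr n (rev (sort \<nu>))"
  using assms by (simp_all add: is_partition_def rearr_def sorted_wrt_rev)

text \<open>P* is normalised at the partition, whereas the collapsed sum is monic at its reversal;
  symmetry identifies the two coefficients.\<close>

lemma coeff_symmetric_rev:
  assumes "symmetric_mp n p" "length lam = n"
  shows "coeff_at p (mmon (rev lam)) = coeff_at p (mmon lam)"
proof -
  define \<sigma> where "\<sigma> = (\<lambda>j. if j < n then n - Suc j else j)"
  have \<sigma>: "\<sigma> permutes {..<n}"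
    by (rule bij_imp_permutes, rule bij_betwI[of _ _ _ \<sigma>]) (auto simp: \<sigma>_def)
  have b: "bij \<sigma>" using \<sigma> by (rule permutes_bij)
  have "mon_perm \<sigma> (mmon lam) = mmon (rev lam)"
    by (rule mon_perm_eqI[OF b]) (use assms(2) in \<open>auto simp: expo_mmon[of _ n] \<sigma>_def rev_nth\<close>)
  thus ?thesis
    using coeff_mperm[OF b, of p "mmon lam"] assms(1) \<sigma> by (simp add: symmetric_mp_def)
qed

text \<open>The sum of f* over all rearrangements meets every condition on P* except the
  normalisation. The constant \<open>c\<close> is not computed over Q(q,t): it suffices that it
  becomes 1 at q = 1, where the sum becomes a monic E*.\<close>

lemma Pstar_eq:
  assumes lam: "is_partition n lam"
  defines "P \<equiv> G.hsum n lam n" and "c \<equiv> coeff_at (G.hsum n lam n) (mmon lam)"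
  shows "spec_ok c" "spec c = 1" "Pstar qq tq n lam = mconst (1 / c) * P"
proof -
  have len: "length lam = n" using lam by (simp add: is_partition_def)
  note sym = hsum_full_symmetric[OF lam] and props = G.hsum_props[OF lam, of n] and sp = mspec_hsum_full[OF lam]
  have c: "c = coeff_at P (mmon (rev lam))" unfolding c_def P_def using coeff_symmetric_rev[OF sym len] by simp
  show ok: "spec_ok c" using sp(1) by (simp add: c_def mspec_ok_def)
  have "spec c = coeff_at (eps n (rev lam)) (mmon (rev lam))"
    unfolding c P_def sp(2)[symmetric] by (simp add: coeff_mspec)
  also have "\<dots> = 1" unfolding eps_def coeff_mspec using len by (simp add: G.E_props(3) spec_1)
  finally show spc: "spec c = 1" .
  hence c0: "c \<noteq> 0" using spec_0 by auto
  have val: "meval P (G.pt \<nu>) = (if \<nu> \<in> rearr n lam then G.H n (rev lam) else 0)"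
    if \<nu>: "length \<nu> = n" "sum_list \<nu> \<le> sum_list lam" for \<nu>
  proof (cases "\<nu> \<in> rearr n lam")
    case True
    thus ?thesis unfolding P_def
      using G.hsum_val[OF lam order_refl, of \<nu>] rev_upto_n[OF len] by (simp add: Bset_n)
  next
    case False
    thus ?thesis unfolding P_def G.hsum_def meval_simps
      using G.F_val_outside[OF lam order_refl _ \<nu>] by (auto simp: Bset_n intro!: sum.neutral)
  qed
  have H0: "G.H n (rev lam) \<noteq> 0" using G.H_nz[of "rev lam"] len by simp
  show "Pstar qq tq n lam = mconst (1 / c) * P"
    unfolding Pstar_def
  proof (rule the_equality, intro conjI allI impI)
    show "in_vars n (mconst (1 / c) * P)" "total_deg_le (mconst (1 / c) * P) (sum_list lam)"
      using props by (auto simp: P_def)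
    show "symmetric_mp n (mconst (1 / c) * P)" using sym by (simp add: symmetric_mp_def P_def)
    show "coeff_at (mconst (1 / c) * P) (mmon lam) = 1" using c0 by (simp add: c_def P_def)
    fix \<nu> assume \<nu>: "is_partition n \<nu> \<and> \<nu> \<noteq> lam \<and> sum_list \<nu> \<le> sum_list lam"
    have "\<nu> \<notin> rearr n lam"
      using \<nu> lam sorted_desc_unique[of \<nu> lam] by (auto simp: is_partition_def rearr_def)
    thus "meval (mconst (1 / c) * P) (G.pt \<nu>) = 0"
      using val[of \<nu>] \<nu> by (simp add: is_partition_def)
  next
    fix r assume r: "in_vars n r \<and> symmetric_mp n r \<and> total_deg_le r (sum_list lam) \<and>
      coeff_at r (mmon lam) = 1 \<and>
      (\<forall>\<nu>. is_partition n \<nu> \<and> \<nu> \<noteq> lam \<and> sum_list \<nu> \<le> sum_list lam \<longrightarrow> meval r (G.pt \<nu>) = 0)"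
    \<comment> \<open>The sum takes the value H of the reversed partition at all rearrangements of
      \<open>lam\<close>, so this scalar matches \<open>r\<close> there.\<close>
    define d where "d = meval r (G.pt lam) / G.H n (rev lam)"
    have eq: "r = mconst d * P"
    proof (rule G.interp_unique[of n _ "sum_list lam"])
      fix \<nu> assume \<nu>: "length \<nu> = n" "sum_list \<nu> \<le> sum_list lam"
      show "meval r (G.pt \<nu>) = meval (mconst d * P) (G.pt \<nu>)"
      proof (cases "\<nu> \<in> rearr n lam")
        case True
        thus ?thesis using val[OF \<nu>] G.symmetric_val[OF _ _ lam True, of r] r H0 by (simp add: d_def)
      next
        case False
        \<comment> \<open>By symmetry \<open>r\<close> has the same value at the sorted composition,
          a partition other than \<open>lam\<close> of the same size as \<open>\<nu>\<close>, where
          it vanishes.\<close>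
        let ?\<mu> = "rev (sort \<nu>)"
        note s = sort_desc_partition[OF \<nu>(1)]
        have "?\<mu> \<noteq> lam" using False s(2) by auto
        moreover have "sum_list ?\<mu> = sum_list \<nu>" using rearr_sum_list[OF s(2)] by simp
        ultimately have "meval r (G.pt ?\<mu>) = 0" using r s(1) \<nu>(2) by simp
        thus ?thesis using val[OF \<nu>] G.symmetric_val[OF _ _ s, of r] r False by simp
      qed
    qed (use r props in \<open>auto simp: P_def\<close>)
    have "d * c = 1" using r arg_cong[OF eq, of "\<lambda>x. coeff_at x (mmon lam)"] by (simp add: c_def P_def)
    hence "d = 1 / c" using c0 by (simp add: field_simps)
    thus "r = mconst (1 / c) * P" using eq by simp
  qed
qed

lemma mspec_Pstar:
  assumes lam: "is_partition n lam"
  shows "mspec_ok (Pstar qq tq n lam)"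
    "mspec (Pstar qq tq n lam) = (\<Prod>i\<in>{1..first_part lam}. estar tt n (conj_part lam i))"
proof -
  note P = Pstar_eq[OF lam] and sp = mspec_hsum_full[OF lam]
  let ?c = "coeff_at (G.hsum n lam n) (mmon lam)"
  have c: "spec_ok (1 / ?c)" "spec (1 / ?c) = 1"
    using spec_divide[OF spec_1(1) P(1)] P(2) by (simp_all add: spec_1)
  show "mspec_ok (Pstar qq tq n lam)"
    unfolding P(3) using c sp by (simp add: mspec_ok_iff sok.coeffs_in_cmult)
  show "mspec (Pstar qq tq n lam) = (\<Prod>i\<in>{1..first_part lam}. estar tt n (conj_part lam i))"
    unfolding P(3) mspec_cmult[OF c(1) sp(1)] c(2) sp(2) by (simp add: eps_antidominant[OF lam])
qed

lemma mspec_Pstar_column: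
  assumes "1 \<le> k" "k \<le> n"
  shows "mspec_ok (Pstar qq tq n (replicate k 1 @ replicate (n - k) 0))"
    "mspec (Pstar qq tq n (replicate k 1 @ replicate (n - k) 0)) = estar tt n k"
proof -
  let ?col = "replicate k 1 @ replicate (n - k) (0::nat)"
  have nth: "?col ! j = (if j < k then 1 else 0)" if "j < n" for j
    using that assms by (auto simp: nth_append)
  have len: "length ?col = n" using assms by simp
  have part: "is_partition n ?col"
    unfolding is_partition_def sorted_desc_iff_adjacent len using nth by simp
  have "set ?col \<subseteq> {0, 1}" "1 \<in> set ?col" using assms by auto
  hence "insert 0 (set ?col) = {0, 1}" by auto
  hence fp: "first_part ?col = 1" unfolding first_part_def by simp
  have "{j. j < length ?col \<and> 1 \<le> ?col ! j} = {..<k}"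
    unfolding len using nth assms(2) by (auto split: if_splits)
  hence "conj_part ?col 1 = k" unfolding conj_part_def by simp
  thus "mspec_ok (Pstar qq tq n ?col)" "mspec (Pstar qq tq n ?col) = estar tt n k"
    using mspec_Pstar[OF part] fp by simp_all
qed

lemma conj_part_bounds:
  assumes "length lam = n" "i \<in> {1..first_part lam}"
  shows "1 \<le> conj_part lam i" "conj_part lam i \<le> n"
proof -
  have "first_part lam \<in> insert 0 (set lam)" unfolding first_part_def by (rule Max_in) auto
  hence "first_part lam \<in> set lam" using assms by auto
  then obtain j where "j < length lam" "lam ! j = first_part lam" by (metis in_set_conv_nth)
  hence "j \<in> {j. j < length lam \<and> i \<le> lam ! j}" using assms by simp
  moreover have fin: "finite {j. j < length lam \<and> i \<le> lam ! j}" by simp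
  ultimately show "1 \<le> conj_part lam i"
    unfolding conj_part_def by (metis One_nat_def Suc_leI card_gt_0_iff empty_iff)
  have "conj_part lam i \<le> card {..<length lam}" unfolding conj_part_def by (rule card_mono) auto
  thus "conj_part lam i \<le> n" using assms by simp
qed

theorem theorem7p1:
  fixes n :: nat
  shows "(\<forall>lam S. is_partition n lam \<and> 0 < first_part lam \<and> S \<subseteq> {..<n} \<and> card S = card (supp lam) \<longrightarrow>
            (\<forall>\<mu>\<in>rearr n lam. mspec_ok (fstar qq tq n lam \<mu>)) \<and>
            (\<Sum>\<mu> | \<mu> \<in> rearr n lam \<and> supp \<mu> = S. mspec (fstar qq tq n lam \<mu>)) =
              (\<Prod>i\<in>S. mvar i - mconst (tt ^ card (({..<n} - S) \<inter> {..<i}) / tt ^ (n - 1))) *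
              (\<Prod>i\<in>{2..first_part lam}. estar tt n (conj_part lam i)))
       \<and> (\<forall>lam. is_partition n lam \<longrightarrow>
            mspec_ok (Pstar qq tq n lam) \<and>
            (\<forall>i\<in>{1..first_part lam}.
               mspec_ok (Pstar qq tq n (replicate (conj_part lam i) 1 @ replicate (n - conj_part lam i) 0))) \<and>
            mspec (Pstar qq tq n lam) =
              (\<Prod>i\<in>{1..first_part lam}.
                 mspec (Pstar qq tq n (replicate (conj_part lam i) 1 @ replicate (n - conj_part lam i) 0))) \<and>
            (\<Prod>i\<in>{1..first_part lam}.
                 mspec (Pstar qq tq n (replicate (conj_part lam i) 1 @ replicate (n - conj_part lam i) 0))) =
              (\<Prod>i\<in>{1..first_part lam}. estar tt n (conj_part lam i)))"
proof (intro conjI allI impI)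
  fix lam S
  assume asm: "is_partition n lam \<and> 0 < first_part lam \<and> S \<subseteq> {..<n} \<and> card S = card (supp lam)"
  thus "\<forall>\<mu>\<in>rearr n lam. mspec_ok (fstar qq tq n lam \<mu>)" using mspec_ok_fstar by blast
  \<comment> \<open>The columns of the stripped partition are those of \<open>lam\<close> from the
    second on.\<close>
  have "eps n (rev (strip lam)) = (\<Prod>i\<in>{2..first_part lam}. estar tt n (conj_part lam i))"
    using eps_antidominant[OF strip_partition[of n lam]] asm prod_estar_strip by simp
  thus "(\<Sum>\<mu> | \<mu> \<in> rearr n lam \<and> supp \<mu> = S. mspec (fstar qq tq n lam \<mu>)) =
      (\<Prod>i\<in>S. mvar i - mconst (tt ^ card (({..<n} - S) \<inter> {..<i}) / tt ^ (n - 1))) *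
      (\<Prod>i\<in>{2..first_part lam}. estar tt n (conj_part lam i))"
    using Fsum_factor[of n lam S] asm unfolding Fsum_def gS_def by simp
next
  fix lam assume lam: "is_partition n lam"
  hence len: "length lam = n" by (simp add: is_partition_def)
  show "mspec_ok (Pstar qq tq n lam)" by (rule mspec_Pstar(1)[OF lam])
  show "\<forall>i\<in>{1..first_part lam}.
      mspec_ok (Pstar qq tq n (replicate (conj_part lam i) 1 @ replicate (n - conj_part lam i) 0))"
    using mspec_Pstar_column(1) conj_part_bounds[OF len] by blast
  show *: "(\<Prod>i\<in>{1..first_part lam}.
      mspec (Pstar qq tq n (replicate (conj_part lam i) 1 @ replicate (n - conj_part lam i) 0))) =
      (\<Prod>i\<in>{1..first_part lam}. estar tt n (conj_part lam i))"
    using mspec_Pstar_column(2) conj_part_bounds[OF len] by (intro prod.cong) auto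
  show "mspec (Pstar qq tq n lam) = (\<Prod>i\<in>{1..first_part lam}.
      mspec (Pstar qq tq n (replicate (conj_part lam i) 1 @ replicate (n - conj_part lam i) 0)))"
    unfolding * by (rule mspec_Pstar(2)[OF lam])
qed

end
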